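(* Let $1<p<\infty$, $n\ge 1$, and let $f\in C([0,\infty))$ and $g\in C^{0,1}([0,\infty))$ be strictly increasing with $f(0)=g(0)=0$. Set $F(s)=\int_0^s f(t)\,dt$. (i) If either $$\int_1^\infty \frac{ds}{F(s)^{1/p}}<+\infty \qquad\text{or}\qquad \int_1^\infty \frac{s^{p-2}\,ds}{g(s)}<+\infty,$$ then every nonnegative weak subsolution $u\in W^{1,\infty}_{\mathrm{loc}}(\mathbb{R}^n)$ of $$\Delta_p u=f(u)+g(|\nabla u|)\quad\text{in }\mathbb{R}^n$$ is identically zero. (ii) If $$\int_1^\infty \frac{ds}{F(s)^{1/p}}=+\infty \qquad\text{and}\qquad \int_1^\infty \frac{s^{p-2}\,ds}{g(s)}=+\infty,$$ and there exist numbers $A_0,\varepsilon_0>0$ such that for all $A\ge A_0$ either $$p\le 2\ \text{ and }\ \liminf_{s\to\infty}\frac{g\big(A\,F(s)^{1/p}\big)}{A^p f(s)}>\frac1p+\varepsilon_0,$$ or $$p\ge 2\ \text{ and }\ \limsup_{s\to\infty}\frac{g\big(A\,F(s)^{1/p}\big)}{A^p f(s)}<\frac1p-\varepsilon_0,$$ then the equation $\Delta_p u=f(u)+g(|\nabla u|)$ in $\mathbb{R}^n$ has at least one positive solution.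
   Context: $\Delta_p u:=\operatorname{div}(|\nabla u|^{p-2}\nabla u)$ is the $p$-Laplacian, $1<p<\infty$. A function $u\in W^{1,p}_{\mathrm{loc}}(\mathbb{R}^n)$ is a weak subsolution of $\Delta_p u=f(u)+g(|\nabla u|)$ in $\mathbb{R}^n$ if $$\int_{\mathbb{R}^n}|\nabla u|^{p-2}\nabla u\cdot\nabla\phi\,dx\le -\int_{\mathbb{R}^n}\big(f(u)+g(|\nabla u|)\big)\phi\,dx$$ for every $\phi\in C_c^\infty(\mathbb{R}^n)$ with $\phi\ge 0$; a weak supersolution satisfies the opposite inequality, and a weak solution is both. *)

theory Defs
  imports "HOL-Analysis.Analysis"
begin

(* Points of R^n are elements of real^'n, 'n a finite index type (n = CARD('n) >= 1). *)

definition partial_deriv :: "'n::finite \<Rightarrow> (real^'n \<Rightarrow> real) \<Rightarrow> (real^'n \<Rightarrow> real)" where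
  "partial_deriv i \<phi> = (\<lambda>x. frechet_derivative \<phi> (at x) (axis i 1))"

definition grad :: "(real^'n::finite \<Rightarrow> real) \<Rightarrow> real^'n \<Rightarrow> real^'n" where
  "grad \<phi> x = (\<chi> i. partial_deriv i \<phi> x)"

definition smooth_fun :: "(real^'n::finite \<Rightarrow> real) \<Rightarrow> bool" where
  "smooth_fun \<phi> \<longleftrightarrow> (\<forall>is::'n list. \<forall>x. (fold partial_deriv is \<phi>) differentiable (at x))"

definition test_fun :: "(real^'n::finite \<Rightarrow> real) \<Rightarrow> bool" where
  "test_fun \<phi> \<longleftrightarrow> smooth_fun \<phi> \<and> compact (closure {x. \<phi> x \<noteq> 0})"

definition Lp_loc :: "real \<Rightarrow> (real^'n::finite \<Rightarrow> real) \<Rightarrow> bool" where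
  "Lp_loc p u \<longleftrightarrow> u \<in> borel_measurable lborel \<and>
     (\<forall>K. compact K \<longrightarrow> set_integrable lborel K (\<lambda>x. \<bar>u x\<bar> powr p))"

definition Linf_loc :: "(real^'n::finite \<Rightarrow> real) \<Rightarrow> bool" where
  "Linf_loc u \<longleftrightarrow> u \<in> borel_measurable lborel \<and>
     (\<forall>K. compact K \<longrightarrow> (\<exists>C. AE x in lborel. x \<in> K \<longrightarrow> \<bar>u x\<bar> \<le> C))"

definition has_weak_gradient :: "(real^'n::finite \<Rightarrow> real) \<Rightarrow> (real^'n \<Rightarrow> real^'n) \<Rightarrow> bool" where
  "has_weak_gradient u Du \<longleftrightarrow> Du \<in> borel_measurable lborel \<and>
     (\<forall>\<phi>. test_fun \<phi> \<longrightarrow> (\<forall>i.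
        (LINT x|lborel. u x * partial_deriv i \<phi> x) = - (LINT x|lborel. (Du x $ i) * \<phi> x)))"

definition W1p_loc :: "real \<Rightarrow> (real^'n::finite \<Rightarrow> real) \<Rightarrow> (real^'n \<Rightarrow> real^'n) \<Rightarrow> bool" where
  "W1p_loc p u Du \<longleftrightarrow> Lp_loc p u \<and> Lp_loc p (\<lambda>x. norm (Du x)) \<and> has_weak_gradient u Du"

definition W1inf_loc :: "(real^'n::finite \<Rightarrow> real) \<Rightarrow> (real^'n \<Rightarrow> real^'n) \<Rightarrow> bool" where
  "W1inf_loc u Du \<longleftrightarrow> Linf_loc u \<and> Linf_loc (\<lambda>x. norm (Du x)) \<and> has_weak_gradient u Du"

(* the two sides of the weak formulation of  Delta_p u = f(u) + g(|grad u|)  tested with phi *)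
definition plap_lhs :: "real \<Rightarrow> (real^'n::finite \<Rightarrow> real^'n) \<Rightarrow> (real^'n \<Rightarrow> real) \<Rightarrow> (real^'n \<Rightarrow> real)" where
  "plap_lhs p Du \<phi> = (\<lambda>x. (norm (Du x) powr (p - 2)) * (Du x \<bullet> grad \<phi> x))"

definition plap_rhs :: "(real \<Rightarrow> real) \<Rightarrow> (real \<Rightarrow> real) \<Rightarrow> (real^'n::finite \<Rightarrow> real) \<Rightarrow>
     (real^'n \<Rightarrow> real^'n) \<Rightarrow> (real^'n \<Rightarrow> real) \<Rightarrow> (real^'n \<Rightarrow> real)" where
  "plap_rhs f g u Du \<phi> = (\<lambda>x. (f (u x) + g (norm (Du x))) * \<phi> x)"

definition weak_subsolution :: "real \<Rightarrow> (real \<Rightarrow> real) \<Rightarrow> (real \<Rightarrow> real) \<Rightarrow>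
     (real^'n::finite \<Rightarrow> real) \<Rightarrow> (real^'n \<Rightarrow> real^'n) \<Rightarrow> bool" where
  "weak_subsolution p f g u Du \<longleftrightarrow> W1p_loc p u Du \<and>
     (\<forall>\<phi>. test_fun \<phi> \<and> (\<forall>x. \<phi> x \<ge> 0) \<longrightarrow>
        integrable lborel (plap_lhs p Du \<phi>) \<and> integrable lborel (plap_rhs f g u Du \<phi>) \<and>
        (LINT x|lborel. plap_lhs p Du \<phi> x) \<le> - (LINT x|lborel. plap_rhs f g u Du \<phi> x))"

definition weak_supersolution :: "real \<Rightarrow> (real \<Rightarrow> real) \<Rightarrow> (real \<Rightarrow> real) \<Rightarrow>
     (real^'n::finite \<Rightarrow> real) \<Rightarrow> (real^'n \<Rightarrow> real^'n) \<Rightarrow> bool" where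
  "weak_supersolution p f g u Du \<longleftrightarrow> W1p_loc p u Du \<and>
     (\<forall>\<phi>. test_fun \<phi> \<and> (\<forall>x. \<phi> x \<ge> 0) \<longrightarrow>
        integrable lborel (plap_lhs p Du \<phi>) \<and> integrable lborel (plap_rhs f g u Du \<phi>) \<and>
        (LINT x|lborel. plap_lhs p Du \<phi> x) \<ge> - (LINT x|lborel. plap_rhs f g u Du \<phi> x))"

definition weak_solution :: "real \<Rightarrow> (real \<Rightarrow> real) \<Rightarrow> (real \<Rightarrow> real) \<Rightarrow>
     (real^'n::finite \<Rightarrow> real) \<Rightarrow> (real^'n \<Rightarrow> real^'n) \<Rightarrow> bool" where
  "weak_solution p f g u Du \<longleftrightarrow> weak_subsolution p f g u Du \<and> weak_supersolution p f g u Du"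

definition primF :: "(real \<Rightarrow> real) \<Rightarrow> real \<Rightarrow> real" where
  "primF f s = integral {0..s} f"

definition loc_lipschitz_nonneg :: "(real \<Rightarrow> real) \<Rightarrow> bool" where
  "loc_lipschitz_nonneg g \<longleftrightarrow> (\<forall>T\<ge>0. \<exists>L. L-lipschitz_on {0..T} g)"

end

theory Submission
  imports Defs
begin

text \<open>
  \<^emph>\<open>Part (ii).\<close> A radial function \<open>v(r)\<close> with \<open>w = (v')^(p-1)\<close> solves the equation iff \<open>r^(n-1) w(r)\<close> is the
  integral of \<open>s^(n-1) (f(v) + g(v'))\<close> over \<open>[0, r]\<close>. This system is monotone in \<open>(v, w)\<close>, so Picard iteration from
  below converges as soon as there is a global upper solution, and it suffices to have one for the
  one-dimensional inequality \<open>((V')^(p-1))' \<ge> f(V) + g(V')\<close>. In the limsup case \<open>V' = A F(V)^(1/p)\<close> works for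
  large \<open>A\<close>; in the liminf case one solves \<open>((V')^(p-1))' = C g(V')\<close> and shows that \<open>V' \<ge> A F(V)^(1/p)\<close> is preserved.

  \<^emph>\<open>Part (i).\<close> Truncating \<open>f(v) + g(v')\<close> at a high level gives, for every \<open>\<epsilon> > 0\<close>, a global radial supersolution
  \<open>V\<close> with \<open>V = \<epsilon>\<close> at the centre; the integral condition forces its slope above any given \<open>K\<close> before a
  radius \<open>R\<close> that does not depend on \<open>K\<close>. Taking for \<open>K\<close> a Lipschitz constant of \<open>u\<close>, the difference \<open>u - V\<close>
  has its maximum \<open>M\<close> inside the ball, and if \<open>M\<close> were positive, testing with the square of the positive part of
  \<open>u - V - M + \<eta>\<close> would contradict the strict monotonicity of \<open>f\<close> and of the flux. Hence \<open>u \<le> \<epsilon>\<close> at every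
  centre. Since \<open>u\<close> is only a Sobolev function, the test functions are built from its mollifications.
\<close>

section \<open>Scalar and radial ordinary differential equations\<close>

text \<open>For p > 2 the inverse of t^(p-1) is only Hoelder continuous at 0, and f is merely
  continuous, so no Lipschitz existence theory applies to the radial equation; monotonicity in (v,
  w) replaces it. One-dimensional upper solutions suffice in every dimension because the weight
  (s/r)^(n-1) is at most 1. Conversely, a nondecreasing source h gives w' >= h/n, so the dimension
  costs only a factor in the blow-up estimates.

  In part (i) the uncapped radial solution would cease to exist at a finite radius; capping the
  source keeps it global and preserves the supersolution inequality. The radius must be chosen
  before the slope K, since K bounds the gradient of u on a ball of comparable radius.

  The gradient term obstructs the comparison: where u exceeds V by a fixed amount, f(u) - f(V) is at
  least some c > 0, but g(|Du|) - g(|DV|) may be as low as -L |Du - DV|. Squaring the positive part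
  supplies an extra factor s <= \<eta>, by which the flux term absorbs this loss. The test function
  carries mollified gradients, so the flux term has a favourable sign only in the limit.\<close>

lemma integral_unbounded_if_not_integrable_on:
  fixes \<psi> :: "real \<Rightarrow> real"
  assumes cont: "continuous_on {1..} \<psi>" and nonneg: "\<And>s. s \<ge> 1 \<Longrightarrow> \<psi> s \<ge> 0"
    and nint: "\<not> \<psi> integrable_on {1..}" and a: "a \<ge> 1"
  shows "\<exists>s\<ge>a. integral {a..s} \<psi> \<ge> C"
proof (rule ccontr)
  assume "\<not> ?thesis"
  then have bdd: "integral {a..s} \<psi> < C" if "s \<ge> a" for s using that by force
  have int: "\<psi> integrable_on {x..y}" if "x \<ge> 1" for x y
    by (intro integrable_continuous_real continuous_on_subset[OF cont]) (use that in auto)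
  have mono: "integral {a..x} \<psi> \<le> integral {a..y} \<psi>" if "x \<le> y" for x y
    by (intro integral_subset_le int a) (use that a nonneg in auto)
  have bd: "bdd_above (range (\<lambda>y. integral {a..y} \<psi>))"
  proof (rule bdd_aboveI2)
    show "integral {a..y} \<psi> \<le> C" for y
      using mono[of y "max y a"] bdd[of "max y a"] by auto
  qed
  have "((\<lambda>y. integral {a..y} \<psi>) \<longlongrightarrow> (SUP y. integral {a..y} \<psi>)) at_top"
  proof (rule increasing_tendsto)
    show "\<forall>\<^sub>F y in at_top. integral {a..y} \<psi> \<le> (SUP y. integral {a..y} \<psi>)"
      by (intro always_eventually allI cSUP_upper bd) auto
    fix x assume "x < (SUP y. integral {a..y} \<psi>)"
    then obtain y where "x < integral {a..y} \<psi>"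
      using less_cSUP_iff[OF _ bd] by auto
    then have "x < integral {a..z} \<psi>" if "z \<ge> y" for z using mono[OF that] by simp
    then show "\<forall>\<^sub>F y in at_top. x < integral {a..y} \<psi>"
      using eventually_at_top_linorder by blast
  qed
  then have 1: "(\<psi> has_integral (SUP y. integral {a..y} \<psi>)) {a..}"
    by (intro has_integral_to_inf int a) (use a nonneg in auto)
  have 2: "(\<psi> has_integral integral {1..a} \<psi>) {1..a}"
    using int[of 1 a] by (simp add: integrable_integral)
  have "(\<psi> has_integral (integral {1..a} \<psi> + (SUP y. integral {a..y} \<psi>))) ({1..a} \<union> {a..})"
    by (rule has_integral_Un[OF 2 1]) (auto intro: negligible_subset[of "{a}"])
  moreover have "{1..a} \<union> {a..} = {1..}" using a by auto
  ultimately show False using nint by auto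
qed

text \<open>Integrability is given from 1 on, whereas the blow-up estimates start at an arbitrary a
  > 0, possibly below 1; hence the passage through \<open>min a 1\<close>.\<close>

lemma integral_bounded_if_integrable_on:
  fixes \<psi> :: "real \<Rightarrow> real"
  assumes cont: "continuous_on {0<..} \<psi>" and nonneg: "\<And>s. s > 0 \<Longrightarrow> \<psi> s \<ge> 0"
    and int1: "\<psi> integrable_on {1..}" and a: "a > 0"
  shows "\<exists>C. \<forall>s\<ge>a. integral {a..s} \<psi> \<le> C"
proof -
  have int: "\<psi> integrable_on {x..y}" if "x > 0" for x y
    by (intro integrable_continuous_real continuous_on_subset[OF cont]) (use that in auto)
  define c where "c = min a 1"
  have c: "c > 0" "c \<le> 1" "c \<le> a" using a by (auto simp: c_def)
  have "integral {a..s} \<psi> \<le> integral {c..1} \<psi> + integral {1..} \<psi>" if "s \<ge> a" for s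
  proof -
    have "(\<psi> has_integral (integral {c..1} \<psi> + integral {1..} \<psi>)) ({c..1} \<union> {1..})"
      using int[of c 1] int1 c
      by (intro has_integral_Un) (auto intro: negligible_subset[of "{1}"] integrable_integral)
    moreover have "{c..1} \<union> {1..} = {c..}" using c by auto
    ultimately have I: "(\<psi> has_integral (integral {c..1} \<psi> + integral {1..} \<psi>)) {c..}" by simp
    have "integral {a..s} \<psi> \<le> integral {c..} \<psi>"
      by (intro integral_subset_le int a) (use c nonneg a I in auto)
    then show ?thesis using I by (simp add: integral_unique)
  qed
  then show ?thesis by blast
qed

lemma integral_has_real_derivative_at:
  fixes k :: "real \<Rightarrow> real"
  assumes "continuous_on {a..} k" "r > a"
  shows "((\<lambda>x. integral {a..x} k) has_real_derivative k r) (at r)"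
proof -
  have "((\<lambda>x. integral {a..x} k) has_real_derivative k r) (at r within {a..r+1})"
    using assms by (intro integral_has_real_derivative continuous_on_subset[OF assms(1)]) auto
  then have "((\<lambda>x. integral {a..x} k) has_real_derivative k r) (at r within {a<..<r+1})"
    by (rule DERIV_subset) auto
  then show ?thesis using assms by (subst (asm) at_within_open) auto
qed

lemma continuous_on_atLeastI:
  fixes y :: "real \<Rightarrow> real"
  assumes "\<And>T. T \<ge> a \<Longrightarrow> continuous_on {a..T} y"
  shows "continuous_on {a..} y"
  unfolding continuous_on_eq_continuous_within
proof
  fix t assume t: "t \<in> {a..}"
  have "continuous (at t within {a..t+1}) y"
    using assms[of "t+1"] t by (auto simp: continuous_on_eq_continuous_within)
  moreover have "at t within {a..t+1} = at t within {a..}"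
    by (rule at_within_nhd[of t "{..<t+1}"]) auto
  ultimately show "continuous (at t within {a..}) y" by simp
qed

lemma continuous_on_Icc_bounded_above:
  fixes x :: "real \<Rightarrow> real"
  assumes "continuous_on {a..b} x"
  shows "\<exists>C. \<forall>s\<in>{a..b}. x s \<le> C"
proof -
  have "bounded (x ` {a..b})"
    by (intro compact_imp_bounded compact_continuous_image assms) auto
  then obtain C where "\<forall>y\<in>x ` {a..b}. norm y \<le> C" unfolding bounded_iff by blast
  then show ?thesis by (intro exI[of _ C]) auto
qed

text \<open>Separation of variables: y is the inverse of \<open>P\<close>, where \<open>P s\<close>
  is the time needed to climb from a to s. Divergence of the integral of 1/\<phi> says exactly that
  \<open>P\<close> maps onto all of [0, \<infinity>), so y does not escape in finite time.\<close>

lemma scalar_ode_global: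
  fixes \<phi> :: "real \<Rightarrow> real"
  assumes cont: "continuous_on {a..} \<phi>" and pos: "\<And>s. s \<ge> a \<Longrightarrow> \<phi> s > 0"
    and unb: "\<And>C. \<exists>s\<ge>a. integral {a..s} (\<lambda>s. 1 / \<phi> s) \<ge> C"
  shows "\<exists>y. continuous_on {0..} y \<and> y 0 = a \<and> (\<forall>t\<ge>0. y t \<ge> a) \<and>
    (\<forall>t>0. (y has_real_derivative \<phi> (y t)) (at t))"
proof -
  define P where "P s = integral {a..s} (\<lambda>s. 1 / \<phi> s)" for s
  have ci: "continuous_on {a..} (\<lambda>s. 1 / \<phi> s)"
    by (intro continuous_intros cont) (use pos in force)
  have cP: "continuous_on {a..b} P" for b
    unfolding P_def by (intro indefinite_integral_continuous_1 integrable_continuous_real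
       continuous_on_subset[OF ci]) auto
  have dP: "(P has_real_derivative 1 / \<phi> s) (at s)" if "s > a" for s
    unfolding P_def by (rule integral_has_real_derivative_at[OF ci that])
  have smono: "P x < P y" if "a \<le> x" "x < y" for x y
  proof (rule DERIV_pos_imp_increasing_open[OF that(2)])
    show "\<exists>d. (P has_real_derivative d) (at z) \<and> 0 < d" if "x < z" "z < y" for z
      using dP[of z] pos[of z] \<open>a \<le> x\<close> that by (intro exI[of _ "1 / \<phi> z"]) auto
    show "continuous_on {x..y} P" using cP[of y] by (rule continuous_on_subset) (use that in auto)
  qed
  have Pa: "P a = 0" by (simp add: P_def)
  have surj: "\<exists>s\<ge>a. P s = t" if "t \<ge> 0" for t
  proof -
    obtain b where b: "b \<ge> a" "P b \<ge> t" using unb[of t] by (auto simp: P_def)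
    then show ?thesis using IVT'[of P a t b] that Pa cP[of b] by auto
  qed
  define y where "y t = (SOME s. s \<ge> a \<and> P s = t)" for t
  have y: "y t \<ge> a" "P (y t) = t" if "t \<ge> 0" for t
    using someI_ex[of "\<lambda>s. s \<ge> a \<and> P s = t"] surj[OF that] by (auto simp: y_def)
  have yP: "y (P s) = s" if "s \<ge> a" for s
  proof -
    have "P s \<ge> 0" using smono[of a s] Pa that by (cases "s = a") auto
    then show ?thesis using y[of "P s"] smono[of s "y (P s)"] smono[of "y (P s)" s] that
      by (metis linorder_neqE_linordered_idom order_less_irrefl)
  qed
  have cy: "continuous_on {0..T} y" if "T \<ge> 0" for T
  proof -
    have "continuous_on (P ` {a..y T}) y"
      by (intro continuous_on_inv cP) (use yP in auto)
    moreover have "{0..T} \<subseteq> P ` {a..y T}"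
    proof
      fix t assume t: "t \<in> {0..T}"
      have "y t \<le> y T" using smono[of "y T" "y t"] y[of t] y[of T] t that by force
      then show "t \<in> P ` {a..y T}" using y[of t] t by (intro image_eqI[of _ _ "y t"]) auto
    qed
    ultimately show ?thesis by (rule continuous_on_subset)
  qed
  have isc: "isCont y t" if "t > 0" for t
    using continuous_on_interior[OF cy[of "t+1"], of t] that by auto
  have "(y has_real_derivative \<phi> (y t)) (at t)" if "t > 0" for t
  proof -
    have "y t \<noteq> a" using y[of t] Pa that by auto
    then have gt: "y t > a" using y[of t] that by auto
    have "(y has_real_derivative inverse (1 / \<phi> (y t))) (at t)"
      using dP[OF gt] pos[of "y t"] gt that y isc
      by (intro DERIV_inverse_function[where f = P and a = 0 and b = "t+1"]) auto
    then show ?thesis by simp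
  qed
  moreover have "continuous_on {0..} y" by (rule continuous_on_atLeastI[OF cy])
  moreover have "y 0 = a" using yP[of a] Pa by simp
  ultimately show ?thesis using y by (intro exI[of _ y]) auto
qed

text \<open>\<open>P\<close> composed with y grows at rate at least c but stays below C, so the
  lifetime is at most C / c. The strict bound \<open>ygt\<close> is kept apart from
  \<open>ya\<close> because \<open>P\<close> is differentiable only to the right of a.\<close>

lemma blow_up_time:
  fixes \<psi> y :: "real \<Rightarrow> real"
  assumes cont: "continuous_on {0<..} \<psi>" and nonneg: "\<And>s. s > 0 \<Longrightarrow> \<psi> s > 0"
    and bd: "\<And>s. s \<ge> a \<Longrightarrow> integral {a..s} \<psi> \<le> C" and a: "a > 0" and t: "t0 \<le> t1"
    and cy: "continuous_on {t0..t1} y" and ya: "\<And>t. t0 \<le> t \<Longrightarrow> t \<le> t1 \<Longrightarrow> y t \<ge> a"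
    and ygt: "\<And>t. t0 < t \<Longrightarrow> t < t1 \<Longrightarrow> y t > a"
    and dy: "\<And>t. t0 < t \<Longrightarrow> t < t1 \<Longrightarrow> \<exists>d. (y has_real_derivative d) (at t) \<and> c \<le> d * \<psi> (y t)"
  shows "c * (t1 - t0) \<le> C"
proof -
  define P where "P s = integral {a..s} \<psi>" for s
  have ci: "continuous_on {a..b} \<psi>" for b
    by (rule continuous_on_subset[OF cont]) (use a in auto)
  have cP: "continuous_on {a..b} P" for b
    unfolding P_def by (intro indefinite_integral_continuous_1 integrable_continuous_real ci)
  have dP: "(P has_real_derivative \<psi> s) (at s)" if "s > a" for s
    unfolding P_def
    by (rule integral_has_real_derivative_at[OF continuous_on_subset[OF cont] that]) (use a in auto)
  have "P (y t0) - c * t0 \<le> P (y t1) - c * t1"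
  proof (rule DERIV_nonneg_imp_increasing_open[OF t])
    fix x assume x: "t0 < x" "x < t1"
    obtain d where d: "(y has_real_derivative d) (at x)" "c \<le> d * \<psi> (y x)" using dy[OF x] by auto
    have "((\<lambda>t. P (y t) - c * t) has_real_derivative (\<psi> (y x) * d - c)) (at x)"
      by (rule derivative_eq_intros DERIV_chain2[OF dP] d ygt x refl | simp)+
    then show "\<exists>z. ((\<lambda>t. P (y t) - c * t) has_real_derivative z) (at x) \<and> 0 \<le> z"
      using d by (intro exI conjI) (auto simp: mult.commute)
  next
    obtain b where "y ` {t0..t1} \<subseteq> {..b}"
      using continuous_on_Icc_bounded_above[OF cy] by auto
    then have "y ` {t0..t1} \<subseteq> {a..b}" using ya by auto
    then show "continuous_on {t0..t1} (\<lambda>t. P (y t) - c * t)"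
      by (intro continuous_intros continuous_on_compose2[OF cP cy]) auto
  qed
  moreover have "P (y t1) \<le> C" using bd ya t by (auto simp: P_def)
  moreover have "P (y t0) \<ge> 0"
    unfolding P_def by (intro integral_nonneg integrable_continuous_real ci)
      (use nonneg a in \<open>auto simp: less_imp_le\<close>)
  ultimately show ?thesis by (simp add: algebra_simps)
qed


section \<open>Weighted radial means of a source function\<close>

lemma radial_mean_le:
  fixes h :: "real \<Rightarrow> real"
  assumes int: "(\<lambda>s. s ^ m * h s) integrable_on {0..r}" and int': "k integrable_on {0..r}"
    and h: "\<And>s. 0 \<le> s \<Longrightarrow> s \<le> r \<Longrightarrow> 0 \<le> h s \<and> h s \<le> k s" and r: "r \<ge> 0"
  shows "integral {0..r} (\<lambda>s. s ^ m * h s) / r ^ m \<le> integral {0..r} k"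
    and "0 \<le> integral {0..r} (\<lambda>s. s ^ m * h s) / r ^ m"
proof -
  show "integral {0..r} (\<lambda>s. s ^ m * h s) / r ^ m \<le> integral {0..r} k"
  proof (cases "r = 0")
    case False
    then have r: "r > 0" using r by simp
    have "integral {0..r} (\<lambda>s. s ^ m * h s) \<le> integral {0..r} (\<lambda>s. r ^ m * k s)"
      by (intro integral_le int integrable_on_mult_right int' mult_mono power_mono)
        (use h r in \<open>auto intro: order.trans\<close>)
    then show ?thesis using r by (simp add: divide_le_eq mult.commute)
  qed auto
  show "0 \<le> integral {0..r} (\<lambda>s. s ^ m * h s) / r ^ m"
    by (intro divide_nonneg_nonneg integral_nonneg int) (use h r in auto)
qed

text \<open>Only r = 0 is delicate, and there the mean is at most C r. The source h is assumed
  bounded and integrable rather than continuous, because the lemma is applied to a limit of iterates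
  before its continuity is known.\<close>

lemma radial_mean_continuous:
  fixes h :: "real \<Rightarrow> real"
  assumes int: "(\<lambda>s. s ^ m * h s) integrable_on {0..R}"
    and h: "\<And>s. 0 \<le> s \<Longrightarrow> s \<le> R \<Longrightarrow> 0 \<le> h s \<and> h s \<le> C"
  shows "continuous_on {0..R} (\<lambda>r. integral {0..r} (\<lambda>s. s ^ m * h s) / r ^ m)"
  unfolding continuous_on_eq_continuous_within
proof
  fix r assume r: "r \<in> {0..R}"
  have cI: "continuous_on {0..R} (\<lambda>r. integral {0..r} (\<lambda>s. s ^ m * h s))"
    by (rule indefinite_integral_continuous_1[OF int])
  show "continuous (at r within {0..R}) (\<lambda>r. integral {0..r} (\<lambda>s. s ^ m * h s) / r ^ m)"
  proof (cases "r = 0")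
    case False
    then show ?thesis using cI r
      by (intro continuous_intros) (auto simp: continuous_on_eq_continuous_within)
  next
    case True
    have b: "norm (integral {0..x} (\<lambda>s. s ^ m * h s) / x ^ m) \<le> C * x" if "x \<in> {0..R}" for x
    proof -
      have i: "(\<lambda>s. s ^ m * h s) integrable_on {0..x}"
        by (rule integrable_on_subinterval[OF int]) (use that in auto)
      have hC: "0 \<le> h s \<and> h s \<le> C" if "0 \<le> s" "s \<le> x" for s
        using h[of s] that \<open>x \<in> {0..R}\<close> by simp
      note le = radial_mean_le[OF i integrable_const_ivl hC]
      have "integral {0..x} (\<lambda>s. s ^ m * h s) / x ^ m \<le> integral {0..x} (\<lambda>_. C)"
        "0 \<le> integral {0..x} (\<lambda>s. s ^ m * h s) / x ^ m"
        by (rule le; use that in simp)+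
      then show ?thesis using that by (simp only: real_norm_def) (simp add: mult.commute)
    qed
    have "((\<lambda>r. integral {0..r} (\<lambda>s. s ^ m * h s) / r ^ m) \<longlongrightarrow> 0) (at 0 within {0..R})"
    proof (rule Lim_null_comparison)
      show "\<forall>\<^sub>F x in at 0 within {0..R}. norm (integral {0..x} (\<lambda>s. s ^ m * h s) / x ^ m) \<le> C * x"
        using b by (auto simp: eventually_at_filter)
      show "((\<lambda>x. C * x) \<longlongrightarrow> 0) (at 0 within {0..R})" by (auto intro!: tendsto_eq_intros)
    qed
    then show ?thesis using True by (simp add: continuous_within)
  qed
qed

text \<open>With m = n - 1 this is the radial divergence equation r^(-m) (r^m w)' = h, solved for
  w'.\<close>

lemma radial_mean_has_derivative:
  fixes h w :: "real \<Rightarrow> real"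
  assumes ch: "continuous_on {0..} h"
    and w: "\<And>r. r \<ge> 0 \<Longrightarrow> w r = integral {0..r} (\<lambda>s. s ^ m * h s) / r ^ m" and r: "r > 0"
  shows "(w has_real_derivative h r - real m * (w r / r)) (at r)"
proof -
  let ?I = "\<lambda>r. integral {0..r} (\<lambda>s. s ^ m * h s)"
  have dI: "(?I has_real_derivative r ^ m * h r) (at r)"
    by (rule integral_has_real_derivative_at[OF _ r]) (intro continuous_intros ch)
  have "((\<lambda>r. ?I r / r ^ m) has_real_derivative
      ((r ^ m * h r) * r ^ m - ?I r * (real m * r ^ (m - 1))) / (r ^ m * r ^ m)) (at r)"
    using r by (intro DERIV_divide dI) (auto intro!: derivative_eq_intros)
  also have "((r ^ m * h r) * r ^ m - ?I r * (real m * r ^ (m - 1))) / (r ^ m * r ^ m)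
      = h r - real m * ((?I r / r ^ m) / r)"
    using r by (cases m) (auto simp: field_simps)
  also have "?I r / r ^ m = w r" using w r by simp
  finally show ?thesis
    by (rule has_field_derivative_transform_within_open[where S = "{0<..}"]) (use w r in auto)
qed

text \<open>\<open>w r / r\<close> is 1/(m+1) times the average of h over [0, r] with respect to the
  probability density (m+1) s^m / r^(m+1), and \<open>h r\<close> is the largest value
  averaged.\<close>

lemma radial_mean_le_mono:
  fixes h w :: "real \<Rightarrow> real"
  assumes ch: "continuous_on {0..} h"
    and w: "\<And>r. r \<ge> 0 \<Longrightarrow> w r = integral {0..r} (\<lambda>s. s ^ m * h s) / r ^ m"
    and mono: "\<And>s. 0 \<le> s \<Longrightarrow> s \<le> r \<Longrightarrow> h s \<le> h r" and r: "r > 0"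
  shows "real (Suc m) * (w r / r) \<le> h r"
proof -
  have cs: "continuous_on {0..} (\<lambda>s. s ^ m * h s)" by (intro continuous_intros ch)
  have I: "((\<lambda>s. s ^ m * h r) has_integral (r ^ Suc m / real (Suc m) * h r)) {0..r}"
  proof -
    have d: "((\<lambda>s. s ^ Suc m / real (Suc m)) has_real_derivative s ^ m) (at s within A)" for s A
      using DERIV_cdivide[OF has_field_derivative_at_within[OF DERIV_pow[of "Suc m" s]], of "real (Suc m)"]
      by simp
    have "((\<lambda>s. s ^ m) has_integral (r ^ Suc m / real (Suc m) - 0 ^ Suc m / real (Suc m))) {0..r}"
      using r d by (intro fundamental_theorem_of_calculus)
        (auto simp: has_real_derivative_iff_has_vector_derivative[symmetric])
    from has_integral_mult_left[OF this, of "h r"] show ?thesis by simp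
  qed
  have "integral {0..r} (\<lambda>s. s ^ m * h s) \<le> integral {0..r} (\<lambda>s. s ^ m * h r)"
  proof (rule integral_le)
    show "(\<lambda>s. s ^ m * h s) integrable_on {0..r}"
      by (intro integrable_continuous_real continuous_on_subset[OF cs]) auto
    show "(\<lambda>s. s ^ m * h r) integrable_on {0..r}" using I by (rule has_integral_integrable)
    show "s ^ m * h s \<le> s ^ m * h r" if "s \<in> {0..r}" for s
      using that by (intro mult_left_mono mono) auto
  qed
  also have "\<dots> = r ^ Suc m / real (Suc m) * h r" using I by (rule integral_unique)
  finally have a: "integral {0..r} (\<lambda>s. s ^ m * h s) \<le> r ^ Suc m / real (Suc m) * h r" .
  have "w r * r ^ m = integral {0..r} (\<lambda>s. s ^ m * h s)" using r w[of r] by simp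
  then have "real (Suc m) * (w r * r ^ m) \<le> real (Suc m) * (r ^ Suc m / real (Suc m) * h r)"
    using a by (intro mult_left_mono) auto
  then have "(real (Suc m) * w r) * r ^ m \<le> (r * h r) * r ^ m"
    by (simp add: algebra_simps del: of_nat_Suc)
  then have "real (Suc m) * w r \<le> r * h r" using r by (simp del: of_nat_Suc)
  then show ?thesis using r by (simp add: field_simps del: of_nat_Suc)
qed

text \<open>\<open>Suc m\<close> is the dimension n. Since w/r <= h/n, the term (n-1) w/r removes at
  most the share (n-1)/n of h, which leaves w' >= h/n. This one-dimensional inequality is what the
  blow-up estimates consume.\<close>

lemma radial_mean_has_derivative_ge:
  fixes h w :: "real \<Rightarrow> real"
  assumes ch: "continuous_on {0..} h"
    and w: "\<And>r. r \<ge> 0 \<Longrightarrow> w r = integral {0..r} (\<lambda>s. s ^ m * h s) / r ^ m"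
    and mono: "\<And>s. 0 \<le> s \<Longrightarrow> s \<le> r \<Longrightarrow> h s \<le> h r" and r: "r > 0"
  shows "h r \<le> real (Suc m) * (h r - real m * (w r / r))"
proof -
  have "real m * (real (Suc m) * (w r / r)) \<le> real m * h r"
    using radial_mean_le_mono[OF ch w mono r] by (intro mult_left_mono) auto
  then show ?thesis by (simp add: algebra_simps)
qed

lemma radial_mean_mono:
  fixes h w :: "real \<Rightarrow> real"
  assumes ch: "continuous_on {0..} h" and h0: "\<And>s. 0 \<le> s \<Longrightarrow> 0 \<le> h s"
    and w: "\<And>r. r \<ge> 0 \<Longrightarrow> w r = integral {0..r} (\<lambda>s. s ^ m * h s) / r ^ m"
    and mono: "\<And>s r. 0 \<le> s \<Longrightarrow> s \<le> r \<Longrightarrow> h s \<le> h r" and r: "0 \<le> r" "r \<le> r'"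
  shows "w r \<le> w r'"
proof (rule DERIV_nonneg_imp_increasing_open[OF r(2)])
  fix x assume x: "r < x" "x < r'"
  then have x0: "x > 0" using r by simp
  have "h x \<le> real (Suc m) * (h x - real m * (w x / x))"
    by (rule radial_mean_has_derivative_ge[OF ch w mono x0])
  then have "0 \<le> real (Suc m) * (h x - real m * (w x / x))" using h0[of x] x0 by linarith
  then have "0 \<le> h x - real m * (w x / x)" by (simp add: zero_le_mult_iff del: of_nat_Suc)
  then show "\<exists>y. (w has_real_derivative y) (at x) \<and> 0 \<le> y"
    using radial_mean_has_derivative[OF ch w x0] by blast
next
  have "continuous_on {0..r'} (\<lambda>r. integral {0..r} (\<lambda>s. s ^ m * h s) / r ^ m)"
  proof (rule radial_mean_continuous[where C = "h r'"])
    have "continuous_on {0..} (\<lambda>s. s ^ m * h s)" by (intro continuous_intros ch)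
    then show "(\<lambda>s. s ^ m * h s) integrable_on {0..r'}"
      by (intro integrable_continuous_real) (auto intro: continuous_on_subset)
  qed (use h0 mono in auto)
  then have "continuous_on {0..r'} w" by (rule continuous_on_eq) (use w in auto)
  then show "continuous_on {r..r'} w" by (rule continuous_on_subset) (use r in auto)
qed

section \<open>Monotone iteration for the radial system\<close>

primrec radial_iter :: "nat \<Rightarrow> real \<Rightarrow> (real \<Rightarrow> real) \<Rightarrow> (real \<Rightarrow> real \<Rightarrow> real) \<Rightarrow> nat \<Rightarrow>
    (real \<Rightarrow> real) \<times> (real \<Rightarrow> real)" where
  "radial_iter m v0 b H 0 = (\<lambda>_. v0, \<lambda>_. 0)"
| "radial_iter m v0 b H (Suc k) =
     (\<lambda>r. v0 + integral {0..r} (\<lambda>s. b (snd (radial_iter m v0 b H k) s)),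
      \<lambda>r. integral {0..r} (\<lambda>s. s ^ m * H (fst (radial_iter m v0 b H k) s) (snd (radial_iter m v0 b H k) s)) / r ^ m)"

text \<open>The iterates start at (v0, 0), increase, and stay below (V, W). In the w-component this
  uses that a weighted mean is at most the plain integral, so (V, W) has to satisfy only the
  inequality without the weight. Continuity and monotonicity of H and b then let monotone
  convergence pass to the limit; no Lipschitz condition enters.\<close>

lemma radial_system_solution:
  fixes H :: "real \<Rightarrow> real \<Rightarrow> real" and b V W :: "real \<Rightarrow> real" and v0 :: real
  assumes cH: "continuous_on UNIV (\<lambda>z. H (fst z) (snd z))"
    and mH: "\<And>x x' y y'. x \<le> x' \<Longrightarrow> y \<le> y' \<Longrightarrow> H x y \<le> H x' y'"
    and H0: "\<And>x y. 0 \<le> H x y"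
    and cb: "continuous_on UNIV b" and mb: "\<And>x y. x \<le> y \<Longrightarrow> b x \<le> b y" and b0: "\<And>x. 0 \<le> b x"
    and cV: "continuous_on {0..} V" and cW: "continuous_on {0..} W"
    and V: "\<And>r. r \<ge> 0 \<Longrightarrow> v0 + integral {0..r} (\<lambda>s. b (W s)) \<le> V r"
    and W: "\<And>r. r \<ge> 0 \<Longrightarrow> integral {0..r} (\<lambda>s. H (V s) (W s)) \<le> W r"
  obtains v w where "continuous_on {0..} v" "continuous_on {0..} w"
    "\<And>r. r \<ge> 0 \<Longrightarrow> v r = v0 + integral {0..r} (\<lambda>s. b (w s))"
    "\<And>r. r \<ge> 0 \<Longrightarrow> w r = integral {0..r} (\<lambda>s. s ^ m * H (v s) (w s)) / r ^ m"
    "\<And>r. r \<ge> 0 \<Longrightarrow> 0 \<le> w r" "\<And>r r'. 0 \<le> r \<Longrightarrow> r \<le> r' \<Longrightarrow> w r \<le> w r'"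
proof -
  define vk where "vk k = fst (radial_iter m v0 b H k)" for k
  define wk where "wk k = snd (radial_iter m v0 b H k)" for k
  have vk0: "vk 0 = (\<lambda>_. v0)" and wk0: "wk 0 = (\<lambda>_. 0)" by (auto simp: vk_def wk_def)
  have vkS: "vk (Suc k) = (\<lambda>r. v0 + integral {0..r} (\<lambda>s. b (wk k s)))" for k
    by (simp add: vk_def wk_def)
  have wkS: "wk (Suc k) = (\<lambda>r. integral {0..r} (\<lambda>s. s ^ m * H (vk k s) (wk k s)) / r ^ m)" for k
    by (simp add: vk_def wk_def)
  have cH2: "continuous_on S (\<lambda>s. H (x s) (y s))" if "continuous_on S x" "continuous_on S y"
    for S and x y :: "real \<Rightarrow> real"
    using continuous_on_compose2[OF cH continuous_on_Pair[OF that]] by auto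
  have cb2: "continuous_on S (\<lambda>s. b (x s))" if "continuous_on S x" for S and x :: "real \<Rightarrow> real"
    using continuous_on_compose2[OF cb that] by auto
  note sub = continuous_on_subset[of "{0..}"]
  have ic: "x integrable_on {0..r}" if "continuous_on {0..} x" for x :: "real \<Rightarrow> real" and r
    by (intro integrable_continuous_real sub[OF that]) auto
  have cont: "continuous_on {0..} (vk k) \<and> continuous_on {0..} (wk k)" for k
  proof (induction k)
    case (Suc k)
    have 1: "continuous_on {0..T} (vk (Suc k))" for T
      unfolding vkS using Suc by (intro continuous_intros indefinite_integral_continuous_1 ic cb2) auto
    have 2: "continuous_on {0..T} (wk (Suc k))" for T
    proof -
      have "continuous_on {0..T} (\<lambda>s. H (vk k s) (wk k s))"
        using Suc by (intro cH2 sub[OF conjunct1[OF Suc]] sub[OF conjunct2[OF Suc]]) auto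
      then obtain C where C: "\<And>s. s \<in> {0..T} \<Longrightarrow> H (vk k s) (wk k s) \<le> C"
        using continuous_on_Icc_bounded_above by blast
      show ?thesis unfolding wkS
        by (intro radial_mean_continuous[where C = C] ic continuous_intros cH2) (use Suc H0 C in auto)
    qed
    show ?case using 1 2 continuous_on_atLeastI[of 0] by blast
  qed (simp add: vk0 wk0)
  have ib: "(\<lambda>s. b (wk k s)) integrable_on {0..r}" for k r
    using cont by (intro ic cb2) auto
  have iH: "(\<lambda>s. H (vk k s) (wk k s)) integrable_on {0..r}" for k r
    using cont by (intro ic cH2) auto
  have isH: "(\<lambda>s. s ^ m * H (vk k s) (wk k s)) integrable_on {0..r}" for k r
    using cont by (intro ic continuous_intros cH2) auto
  have ibW: "(\<lambda>s. b (W s)) integrable_on {0..r}" for r by (intro ic cb2 cW)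
  have iHW: "(\<lambda>s. H (V s) (W s)) integrable_on {0..r}" for r by (intro ic cH2 cW cV)
  have wk_nn: "wk k r \<ge> 0" if "r \<ge> 0" for k r
  proof (cases k)
    case (Suc j)
    show ?thesis unfolding Suc wkS
      by (rule radial_mean_le(2)[OF isH iH]) (use H0 that in auto)
  qed (simp add: wk0)
  have le: "vk k r \<le> V r \<and> wk k r \<le> W r" if "r \<ge> 0" for k r
    using that
  proof (induction k arbitrary: r)
    case 0
    have "0 \<le> integral {0..r} (\<lambda>s. b (W s))" by (intro integral_nonneg ibW) (use b0 in auto)
    moreover have "0 \<le> integral {0..r} (\<lambda>s. H (V s) (W s))" by (intro integral_nonneg iHW) (use H0 in auto)
    ultimately show ?case using V[OF 0] W[OF 0] by (simp add: vk0 wk0)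
  next
    case (Suc k)
    have "integral {0..r} (\<lambda>s. b (wk k s)) \<le> integral {0..r} (\<lambda>s. b (W s))"
      by (intro integral_le ib ibW mb) (use Suc in auto)
    moreover have "wk (Suc k) r \<le> integral {0..r} (\<lambda>s. H (V s) (W s))"
      unfolding wkS by (rule radial_mean_le[OF isH iHW]) (use Suc H0 mH in auto)
    ultimately show ?case using V[OF Suc.prems] W[OF Suc.prems] by (simp add: vkS)
  qed
  have inc: "vk k r \<le> vk (Suc k) r \<and> wk k r \<le> wk (Suc k) r" if "r \<ge> 0" for k r
    using that
  proof (induction k arbitrary: r)
    case 0
    have "0 \<le> integral {0..r} (\<lambda>s. b (wk 0 s))" by (intro integral_nonneg ib) (use b0 in auto)
    then show ?case using wk_nn[OF 0, of "Suc 0"] by (simp add: vk0 wk0 vkS)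
  next
    case (Suc k)
    have "integral {0..r} (\<lambda>s. b (wk k s)) \<le> integral {0..r} (\<lambda>s. b (wk (Suc k) s))"
      by (intro integral_le ib mb) (use Suc in auto)
    moreover have "integral {0..r} (\<lambda>s. s ^ m * H (vk k s) (wk k s))
      \<le> integral {0..r} (\<lambda>s. s ^ m * H (vk (Suc k) s) (wk (Suc k) s))"
      by (intro integral_le isH mult_left_mono mH) (use Suc in auto)
    ultimately show ?case
      using Suc.prems by (auto simp: vkS[of "Suc k"] wkS[of "Suc k"] vkS[of k] wkS[of k] intro!: divide_right_mono)
  qed
  \<comment> \<open>Monotonicity in r survives each iteration because both arguments of H increase
    with r. For the limit w it later carries a slope bound from one radius to all larger
    ones.\<close>
  have mono: "vk k r \<le> vk k r' \<and> wk k r \<le> wk k r'" if "0 \<le> r" "r \<le> r'" for k r r'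
    using that
  proof (induction k arbitrary: r r')
    case (Suc k)
    have "integral {0..r} (\<lambda>s. b (wk k s)) \<le> integral {0..r'} (\<lambda>s. b (wk k s))"
      by (intro integral_subset_le ib) (use Suc.prems b0 in auto)
    moreover have "wk (Suc k) r \<le> wk (Suc k) r'"
    proof (rule radial_mean_mono[where w = "wk (Suc k)"])
      show "continuous_on {0..} (\<lambda>s. H (vk k s) (wk k s))" using cont by (intro cH2) auto
      show "H (vk k s) (wk k s) \<le> H (vk k t) (wk k t)" if "0 \<le> s" "s \<le> t" for s t
        using Suc.IH[OF that] by (intro mH) auto
    qed (use Suc.prems H0 in \<open>auto simp: wkS\<close>)
    ultimately show ?case by (simp add: vkS)
  qed (simp add: vk0 wk0)
  define v where "v r = (SUP k. vk k r)" for r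
  define w where "w r = (SUP k. wk k r)" for r
  have bv: "bdd_above (range (\<lambda>k. vk k r))" and bw: "bdd_above (range (\<lambda>k. wk k r))" if "r \<ge> 0" for r
    using le[OF that] by (auto intro!: bdd_aboveI2)
  have lv: "(\<lambda>k. vk k r) \<longlonglongrightarrow> v r" if "r \<ge> 0" for r
    unfolding v_def using inc[OF that] by (intro LIMSEQ_incseq_SUP bv that incseq_SucI) auto
  have lw: "(\<lambda>k. wk k r) \<longlonglongrightarrow> w r" if "r \<ge> 0" for r
    unfolding w_def using inc[OF that] by (intro LIMSEQ_incseq_SUP bw that incseq_SucI) auto
  have vV: "v r \<le> V r" if "r \<ge> 0" for r
    using lv[OF that] le[OF that] by (intro LIMSEQ_le_const2[OF lv[OF that]]) auto
  have wW: "w r \<le> W r" if "r \<ge> 0" for r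
    using lw[OF that] le[OF that] by (intro LIMSEQ_le_const2[OF lw[OF that]]) auto
  have w0: "w r \<ge> 0" if "r \<ge> 0" for r
    using wk_nn[OF that] by (intro LIMSEQ_le_const[OF lw[OF that]]) auto
  have lbw: "(\<lambda>k. b (wk k r)) \<longlonglongrightarrow> b (w r)" if "r \<ge> 0" for r
    using continuous_on_tendsto_compose[OF cb lw[OF that]] by auto
  have lHw: "(\<lambda>k. H (vk k r) (wk k r)) \<longlonglongrightarrow> H (v r) (w r)" if "r \<ge> 0" for r
    using continuous_on_tendsto_compose[OF cH tendsto_Pair[OF lv[OF that] lw[OF that]]] by auto
  \<comment> \<open>Monotone convergence also delivers integrability of the limit, whose continuity
    is not yet available.\<close>
  have mc1: "(\<lambda>s. b (w s)) integrable_on {0..r} \<and>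
      (\<lambda>k. integral {0..r} (\<lambda>s. b (wk k s))) \<longlonglongrightarrow> integral {0..r} (\<lambda>s. b (w s))" for r
  proof (rule monotone_convergence_increasing)
    show "bounded (range (\<lambda>k. integral {0..r} (\<lambda>s. b (wk k s))))"
    proof (rule boundedI)
      fix x assume "x \<in> range (\<lambda>k. integral {0..r} (\<lambda>s. b (wk k s)))"
      then obtain k where k: "x = integral {0..r} (\<lambda>s. b (wk k s))" by auto
      have "0 \<le> x" unfolding k by (intro integral_nonneg ib) (use b0 in auto)
      moreover have "x \<le> integral {0..r} (\<lambda>s. b (W s))"
        unfolding k by (intro integral_le ib ibW mb) (use le in auto)
      ultimately show "norm x \<le> integral {0..r} (\<lambda>s. b (W s))" by simp
    qed
  qed (use ib inc mb lbw in auto)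
  have mc2: "(\<lambda>s. s ^ m * H (v s) (w s)) integrable_on {0..r} \<and>
      (\<lambda>k. integral {0..r} (\<lambda>s. s ^ m * H (vk k s) (wk k s))) \<longlonglongrightarrow> integral {0..r} (\<lambda>s. s ^ m * H (v s) (w s))" for r
  proof (rule monotone_convergence_increasing)
    have isHW: "(\<lambda>s. s ^ m * H (V s) (W s)) integrable_on {0..r}"
      using cV cW by (intro ic continuous_intros cH2) auto
    show "bounded (range (\<lambda>k. integral {0..r} (\<lambda>s. s ^ m * H (vk k s) (wk k s))))"
    proof (rule boundedI)
      fix x assume "x \<in> range (\<lambda>k. integral {0..r} (\<lambda>s. s ^ m * H (vk k s) (wk k s)))"
      then obtain k where k: "x = integral {0..r} (\<lambda>s. s ^ m * H (vk k s) (wk k s))" by auto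
      have "0 \<le> x" unfolding k by (intro integral_nonneg isH) (use H0 in auto)
      moreover have "x \<le> integral {0..r} (\<lambda>s. s ^ m * H (V s) (W s))"
        unfolding k by (intro integral_le isH isHW mult_left_mono mH) (use le in auto)
      ultimately show "norm x \<le> integral {0..r} (\<lambda>s. s ^ m * H (V s) (W s))" by simp
    qed
    show "(\<lambda>k. s ^ m * H (vk k s) (wk k s)) \<longlonglongrightarrow> s ^ m * H (v s) (w s)" if "s \<in> {0..r}" for s
      using that by (intro tendsto_intros lHw) auto
  qed (use isH inc mH in \<open>auto intro!: mult_left_mono\<close>)
  have veq: "v r = v0 + integral {0..r} (\<lambda>s. b (w s))" if "r \<ge> 0" for r
  proof (rule LIMSEQ_unique[OF LIMSEQ_Suc[OF lv[OF that]]])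
    show "(\<lambda>k. vk (Suc k) r) \<longlonglongrightarrow> v0 + integral {0..r} (\<lambda>s. b (w s))"
      unfolding vkS using mc1 by (intro tendsto_intros) auto
  qed
  have weq: "w r = integral {0..r} (\<lambda>s. s ^ m * H (v s) (w s)) / r ^ m" if "r \<ge> 0" for r
  proof (cases "r = 0")
    case False
    show ?thesis
    proof (rule LIMSEQ_unique[OF LIMSEQ_Suc[OF lw[OF that]]])
      show "(\<lambda>k. wk (Suc k) r) \<longlonglongrightarrow> integral {0..r} (\<lambda>s. s ^ m * H (v s) (w s)) / r ^ m"
        unfolding wkS using mc2 False by (intro tendsto_intros) auto
    qed
  next
    case True
    \<comment> \<open>The integral over a single point is 0, so the quotient is 0 whether
      \<open>0 ^ m\<close> is 1 (m = 0) or 0 (division by zero).\<close>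
    have "wk k 0 = 0" for k by (cases k) (auto simp: wk0 wkS)
    then have "w 0 = 0" by (simp add: w_def)
    then show ?thesis using True by simp
  qed
  have cv: "continuous_on {0..} v"
  proof (rule continuous_on_atLeastI)
    fix T :: real
    have "continuous_on {0..T} (\<lambda>r. v0 + integral {0..r} (\<lambda>s. b (w s)))"
      using mc1 by (intro continuous_intros indefinite_integral_continuous_1) auto
    then show "continuous_on {0..T} v" by (rule continuous_on_eq) (use veq in auto)
  qed
  have cw: "continuous_on {0..} w"
  proof (rule continuous_on_atLeastI)
    fix T :: real
    have "continuous_on {0..T} (\<lambda>s. H (V s) (W s))"
      by (intro cH2 sub[OF cV] sub[OF cW]) auto
    then obtain C where C: "\<And>s. s \<in> {0..T} \<Longrightarrow> H (V s) (W s) \<le> C"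
      using continuous_on_Icc_bounded_above by blast
    \<comment> \<open>The upper solution bounds the source, which is enough for continuity of the
      mean although continuity of w is the very claim.\<close>
    have C': "H (v s) (w s) \<le> C" if "0 \<le> s" "s \<le> T" for s
      using C[of s] mH[OF vV wW, of s s] that by auto
    have "continuous_on {0..T} (\<lambda>r. integral {0..r} (\<lambda>s. s ^ m * H (v s) (w s)) / r ^ m)"
      by (intro radial_mean_continuous[where C = C]) (use mc2 H0 C' in auto)
    then show "continuous_on {0..T} w" by (rule continuous_on_eq) (use weq in auto)
  qed
  have wmono: "w r \<le> w r'" if "0 \<le> r" "r \<le> r'" for r r'
    using mono[OF that] that by (intro LIMSEQ_le[OF lw lw]) auto
  show ?thesis using that[OF cv cw veq weq w0 wmono] by blast
qed

lemma primitive_has_real_derivative_at: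
  fixes k v :: "real \<Rightarrow> real"
  assumes "continuous_on {a..} k" "r > a" "\<And>r. r \<ge> a \<Longrightarrow> v r = c + integral {a..r} k"
  shows "(v has_real_derivative k r) (at r)"
proof -
  have "((\<lambda>r. c + integral {a..r} k) has_real_derivative k r) (at r)"
    by (rule derivative_eq_intros integral_has_real_derivative_at assms refl | simp)+
  then show ?thesis
    by (rule has_field_derivative_transform_within_open[where S = "{a<..}"]) (use assms in auto)
qed

text \<open>The singularity of w(r)/r at the origin is removable. Its limit, \<open>h 0\<close>
  divided by the dimension, becomes the central value of the coefficient of the vector field in the
  divergence identity.\<close>

lemma radial_mean_div_tendsto:
  fixes h w :: "real \<Rightarrow> real"
  assumes ch: "continuous_on {0..} h"
    and w: "\<And>r. r \<ge> 0 \<Longrightarrow> w r = integral {0..r} (\<lambda>s. s ^ m * h s) / r ^ m"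
  shows "((\<lambda>r. w r / r) \<longlongrightarrow> h 0 / real (Suc m)) (at_right 0)"
proof -
  let ?I = "\<lambda>r. integral {0..r} (\<lambda>s. s ^ m * h s)"
  have pos: "eventually (\<lambda>r::real. r > 0) (at_right 0)" by (simp add: eventually_at_right_less)
  have cs: "continuous_on {0..} (\<lambda>s. s ^ m * h s)" by (intro continuous_intros ch)
  have "continuous_on {0..1} ?I"
    by (intro indefinite_integral_continuous_1 integrable_continuous_real continuous_on_subset[OF cs]) auto
  then have "(?I \<longlongrightarrow> ?I 0) (at 0 within {0..1})"
    by (meson atLeastAtMost_iff continuous_on_def order.refl zero_le_one)
  then have I0: "(?I \<longlongrightarrow> 0) (at_right 0)"
    by (subst (asm) at_within_Icc_at_right) auto
  have h0: "(h \<longlongrightarrow> h 0) (at_right 0)"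
  proof -
    have "(h \<longlongrightarrow> h 0) (at 0 within {0..})" using ch by (auto simp: continuous_on_def)
    then show ?thesis by (rule filterlim_mono[OF _ order.refl at_le]) auto
  qed
  have "((\<lambda>r. ?I r / r ^ Suc m) \<longlongrightarrow> h 0 / real (Suc m)) (at_right 0)"
  proof (rule lhopital_right_0[OF I0])
    show "((\<lambda>r::real. r ^ Suc m) \<longlongrightarrow> 0) (at_right 0)" by (auto intro!: tendsto_eq_intros)
    show "\<forall>\<^sub>F r::real in at_right 0. r ^ Suc m \<noteq> 0" using pos by eventually_elim auto
    show "\<forall>\<^sub>F r::real in at_right 0. real (Suc m) * r ^ m \<noteq> 0" using pos by eventually_elim auto
    show "\<forall>\<^sub>F r in at_right 0. (?I has_real_derivative r ^ m * h r) (at r)"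
      using pos by eventually_elim (rule integral_has_real_derivative_at[OF cs])
    show "\<forall>\<^sub>F r::real in at_right 0. ((\<lambda>r. r ^ Suc m) has_real_derivative real (Suc m) * r ^ m) (at r)"
      using DERIV_pow[of "Suc m"] by (auto intro!: always_eventually)
    have "((\<lambda>r. h r / real (Suc m)) \<longlongrightarrow> h 0 / real (Suc m)) (at_right 0)"
      by (intro tendsto_divide h0 tendsto_const) auto
    moreover have "\<forall>\<^sub>F r in at_right 0. h r / real (Suc m) = r ^ m * h r / (real (Suc m) * r ^ m)"
      using pos by eventually_elim auto
    ultimately show "((\<lambda>r. r ^ m * h r / (real (Suc m) * r ^ m)) \<longlongrightarrow> h 0 / real (Suc m)) (at_right 0)"
      by (rule Lim_transform_eventually)
  qed
  moreover have "\<forall>\<^sub>F r in at_right 0. ?I r / r ^ Suc m = w r / r"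
    using pos by eventually_elim (use w in \<open>auto simp: field_simps\<close>)
  ultimately show ?thesis by (rule Lim_transform_eventually)
qed

text \<open>The inverse of \<open>t \<mapsto> t^(p-1)\<close>, extended by \<open>0\<close> so that it is monotone on the whole line.\<close>

definition pinv :: "real \<Rightarrow> real \<Rightarrow> real" where
  "pinv p x = max 0 x powr (1 / (p - 1))"

lemma pinv_nonneg: "0 \<le> pinv p x" by (simp add: pinv_def)

lemma pinv_mono: "1 < p \<Longrightarrow> x \<le> y \<Longrightarrow> pinv p x \<le> pinv p y"
  unfolding pinv_def by (intro powr_mono2) auto

lemma pinv_strict_mono: "1 < p \<Longrightarrow> 0 \<le> x \<Longrightarrow> x < y \<Longrightarrow> pinv p x < pinv p y"
  unfolding pinv_def by (intro powr_less_mono2) auto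

lemma continuous_on_pinv: "1 < p \<Longrightarrow> continuous_on UNIV (pinv p)"
  unfolding pinv_def by (intro continuous_on_powr' continuous_intros) auto

lemma pinv_powr: "1 < p \<Longrightarrow> 0 \<le> y \<Longrightarrow> pinv p (y powr (p - 1)) = y"
  by (auto simp: pinv_def powr_powr)

lemma powr_pinv: "1 < p \<Longrightarrow> 0 \<le> x \<Longrightarrow> pinv p x powr (p - 1) = x"
  by (auto simp: pinv_def powr_powr)

lemma pinv_eq: "0 \<le> x \<Longrightarrow> pinv p x = x powr (1 / (p - 1))"
  by (simp add: pinv_def)

lemma pinv_0: "pinv p 0 = 0" by (simp add: pinv_def)


lemma has_integral_of_derivative:
  fixes V k :: "real \<Rightarrow> real"
  assumes "continuous_on {0..} V" "\<And>t. t > 0 \<Longrightarrow> (V has_real_derivative k t) (at t)" "r \<ge> 0"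
  shows "(k has_integral (V r - V 0)) {0..r}"
  by (intro fundamental_theorem_of_calculus_interior continuous_on_subset[OF assms(1)])
    (use assms in \<open>auto simp: has_real_derivative_iff_has_vector_derivative[symmetric]\<close>)

text \<open>Let t0 be the last time with D >= 0 before a negative value. If t0 > 0, the positive
  derivative at t0 makes D larger just after t0. Derivatives are given for t > 0 only, so t0 = 0 is
  excluded separately, by right-continuity and \<open>D 0 > 0\<close>.\<close>

lemma positive_invariance:
  fixes D d :: "real \<Rightarrow> real"
  assumes cD: "continuous_on {0..} D" and D0: "D 0 > 0"
    and dD: "\<And>t. t > 0 \<Longrightarrow> (D has_real_derivative d t) (at t)"
    and pos: "\<And>t. t > 0 \<Longrightarrow> D t \<ge> 0 \<Longrightarrow> d t > 0"
    and t: "t \<ge> 0"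
  shows "D t \<ge> 0"
proof (rule ccontr)
  assume neg: "\<not> D t \<ge> 0"
  define S where "S = {0..t} \<inter> D -` {0..}"
  have c: "continuous_on {0..t} D" by (rule continuous_on_subset[OF cD]) auto
  have "closed S" unfolding S_def
    by (rule continuous_closed_preimage[OF c]) auto
  moreover have ne: "S \<noteq> {}" using D0 t by (auto simp: S_def intro!: exI[of _ 0])
  moreover have bd: "bdd_above S" by (auto simp: S_def intro!: bdd_aboveI[of _ t])
  ultimately have "Sup S \<in> S" by (intro closed_contains_Sup)
  define t0 where "t0 = Sup S"
  have t0: "0 \<le> t0" "t0 \<le> t" "D t0 \<ge> 0" using \<open>Sup S \<in> S\<close> by (auto simp: S_def t0_def)
  have t0lt: "t0 < t" using t0 neg by (cases "t0 = t") auto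
  have lt: "D s < 0" if "t0 < s" "s \<le> t" for s
  proof (rule ccontr)
    assume "\<not> D s < 0"
    then have "s \<in> S" using that t0 by (auto simp: S_def)
    then show False using cSup_upper[OF _ bd, of s] that by (simp add: t0_def)
  qed
  show False
  proof (cases "t0 = 0")
    case False
    then have "t0 > 0" using t0 by simp
    from DERIV_pos_inc_right[OF dD[OF this] pos[OF this t0(3)]]
    obtain e where e: "e > 0" "\<And>h. h > 0 \<Longrightarrow> h < e \<Longrightarrow> D t0 < D (t0 + h)" by auto
    define k where "k = min (e/2) (t - t0)"
    have k: "0 < k" "k < e" "t0 + k \<le> t" using e(1) t0lt by (auto simp: k_def)
    then show False using e(2)[of k] lt[of "t0 + k"] t0(3) by simp
  next
    case True
    then have tpos: "t > 0" using t0lt by simp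
    have "D 0 \<le> 0"
    proof (rule tendsto_upperbound)
      show "(D \<longlongrightarrow> D 0) (at_right 0)"
      proof -
        have "(D \<longlongrightarrow> D 0) (at 0 within {0..})" using cD by (auto simp: continuous_on_def)
        then show ?thesis by (rule filterlim_mono[OF _ order.refl at_le]) auto
      qed
      show "\<forall>\<^sub>F s in at_right 0. D s \<le> 0"
        using eventually_at_right_real[OF tpos] by eventually_elim (use lt True in force)
    qed simp
    then show False using D0 by simp
  qed
qed

section \<open>One-dimensional upper solutions and the entire radial solution\<close>

lemma primF_facts:
  fixes f :: "real \<Rightarrow> real"
  assumes f_cont: "continuous_on {0..} f" and f_mono: "strict_mono_on {0..} f" and f0: "f 0 = 0"
  shows "continuous_on {0..} (primF f)"
    and "\<And>s. s > 0 \<Longrightarrow> (primF f has_real_derivative f s) (at s)"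
    and "\<And>s t. 0 \<le> s \<Longrightarrow> s < t \<Longrightarrow> primF f s < primF f t"
    and "\<And>s. s > 0 \<Longrightarrow> primF f s > 0"
    and "\<And>s. s > 0 \<Longrightarrow> f s > 0"
    and "\<And>s t. 0 \<le> s \<Longrightarrow> s \<le> t \<Longrightarrow> f s \<le> f t"
    and "\<And>s. s \<ge> 0 \<Longrightarrow> f s \<ge> 0"
proof -
  show fp: "f s > 0" if "s > 0" for s
    using strict_mono_onD[OF f_mono, of 0 s] that f0 by auto
  show "f s \<le> f t" if "0 \<le> s" "s \<le> t" for s t
    using strict_mono_onD[OF f_mono, of s t] that by (cases "s = t") auto
  show "f s \<ge> 0" if "s \<ge> 0" for s using fp[of s] f0 that by (cases "s = 0") auto
  show c: "continuous_on {0..} (primF f)"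
    unfolding primF_def
    by (intro continuous_on_atLeastI indefinite_integral_continuous_1 integrable_continuous_real
       continuous_on_subset[OF f_cont]) auto
  show d: "(primF f has_real_derivative f s) (at s)" if "s > 0" for s
    unfolding primF_def by (rule integral_has_real_derivative_at[OF f_cont that])
  show l: "primF f s < primF f t" if "0 \<le> s" "s < t" for s t
  proof (rule DERIV_pos_imp_increasing_open[OF that(2)])
    show "\<exists>y. (primF f has_real_derivative y) (at x) \<and> 0 < y" if "s < x" "x < t" for x
      using d[of x] fp[of x] that \<open>0 \<le> s\<close> by auto
    show "continuous_on {s..t} (primF f)" by (rule continuous_on_subset[OF c]) (use that in auto)
  qed
  show "primF f s > 0" if "s > 0" for s using l[of 0 s] that by (simp add: primF_def)
qed

text \<open>Along V' = A F(V)^(1/p) one has W = A^(p-1) F(V)^((p-1)/p), and the powers of F cancel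
  in W' = A^p ((p-1)/p) f(V). This has to dominate f(V) together with at most (1/p - \<epsilon>) A^p
  f(V) coming from g.\<close>

lemma upper_solution_of_limsup:
  fixes f g :: "real \<Rightarrow> real"
  assumes p: "1 < p" "2 \<le> p"
    and f: "continuous_on {0..} f" "strict_mono_on {0..} f" "f 0 = 0"
    and nint: "\<not> (\<lambda>s. 1 / primF f s powr (1/p)) integrable_on {1..}"
    and A: "A > 0" "A powr p * \<epsilon> \<ge> 1" and s0: "s0 \<ge> 1"
    and bd: "\<And>s. s \<ge> s0 \<Longrightarrow> g (A * primF f s powr (1/p)) \<le> (1/p - \<epsilon>) * (A powr p * f s)"
  shows "\<exists>V W. continuous_on {0..} V \<and> continuous_on {0..} W \<and> V 0 = s0 \<and> (\<forall>t\<ge>0. V t \<ge> s0 \<and> W t \<ge> 0) \<and>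
    (\<forall>t>0. (V has_real_derivative pinv p (W t)) (at t)) \<and>
    (\<forall>t>0. \<exists>d. (W has_real_derivative d) (at t) \<and> f (V t) + g (pinv p (W t)) \<le> d)"
proof -
  note F = primF_facts[OF f]
  let ?F = "primF f"
  let ?\<phi> = "\<lambda>s. A * ?F s powr (1/p)"
  have Fne: "?F s \<noteq> 0" if "s \<ge> 1" for s using F(4)[of s] that by simp
  have cF1: "continuous_on {1..} (\<lambda>s. ?F s powr q)" for q
  proof (rule continuous_on_powr)
    show "continuous_on {1..} ?F" by (rule continuous_on_subset[OF F(1)]) auto
    show "\<forall>x\<in>{1..}. ?F x \<noteq> 0" using Fne by simp
  qed simp
  have cF: "continuous_on {s0..} (\<lambda>s. ?F s powr q)" for q
    by (rule continuous_on_subset[OF cF1]) (use s0 in auto)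
  \<comment> \<open>The climbing time is 1/A times the integral of F^(-1/p), so its divergence means
    global existence of V.\<close>
  have "\<exists>y. continuous_on {0..} y \<and> y 0 = s0 \<and> (\<forall>t\<ge>0. y t \<ge> s0) \<and>
    (\<forall>t>0. (y has_real_derivative ?\<phi> (y t)) (at t))"
  proof (rule scalar_ode_global)
    show "continuous_on {s0..} ?\<phi>" by (intro continuous_intros cF)
    show "?\<phi> s > 0" if "s \<ge> s0" for s using A F(4)[of s] s0 that by simp
    fix C
    have "continuous_on {1..} (\<lambda>s. 1 / ?F s powr (1/p))"
      by (intro continuous_on_divide cF1 continuous_on_const) (use Fne in simp)
    then obtain s where s: "s \<ge> s0" "integral {s0..s} (\<lambda>s. 1 / ?F s powr (1/p)) \<ge> A * C"
      using integral_unbounded_if_not_integrable_on[OF _ _ nint s0, of "A * C"] by auto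
    have "integral {s0..s} (\<lambda>s. 1 / ?\<phi> s) = integral {s0..s} (\<lambda>s. (1 / A) * (1 / ?F s powr (1/p)))"
      by simp
    also have "\<dots> = (1/A) * integral {s0..s} (\<lambda>s. 1 / ?F s powr (1/p))" by (rule integral_mult_right)
    also have "\<dots> \<ge> C" using s A by (simp add: field_simps)
    finally show "\<exists>s\<ge>s0. C \<le> integral {s0..s} (\<lambda>s. 1 / ?\<phi> s)" using s by blast
  qed
  then obtain V where V: "continuous_on {0..} V" "V 0 = s0" "\<And>t. t \<ge> 0 \<Longrightarrow> V t \<ge> s0"
    "\<And>t. t > 0 \<Longrightarrow> (V has_real_derivative ?\<phi> (V t)) (at t)" by auto
  define W where "W t = ?\<phi> (V t) powr (p - 1)" for t
  have pW: "pinv p (W t) = ?\<phi> (V t)" for t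
    unfolding W_def using A by (intro pinv_powr p) auto
  have Fpos: "?F (V t) > 0" if "t \<ge> 0" for t using F(4) V(3)[OF that] s0 by simp
  define d where "d t = A powr p * ((p - 1) / p) * f (V t)" for t
  have W_eq: "W t = A powr (p - 1) * ?F (V t) powr ((p - 1) / p)" for t
    using A unfolding W_def by (simp add: powr_mult powr_powr)
  have dW: "(W has_real_derivative d t) (at t)" if t: "t > 0" for t
  proof -
    have dF: "((\<lambda>t. ?F (V t)) has_real_derivative f (V t) * ?\<phi> (V t)) (at t)"
      by (rule DERIV_chain2[OF F(2) V(4)]) (use V(3)[of t] s0 t in auto)
    have "(W has_real_derivative A powr (p - 1) * (((p - 1) / p) * ?F (V t) powr ((p - 1) / p - 1) * (f (V t) * ?\<phi> (V t)))) (at t)"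
      unfolding W_eq
      by (intro DERIV_cmult DERIV_chain2[OF has_real_derivative_powr dF]) (use Fpos[of t] t in auto)
    moreover have "(p - 1) / p - 1 = - (1 / p)" using p by (simp add: field_simps)
    moreover have "A powr (p - 1) * (((p - 1) / p) * ?F (V t) powr (- (1/p)) * (f (V t) * ?\<phi> (V t))) = d t"
    proof -
      have "?F (V t) powr (- (1/p)) * ?F (V t) powr (1/p) = 1"
        using Fpos[of t] t by (simp flip: powr_add)
      moreover have "A powr (p - 1) * A = A powr p" using A by (simp add: powr_diff)
      moreover have "A powr (p - 1) * (((p - 1) / p) * ?F (V t) powr (- (1/p)) * (f (V t) * ?\<phi> (V t))) =
        (A powr (p - 1) * A) * ((p - 1) / p) * f (V t) * (?F (V t) powr (- (1/p)) * ?F (V t) powr (1/p))"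
        by (simp only: mult_ac)
      ultimately show ?thesis unfolding d_def by (simp only: mult_1_right)
    qed
    ultimately show ?thesis by simp
  qed
  have cW: "continuous_on {0..} W"
    unfolding W_eq using V(3)
    by (intro continuous_intros continuous_on_compose2[OF cF V(1)]) auto
  have key: "f (V t) + g (pinv p (W t)) \<le> d t" if "t > 0" for t
  proof -
    have fp: "f (V t) > 0" using F(5) V(3)[of t] s0 that by simp
    \<comment> \<open>Split (p-1)/p as (p-2)/p + 1/p. The g-term takes the share 1/p - \<epsilon>,
      the share (p-2)/p is nonnegative because p >= 2, and A^p \<epsilon> >= 1 pays for f.\<close>
    have "A powr p * ((p - 2) / p) \<ge> 0" using p by simp
    then have "1 \<le> A powr p * ((p - 2) / p) + A powr p * \<epsilon>" using A by linarith
    then have "1 * f (V t) \<le> (A powr p * ((p - 2) / p) + A powr p * \<epsilon>) * f (V t)"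
      using fp by (intro mult_right_mono) auto
    moreover have "g (pinv p (W t)) \<le> (1/p - \<epsilon>) * (A powr p * f (V t))"
      unfolding pW using V(3)[of t] that by (intro bd) auto
    moreover have "A powr p * ((p - 1) / p) = A powr p * ((p - 2) / p) + A powr p * (1 / p)"
      using p by (simp add: field_simps)
    ultimately show ?thesis unfolding d_def by (simp add: algebra_simps)
  qed
  have "W t \<ge> 0" for t by (simp add: W_def)
  moreover have "\<exists>d. (W has_real_derivative d) (at t) \<and> f (V t) + g (pinv p (W t)) \<le> d" if "t > 0" for t
    using dW[OF that] key[OF that] by blast
  ultimately show ?thesis
    using V cW pW by (intro exI[of _ V] exI[of _ W] conjI allI impI) simp_all
qed

text \<open>While y = V' dominates A F(V)^(1/p), the hypothesis bounds f(V) by (p / A^p) g(y), so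
  the whole source is at most C g(y); it therefore suffices to solve (y^(p-1))' = C g(y), which is
  global since the second integral diverges. The domination persists because D = y^p - A^p F(V) has
  a positive derivative wherever D >= 0; here p <= 2 enters through 1/(p-1) >= 1.\<close>

lemma upper_solution_of_liminf:
  fixes f g :: "real \<Rightarrow> real"
  assumes p: "1 < p" "p \<le> 2"
    and f: "continuous_on {0..} f" "strict_mono_on {0..} f" "f 0 = 0"
    and g: "continuous_on {0..} g" "strict_mono_on {0..} g" "g 0 = 0"
    and nint: "\<not> (\<lambda>s. s powr (p - 2) / g s) integrable_on {1..}"
    and A: "A > 0" and s0: "s0 \<ge> 1"
    and bd: "\<And>s. s \<ge> s0 \<Longrightarrow> A powr p * f s \<le> p * g (A * primF f s powr (1/p))"
  shows "\<exists>V W. continuous_on {0..} V \<and> continuous_on {0..} W \<and> V 0 = s0 \<and> (\<forall>t\<ge>0. V t \<ge> s0 \<and> W t \<ge> 0) \<and>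
    (\<forall>t>0. (V has_real_derivative pinv p (W t)) (at t)) \<and>
    (\<forall>t>0. \<exists>d. (W has_real_derivative d) (at t) \<and> f (V t) + g (pinv p (W t)) \<le> d)"
proof -
  note F = primF_facts[OF f]
  note G = primF_facts[OF g]
  let ?F = "primF f"
  \<comment> \<open>The summand 1 accounts for g(y), the summand p / A^p for f(V).\<close>
  define C where "C = 1 + p / A powr p"
  have C: "C > 1" using p A by (simp add: C_def)
  \<comment> \<open>The maximum with 1 puts the start into the range of the divergent integral; the
    final + 1 makes D strictly positive at time 0.\<close>
  define y0 where "y0 = max 1 (A * ?F s0 powr (1/p)) + 1"
  have y0: "y0 \<ge> 1" "y0 > A * ?F s0 powr (1/p)" by (auto simp: y0_def)
  let ?\<phi> = "\<lambda>s. C * g s * s powr (2 - p) / (p - 1)"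
  have Gne: "g s \<noteq> 0" if "s \<ge> 1" for s using G(5)[of s] that by simp
  have cg1: "continuous_on {1..} g" by (rule continuous_on_subset[OF g(1)]) auto
  have cp1: "continuous_on {1..} (\<lambda>s::real. s powr q)" for q
    by (intro continuous_on_powr continuous_intros) auto
  have "\<exists>y. continuous_on {0..} y \<and> y 0 = y0 \<and> (\<forall>t\<ge>0. y t \<ge> y0) \<and>
    (\<forall>t>0. (y has_real_derivative ?\<phi> (y t)) (at t))"
  proof (rule scalar_ode_global)
    have "continuous_on {1..} ?\<phi>"
      using p by (intro continuous_intros cg1 cp1) auto
    then show "continuous_on {y0..} ?\<phi>" by (rule continuous_on_subset) (use y0 in auto)
    show "?\<phi> s > 0" if "s \<ge> y0" for s using C G(5)[of s] y0 that p by simp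
    fix D
    have "continuous_on {1..} (\<lambda>s. s powr (p - 2) / g s)"
      by (intro continuous_on_divide cp1 cg1) (use Gne in simp)
    then obtain s where s: "s \<ge> y0" "integral {y0..s} (\<lambda>s. s powr (p - 2) / g s) \<ge> C / (p - 1) * D"
      using integral_unbounded_if_not_integrable_on[OF _ _ nint y0(1), of "C / (p - 1) * D"] G(5)
      by (auto simp: less_imp_le)
    have "integral {y0..s} (\<lambda>s. 1 / ?\<phi> s) = integral {y0..s} (\<lambda>s. ((p - 1) / C) * (s powr (p - 2) / g s))"
    proof (rule integral_cong)
      fix x assume "x \<in> {y0..s}"
      then have x: "x > 0" "g x > 0" using y0 G(5)[of x] by auto
      have "x powr (p - 2) * x powr (2 - p) = 1" using x by (simp flip: powr_add)
      then have "x powr (p - 2) = 1 / x powr (2 - p)" using x by (simp add: field_simps)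
      then show "1 / ?\<phi> x = ((p - 1) / C) * (x powr (p - 2) / g x)" by simp
    qed
    also have "\<dots> = ((p - 1) / C) * integral {y0..s} (\<lambda>s. s powr (p - 2) / g s)" by (rule integral_mult_right)
    also have "\<dots> \<ge> ((p - 1) / C) * (C / (p - 1) * D)" using s p C by (intro mult_left_mono) auto
    also have "((p - 1) / C) * (C / (p - 1) * D) = D" using p C by simp
    finally show "\<exists>s\<ge>y0. D \<le> integral {y0..s} (\<lambda>s. 1 / ?\<phi> s)" using s by blast
  qed
  then obtain y where y: "continuous_on {0..} y" "y 0 = y0" "\<And>t. t \<ge> 0 \<Longrightarrow> y t \<ge> y0"
    "\<And>t. t > 0 \<Longrightarrow> (y has_real_derivative ?\<phi> (y t)) (at t)" by auto
  have ypos: "y t > 0" if "t \<ge> 0" for t using y(3)[OF that] y0 by simp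
  define W where "W t = y t powr (p - 1)" for t
  define V where "V t = s0 + integral {0..t} y" for t
  have V0: "V 0 = s0" by (simp add: V_def)
  have pW: "pinv p (W t) = y t" if "t \<ge> 0" for t
    unfolding W_def using ypos[OF that] by (intro pinv_powr p) auto
  have cV: "continuous_on {0..} V"
    unfolding V_def
    by (intro continuous_on_atLeastI continuous_on_add continuous_on_const
        indefinite_integral_continuous_1 integrable_continuous_real continuous_on_subset[OF y(1)]) auto
  have dV: "(V has_real_derivative y t) (at t)" if "t > 0" for t
    by (rule primitive_has_real_derivative_at[OF y(1) that]) (simp add: V_def)
  have Vge: "V t \<ge> s0" if "t \<ge> 0" for t
    unfolding V_def using ypos
    by (auto intro!: integral_nonneg integrable_continuous_real continuous_on_subset[OF y(1)] simp: less_imp_le)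
  have cW: "continuous_on {0..} W"
    unfolding W_def by (intro continuous_on_powr y continuous_on_const) (use ypos in force)
  have dW: "(W has_real_derivative C * g (y t)) (at t)" if t: "t > 0" for t
  proof -
    have yt: "y t > 0" using ypos t by simp
    have "(W has_real_derivative (p - 1) * y t powr (p - 1 - 1) * ?\<phi> (y t)) (at t)"
      unfolding W_def by (intro DERIV_chain2[OF has_real_derivative_powr y(4)]) (use yt t in auto)
    moreover have "(p - 1) * y t powr (p - 1 - 1) * ?\<phi> (y t) = C * g (y t)"
    proof -
      have "y t powr (p - 1 - 1) * y t powr (2 - p) = 1" using yt by (simp flip: powr_add)
      moreover have "(p - 1) * y t powr (p - 1 - 1) * ?\<phi> (y t)
        = ((p - 1) / (p - 1)) * (C * g (y t)) * (y t powr (p - 1 - 1) * y t powr (2 - p))" by simp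
      ultimately show ?thesis using p by simp
    qed
    ultimately show ?thesis by simp
  qed
  define D where "D t = y t powr p - A powr p * ?F (V t)" for t
  define d where "d t = (p / (p - 1)) * C * g (y t) * y t - A powr p * (f (V t) * y t)" for t
  have root: "A * ?F (V t) powr (1/p) \<le> y t" if "D t \<ge> 0" "t \<ge> 0" for t
  proof -
    have Fp: "?F (V t) > 0" using F(4) Vge[OF that(2)] s0 by simp
    have "(A powr p * ?F (V t)) powr (1/p) \<le> (y t powr p) powr (1/p)"
      using that(1) p Fp by (intro powr_mono2) (auto simp: D_def)
    then show ?thesis using ypos[OF that(2)] A Fp p by (simp add: powr_mult powr_powr)
  qed
  have fg: "A powr p * f (V t) \<le> p * g (y t)" if "D t \<ge> 0" "t \<ge> 0" for t
  proof -
    have "g (A * ?F (V t) powr (1/p)) \<le> g (y t)"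
      using root[OF that] A by (intro G(6)) auto
    then have "p * g (A * ?F (V t) powr (1/p)) \<le> p * g (y t)" using p by simp
    with bd[OF Vge[OF that(2)]] show ?thesis by linarith
  qed
  have Dnn: "D t \<ge> 0" if "t \<ge> 0" for t
  proof (rule positive_invariance[where D = D and d = d, OF _ _ _ _ that])
    have "continuous_on {0..} (\<lambda>t. y t powr p)"
      by (intro continuous_on_powr y continuous_on_const) (use ypos in force)
    moreover have "continuous_on {0..} (\<lambda>t. ?F (V t))"
      by (rule continuous_on_compose2[OF F(1) cV]) (use Vge s0 in force)
    ultimately show "continuous_on {0..} D" unfolding D_def
      by (intro continuous_on_diff continuous_on_mult continuous_on_const)
    have "(A * ?F s0 powr (1/p)) powr p < y0 powr p"
      using y0 p A by (intro powr_less_mono2) auto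
    then show "0 < D 0" using A F(4)[of s0] s0 p
      by (simp add: D_def y(2) V0 powr_mult powr_powr)
    fix t :: real assume t: "t > 0"
    have yt: "y t > 0" using ypos t by simp
    have d1: "((\<lambda>t. y t powr p) has_real_derivative p * y t powr (p - 1) * ?\<phi> (y t)) (at t)"
      by (intro DERIV_chain2[OF has_real_derivative_powr y(4)]) (use yt t in auto)
    have e1: "p * y t powr (p - 1) * ?\<phi> (y t) = (p / (p - 1)) * C * g (y t) * y t"
    proof -
      have "y t powr (p - 1) * y t powr (2 - p) = y t" using yt by (simp flip: powr_add)
      moreover have "p * y t powr (p - 1) * ?\<phi> (y t)
        = (p / (p - 1)) * C * g (y t) * (y t powr (p - 1) * y t powr (2 - p))" by simp
      ultimately show ?thesis by simp
    qed
    have d2: "((\<lambda>t. ?F (V t)) has_real_derivative f (V t) * y t) (at t)"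
      by (rule DERIV_chain2[OF F(2) dV]) (use Vge[of t] s0 t in auto)
    show "(D has_real_derivative d t) (at t)"
      unfolding D_def d_def e1[symmetric] by (intro DERIV_diff DERIV_cmult d1 d2)
    assume Dt: "0 \<le> D t"
    have gy: "g (y t) > 0" using G(5) yt by simp
    have "1 \<le> 1 / (p - 1)" using p by (simp add: field_simps)
    then have "1 * (p * g (y t)) \<le> 1 / (p - 1) * (p * g (y t))"
      using gy p by (intro mult_right_mono) auto
    \<comment> \<open>C > 1 supplies the strictness that \<open>positive_invariance\<close>
      demands.\<close>
    moreover have "1 / (p - 1) * (p * g (y t)) * 1 < 1 / (p - 1) * (p * g (y t)) * C"
      using gy p C by (intro mult_strict_left_mono) auto
    ultimately have "A powr p * f (V t) < 1 / (p - 1) * (p * g (y t)) * C"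
      using fg[OF Dt] t by linarith
    then have "A powr p * f (V t) * y t < 1 / (p - 1) * (p * g (y t)) * C * y t"
      using yt by (intro mult_strict_right_mono)
    then show "0 < d t" unfolding d_def by (simp add: mult_ac)
  qed
  have key: "f (V t) + g (pinv p (W t)) \<le> C * g (y t)" if "t > 0" for t
  proof -
    have "f (V t) \<le> p * g (y t) / A powr p"
      using fg[OF Dnn, of t] that A by (simp add: field_simps)
    then show ?thesis using that by (simp add: pW C_def algebra_simps)
  qed
  have "W t \<ge> 0" for t by (simp add: W_def)
  moreover have "\<exists>d. (W has_real_derivative d) (at t) \<and> f (V t) + g (pinv p (W t)) \<le> d" if "t > 0" for t
    using dW[OF that] key[OF that] by blast
  ultimately show ?thesis
    using cV cW V0 Vge dV pW by (intro exI[of _ V] exI[of _ W] conjI allI impI) simp_all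
qed

lemma radial_solution_of_upper:
  fixes f g :: "real \<Rightarrow> real" and m :: nat
  assumes p: "1 < p"
    and f: "continuous_on {0..} f" "strict_mono_on {0..} f" "f 0 = 0"
    and g: "continuous_on {0..} g" "strict_mono_on {0..} g" "g 0 = 0"
    and cV: "continuous_on {0..} V" and cW: "continuous_on {0..} W" and V0: "V 0 = s0" and s0: "s0 > 0"
    and VW: "\<And>t. t \<ge> 0 \<Longrightarrow> V t \<ge> s0 \<and> W t \<ge> 0"
    and dV: "\<And>t. t > 0 \<Longrightarrow> (V has_real_derivative pinv p (W t)) (at t)"
    and dW: "\<And>t. t > 0 \<Longrightarrow> \<exists>d. (W has_real_derivative d) (at t) \<and> f (V t) + g (pinv p (W t)) \<le> d"
  obtains v w where "continuous_on {0..} v" "continuous_on {0..} w"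
    "\<And>r. r \<ge> 0 \<Longrightarrow> v r = s0 + integral {0..r} (\<lambda>s. pinv p (w s))"
    "\<And>r. r \<ge> 0 \<Longrightarrow> w r = integral {0..r} (\<lambda>s. s ^ m * (f (v s) + g (pinv p (w s)))) / r ^ m"
    "\<And>r. r \<ge> 0 \<Longrightarrow> 0 \<le> w r" "\<And>r. r \<ge> 0 \<Longrightarrow> s0 \<le> v r"
proof -
  note F = primF_facts[OF f]
  note G = primF_facts[OF g]
  \<comment> \<open>\<open>max 0 x\<close> extends f monotonically and continuously to the whole
    line, as the iteration requires. It disappears at the end because v >= s0 > 0.\<close>
  define H where "H x y = f (max 0 x) + g (pinv p y)" for x y
  have cb: "continuous_on UNIV (pinv p)" by (rule continuous_on_pinv[OF p])
  have cH: "continuous_on UNIV (\<lambda>z. H (fst z) (snd z))"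
    unfolding H_def
    by (intro continuous_intros continuous_on_compose2[OF f(1)] continuous_on_compose2[OF g(1)]
        continuous_on_compose2[OF cb]) (auto simp: pinv_nonneg)
  obtain v w where vw: "continuous_on {0..} v" "continuous_on {0..} w"
    "\<And>r. r \<ge> 0 \<Longrightarrow> v r = s0 + integral {0..r} (\<lambda>s. pinv p (w s))"
    "\<And>r. r \<ge> 0 \<Longrightarrow> w r = integral {0..r} (\<lambda>s. s ^ m * H (v s) (w s)) / r ^ m"
    "\<And>r. r \<ge> 0 \<Longrightarrow> 0 \<le> w r" "\<And>r r'. 0 \<le> r \<Longrightarrow> r \<le> r' \<Longrightarrow> w r \<le> w r'"
  proof (rule radial_system_solution[of H "pinv p" V W s0 m])
    show "continuous_on UNIV (\<lambda>z. H (fst z) (snd z))" by (rule cH)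
    show "H x y \<le> H x' y'" if "x \<le> x'" "y \<le> y'" for x x' y y'
      unfolding H_def using that pinv_mono[OF p] by (intro add_mono F G) (auto simp: pinv_nonneg)
    show "0 \<le> H x y" for x y unfolding H_def by (intro add_nonneg_nonneg F G) (auto simp: pinv_nonneg)
    show "continuous_on UNIV (pinv p)" by (rule cb)
    show "s0 + integral {0..r} (\<lambda>s. pinv p (W s)) \<le> V r" if "r \<ge> 0" for r
      using has_integral_of_derivative[OF cV dV that] V0 by (simp add: integral_unique)
    show "integral {0..r} (\<lambda>s. H (V s) (W s)) \<le> W r" if "r \<ge> 0" for r
    proof -
      define d where "d = deriv W"
      have d1: "(W has_real_derivative d t) (at t)" and d2: "H (V t) (W t) \<le> d t" if "t > 0" for t
        using dW[OF that] VW[of t] s0 that by (auto simp: d_def H_def DERIV_imp_deriv max_def)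
      have I: "(d has_integral (W r - W 0)) {0..r}"
        by (rule has_integral_of_derivative[OF cW d1 that])
      have cHVW: "continuous_on {0..} (\<lambda>s. H (V s) (W s))"
        using continuous_on_compose2[OF cH continuous_on_Pair[OF cV cW]] by auto
      have "((\<lambda>s. H (V s) (W s)) has_integral integral {0..r} (\<lambda>s. H (V s) (W s))) {0..r}"
        by (intro integrable_integral integrable_continuous_real continuous_on_subset[OF cHVW]) auto
      \<comment> \<open>The differential inequality is known for t > 0 only; altering the integrand
        at one point leaves the integral unchanged and makes the pointwise comparison hold on the
        closed interval.\<close>
      moreover have "((\<lambda>t. if t = 0 then H (V 0) (W 0) else d t) has_integral (W r - W 0)) {0..r}"
        by (rule has_integral_spike_finite[OF _ _ I, of "{0}"]) auto
      ultimately have "integral {0..r} (\<lambda>s. H (V s) (W s)) \<le> W r - W 0"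
        by (rule has_integral_le) (use d2 in auto)
      then show ?thesis using VW[of 0] by simp
    qed
  qed (use pinv_mono[OF p] pinv_nonneg cV cW in auto)
  have vge: "s0 \<le> v r" if "r \<ge> 0" for r
  proof -
    have "continuous_on {0..r} (\<lambda>s. pinv p (w s))"
      by (rule continuous_on_compose2[OF cb continuous_on_subset[OF vw(2)]]) auto
    then have "0 \<le> integral {0..r} (\<lambda>s. pinv p (w s))"
      by (intro integral_nonneg integrable_continuous_real) (auto simp: pinv_nonneg)
    then show ?thesis using vw(3)[OF that] by simp
  qed
  have "integral {0..r} (\<lambda>s. s ^ m * H (v s) (w s)) = integral {0..r} (\<lambda>s. s ^ m * (f (v s) + g (pinv p (w s))))" for r
  proof (rule integral_cong)
    fix s assume "s \<in> {0..r}"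
    then have "max 0 (v s) = v s" using vge[of s] s0 by simp
    then show "s ^ m * H (v s) (w s) = s ^ m * (f (v s) + g (pinv p (w s)))" by (simp add: H_def)
  qed
  then show ?thesis using that[OF vw(1-3) _ vw(5) vge] vw(4) by simp
qed


lemma loc_lipschitz_nonneg_imp_continuous_on:
  assumes "loc_lipschitz_nonneg g"
  shows "continuous_on {0..} g"
proof (rule continuous_on_atLeastI)
  fix T :: real assume "T \<ge> 0"
  then obtain L where "L-lipschitz_on {0..T} g" using assms by (auto simp: loc_lipschitz_nonneg_def)
  then show "continuous_on {0..T} g" by (rule lipschitz_on_continuous_on)
qed

lemma radial_global_solution:
  fixes f g :: "real \<Rightarrow> real" and m :: nat
  assumes p: "1 < p"
    and f: "continuous_on {0..} f" "strict_mono_on {0..} f" "f 0 = 0"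
    and g: "continuous_on {0..} g" "strict_mono_on {0..} g" "g 0 = 0"
    and nintF: "\<not> (\<lambda>s. 1 / primF f s powr (1/p)) integrable_on {1..}"
    and nintg: "\<not> (\<lambda>s. s powr (p - 2) / g s) integrable_on {1..}"
    and \<epsilon>: "\<epsilon> > 0" and lim: "\<And>A. A \<ge> A0 \<Longrightarrow>
        (p \<le> 2 \<and> Liminf at_top (\<lambda>s. ereal (g (A * primF f s powr (1/p)) / (A powr p * f s)))
                     > ereal (1/p + \<epsilon>)) \<or>
        (p \<ge> 2 \<and> Limsup at_top (\<lambda>s. ereal (g (A * primF f s powr (1/p)) / (A powr p * f s)))
                     < ereal (1/p - \<epsilon>))"
  obtains s0 v w where "s0 > 0" "continuous_on {0..} v" "continuous_on {0..} w"
    "\<And>r. r \<ge> 0 \<Longrightarrow> v r = s0 + integral {0..r} (\<lambda>s. pinv p (w s))"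
    "\<And>r. r \<ge> 0 \<Longrightarrow> w r = integral {0..r} (\<lambda>s. s ^ m * (f (v s) + g (pinv p (w s)))) / r ^ m"
    "\<And>r. r \<ge> 0 \<Longrightarrow> 0 \<le> w r" "\<And>r. r \<ge> 0 \<Longrightarrow> s0 \<le> v r"
proof -
  note F = primF_facts[OF f]
  \<comment> \<open>Large enough for the alternatives to apply and for A^p \<epsilon> >= 1, which
    the limsup case consumes; the inner 1 ensures A > 0.\<close>
  define A where "A = max A0 (max 1 ((1/\<epsilon>) powr (1/p)))"
  have A: "A \<ge> A0" "A > 0" by (auto simp: A_def)
  have "((1/\<epsilon>) powr (1/p)) powr p \<le> A powr p"
    using p by (intro powr_mono2) (auto simp: A_def)
  then have A\<epsilon>: "A powr p * \<epsilon> \<ge> 1" using \<epsilon> p by (simp add: powr_powr field_simps)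
  let ?q = "\<lambda>s. g (A * primF f s powr (1/p)) / (A powr p * f s)"
  have Afs: "A powr p * f s > 0" if "s \<ge> 1" for s using F(5)[of s] A that by simp
  have "\<exists>s0\<ge>1. \<exists>V W. continuous_on {0..} V \<and> continuous_on {0..} W \<and> V 0 = s0 \<and> (\<forall>t\<ge>0. V t \<ge> s0 \<and> W t \<ge> 0) \<and>
    (\<forall>t>0. (V has_real_derivative pinv p (W t)) (at t)) \<and>
    (\<forall>t>0. \<exists>d. (W has_real_derivative d) (at t) \<and> f (V t) + g (pinv p (W t)) \<le> d)"
    using lim[OF A(1)]
  proof (elim disjE conjE)
    assume p2: "p \<le> 2" and L: "Liminf at_top (\<lambda>s. ereal (?q s)) > ereal (1/p + \<epsilon>)"
    from less_LiminfD[OF L] obtain s1 where s1: "\<And>s. s \<ge> s1 \<Longrightarrow> ?q s > 1/p + \<epsilon>"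
      by (auto simp: eventually_at_top_linorder)
    have "A powr p * f s \<le> p * g (A * primF f s powr (1/p))" if "s \<ge> max s1 1" for s
    proof -
      have "1/p \<le> ?q s" using s1[of s] \<epsilon> that by simp
      then have "(1/p) * (A powr p * f s) \<le> g (A * primF f s powr (1/p))"
        using Afs[of s] that by (subst (asm) pos_le_divide_eq) auto
      then show ?thesis using p by (simp add: field_simps)
    qed
    then show ?thesis using upper_solution_of_liminf[OF p p2 f g nintg A(2), of "max s1 1"]
      by (intro exI[of _ "max s1 1"]) auto
  next
    assume p2: "p \<ge> 2" and L: "Limsup at_top (\<lambda>s. ereal (?q s)) < ereal (1/p - \<epsilon>)"
    from Limsup_lessD[OF L] obtain s1 where s1: "\<And>s. s \<ge> s1 \<Longrightarrow> ?q s < 1/p - \<epsilon>"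
      by (auto simp: eventually_at_top_linorder)
    have "g (A * primF f s powr (1/p)) \<le> (1/p - \<epsilon>) * (A powr p * f s)" if "s \<ge> max s1 1" for s
    proof -
      have "?q s \<le> 1/p - \<epsilon>" using s1[of s] that by simp
      then show ?thesis using Afs[of s] that by (subst (asm) pos_divide_le_eq) auto
    qed
    then show ?thesis using upper_solution_of_limsup[OF p p2 f nintF A(2) A\<epsilon>, of "max s1 1"]
      by (intro exI[of _ "max s1 1"]) auto
  qed
  then obtain s0 V W where *: "s0 \<ge> 1" "continuous_on {0..} V" "continuous_on {0..} W" "V 0 = s0"
    "\<And>t. t \<ge> 0 \<Longrightarrow> V t \<ge> s0 \<and> W t \<ge> 0" "\<And>t. t > 0 \<Longrightarrow> (V has_real_derivative pinv p (W t)) (at t)"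
    "\<And>t. t > 0 \<Longrightarrow> \<exists>d. (W has_real_derivative d) (at t) \<and> f (V t) + g (pinv p (W t)) \<le> d"
    by blast
  then have s0: "s0 > 0" by simp
  show ?thesis
    by (rule radial_solution_of_upper[OF p f g *(2-4) s0 *(5-7), of m];
        (assumption | (rule that[OF s0]; assumption)))
qed

section \<open>Capped radial solutions that become steep within a fixed radius\<close>

lemma radial_truncated_solution:
  fixes f g :: "real \<Rightarrow> real" and m :: nat
  assumes p: "1 < p"
    and f: "continuous_on {0..} f" "strict_mono_on {0..} f" "f 0 = 0"
    and g: "continuous_on {0..} g" "strict_mono_on {0..} g" "g 0 = 0"
    and \<epsilon>: "\<epsilon> > 0" and N: "N \<ge> 0"
  obtains v w h where "continuous_on {0..} v" "continuous_on {0..} w" "continuous_on {0..} h"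
    "\<And>r. r \<ge> 0 \<Longrightarrow> v r = \<epsilon> + integral {0..r} (\<lambda>s. pinv p (w s))"
    "\<And>r. r \<ge> 0 \<Longrightarrow> w r = integral {0..r} (\<lambda>s. s ^ m * h s) / r ^ m"
    "\<And>r. r \<ge> 0 \<Longrightarrow> 0 \<le> w r" "\<And>r. r \<ge> 0 \<Longrightarrow> \<epsilon> \<le> v r"
    "\<And>r. r \<ge> 0 \<Longrightarrow> h r = min (f (v r) + g (pinv p (w r))) N"
    "\<And>r r'. 0 \<le> r \<Longrightarrow> r \<le> r' \<Longrightarrow> w r \<le> w r'"
proof -
  note F = primF_facts[OF f]
  note G = primF_facts[OF g]
  \<comment> \<open>The cap bounds the source by N, and the capped source never exceeds f + g; a
    solution of the capped equation is therefore a supersolution of the original one.\<close>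
  define H where "H x y = min (f (max 0 x) + g (pinv p y)) N" for x y
  have cb: "continuous_on UNIV (pinv p)" by (rule continuous_on_pinv[OF p])
  have cH: "continuous_on UNIV (\<lambda>z. H (fst z) (snd z))"
    unfolding H_def
    by (intro continuous_intros continuous_on_compose2[OF f(1)] continuous_on_compose2[OF g(1)]
        continuous_on_compose2[OF cb]) (auto simp: pinv_nonneg)
  \<comment> \<open>With a source bounded by N, the function N r together with the primitive of its
    \<open>pinv\<close> is an upper solution for all radii, whatever the growth of f and g.\<close>
  have cW: "continuous_on {0..} (\<lambda>r. N * r)" by (intro continuous_intros)
  have cbW: "continuous_on {0..} (\<lambda>s. pinv p (N * s))"
    by (rule continuous_on_compose2[OF cb cW]) auto
  obtain v w where vw: "continuous_on {0..} v" "continuous_on {0..} w"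
    "\<And>r. r \<ge> 0 \<Longrightarrow> v r = \<epsilon> + integral {0..r} (\<lambda>s. pinv p (w s))"
    "\<And>r. r \<ge> 0 \<Longrightarrow> w r = integral {0..r} (\<lambda>s. s ^ m * H (v s) (w s)) / r ^ m"
    "\<And>r. r \<ge> 0 \<Longrightarrow> 0 \<le> w r" "\<And>r r'. 0 \<le> r \<Longrightarrow> r \<le> r' \<Longrightarrow> w r \<le> w r'"
  proof (rule radial_system_solution[of H "pinv p" "\<lambda>r. \<epsilon> + integral {0..r} (\<lambda>s. pinv p (N * s))" "\<lambda>r. N * r" \<epsilon> m])
    show "continuous_on UNIV (\<lambda>z. H (fst z) (snd z))" by (rule cH)
    show "H x y \<le> H x' y'" if "x \<le> x'" "y \<le> y'" for x x' y y'
      unfolding H_def using that pinv_mono[OF p] by (intro min.mono add_mono F G) (auto simp: pinv_nonneg)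
    show "0 \<le> H x y" for x y
      unfolding H_def using N by (intro min.boundedI add_nonneg_nonneg F G) (auto simp: pinv_nonneg)
    show cV: "continuous_on {0..} (\<lambda>r. \<epsilon> + integral {0..r} (\<lambda>s. pinv p (N * s)))"
      by (intro continuous_on_atLeastI continuous_on_add continuous_on_const
        indefinite_integral_continuous_1 integrable_continuous_real continuous_on_subset[OF cbW]) auto
    show "continuous_on UNIV (pinv p)" by (rule cb)
    show "integral {0..r} (\<lambda>s. H (\<epsilon> + integral {0..s} (\<lambda>s. pinv p (N * s))) (N * s)) \<le> N * r" if "r \<ge> 0" for r
    proof -
      have "continuous_on {0..} (\<lambda>s. H (\<epsilon> + integral {0..s} (\<lambda>s. pinv p (N * s))) (N * s))"
        using continuous_on_compose2[OF cH continuous_on_Pair[OF cV cW]] by auto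
      then have "integral {0..r} (\<lambda>s. H (\<epsilon> + integral {0..s} (\<lambda>s. pinv p (N * s))) (N * s)) \<le> integral {0..r} (\<lambda>s. N)"
        by (intro integral_le integrable_continuous_real) (auto intro: continuous_on_subset simp: H_def)
      then show ?thesis using that by (simp add: mult.commute)
    qed
  qed (use pinv_mono[OF p] pinv_nonneg cW in auto)
  have vge: "\<epsilon> \<le> v r" if "r \<ge> 0" for r
  proof -
    have "continuous_on {0..r} (\<lambda>s. pinv p (w s))"
      by (rule continuous_on_compose2[OF cb continuous_on_subset[OF vw(2)]]) auto
    then have "0 \<le> integral {0..r} (\<lambda>s. pinv p (w s))"
      by (intro integral_nonneg integrable_continuous_real) (auto simp: pinv_nonneg)
    then show ?thesis using vw(3)[OF that] by simp
  qed
  have "continuous_on {0..} (\<lambda>s. H (v s) (w s))"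
    using continuous_on_compose2[OF cH continuous_on_Pair[OF vw(1,2)]] by auto
  moreover have "H (v r) (w r) = min (f (v r) + g (pinv p (w r))) N" if "r \<ge> 0" for r
    using vge[OF that] \<epsilon> by (simp add: H_def max_def)
  ultimately show ?thesis using that[OF vw(1,2) _ vw(3-5) vge _ vw(6)] by blast
qed

text \<open>For y = w^(1/(p-1)) one has y' = w^(1/(p-1) - 1) w' / (p-1), and that power of w is the
  reciprocal of y^(p-2). Hence w' >= g(y)/n becomes y' y^(p-2) / g(y) >= 1/(n(p-1)), and the finite
  integral limits the lifetime. The conclusion is phrased as an impossibility on [0, R] so that R
  depends on neither w nor d.\<close>

lemma radial_blow_up_gradient:
  fixes f g :: "real \<Rightarrow> real"
  assumes p: "1 < p" and n: "n > (0::real)"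
    and f: "continuous_on {0..} f" "strict_mono_on {0..} f" "f 0 = 0"
    and g: "continuous_on {0..} g" "strict_mono_on {0..} g" "g 0 = 0"
    and \<epsilon>: "\<epsilon> > 0" and int: "(\<lambda>s. s powr (p - 2) / g s) integrable_on {1..}"
  obtains R where "R > 0" "\<And>w d. continuous_on {0..R} w \<Longrightarrow>
    (\<And>r. 0 < r \<Longrightarrow> r < R \<Longrightarrow> (w has_real_derivative d r) (at r)) \<Longrightarrow>
    (\<And>r. 0 \<le> r \<Longrightarrow> r \<le> R \<Longrightarrow> f \<epsilon> / n * r \<le> w r) \<Longrightarrow>
    (\<And>r. 0 < r \<Longrightarrow> r < R \<Longrightarrow> g (pinv p (w r)) \<le> n * d r) \<Longrightarrow> False"
proof -
  note F = primF_facts[OF f]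
  note G = primF_facts[OF g]
  define \<psi> where "\<psi> s = s powr (p - 2) / g s" for s
  have c\<psi>: "continuous_on {0<..} \<psi>"
    unfolding \<psi>_def
  proof (intro continuous_on_divide continuous_on_powr continuous_on_id continuous_on_const)
    show "continuous_on {0<..} g" by (rule continuous_on_subset[OF g(1)]) auto
    show "\<forall>x\<in>{0<..}. g x \<noteq> 0"
    proof
      fix x :: real assume "x \<in> {0<..}"
      then show "g x \<noteq> 0" using G(5)[of x] by simp
    qed
  qed auto
  have \<psi>pos: "\<psi> s > 0" if "s > 0" for s using G(5)[OF that] that by (simp add: \<psi>_def)
  \<comment> \<open>The bound w >= f(\<epsilon>) r / n gives y >= a at r = 1; the clock starts there
    because the integrand is controlled only away from 0.\<close>
  define a where "a = pinv p (f \<epsilon> / n)"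
  have fe: "f \<epsilon> / n > 0" using F(5)[OF \<epsilon>] n by simp
  have a: "a > 0" using pinv_strict_mono[OF p _ fe] by (simp add: a_def pinv_0)
  have "\<psi> integrable_on {1..}" using int by (simp add: \<psi>_def[abs_def])
  then obtain C where C: "\<And>s. s \<ge> a \<Longrightarrow> integral {a..s} \<psi> \<le> C"
    using integral_bounded_if_integrable_on[OF c\<psi> less_imp_le[OF \<psi>pos] _ a] by blast
  define c where "c = 1 / (n * (p - 1))"
  have c: "c > 0" using n p by (simp add: c_def)
  \<comment> \<open>The time from 1 to R is 1 + |C|/c, so c (R - 1) = c + |C| exceeds C.\<close>
  define R where "R = 2 + \<bar>C\<bar> / c"
  have R: "R \<ge> 2" using c by (simp add: R_def)
  show ?thesis
  proof (rule that[of R])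
    show "R > 0" using R by simp
    fix w d assume cw: "continuous_on {0..R} w"
      and dw: "\<And>r. 0 < r \<Longrightarrow> r < R \<Longrightarrow> (w has_real_derivative d r) (at r)"
      and wge: "\<And>r. 0 \<le> r \<Longrightarrow> r \<le> R \<Longrightarrow> f \<epsilon> / n * r \<le> w r"
      and gd: "\<And>r. 0 < r \<Longrightarrow> r < R \<Longrightarrow> g (pinv p (w r)) \<le> n * d r"
    define y where "y r = pinv p (w r)" for r
    have ygt: "y t > a" if "1 < t" "t \<le> R" for t
    proof -
      have "f \<epsilon> / n * 1 < f \<epsilon> / n * t" using that fe by (intro mult_strict_left_mono)
      also have "\<dots> \<le> w t" using that by (intro wge) auto
      finally show ?thesis unfolding y_def a_def using fe by (intro pinv_strict_mono[OF p]) auto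
    qed
    have "c * (R - 1) \<le> C"
    proof (rule blow_up_time[OF c\<psi> \<psi>pos C a])
      show "continuous_on {1..R} y"
        unfolding y_def by (rule continuous_on_compose2[OF continuous_on_pinv[OF p] continuous_on_subset[OF cw]]) auto
      show "y t \<ge> a" if "1 \<le> t" "t \<le> R" for t
        using wge[of t] that mult_left_mono[of 1 t "f \<epsilon> / n"] fe unfolding y_def a_def
        by (intro pinv_mono[OF p]) auto
      show "y t > a" if "1 < t" "t < R" for t using ygt that by simp
      fix t assume t: "1 < t" "t < R"
      have wt: "w t > 0" using wge[of t] t fe mult_pos_pos[of "f \<epsilon> / n" t] by linarith
      have yt: "y t > 0" using ygt t a by fastforce
      have "((\<lambda>r. w r powr (1/(p-1))) has_real_derivative (1/(p-1)) * w t powr (1/(p-1) - 1) * d t) (at t)"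
        by (intro DERIV_chain2[OF has_real_derivative_powr dw]) (use wt t in auto)
      then have dy: "(y has_real_derivative (1/(p-1)) * w t powr (1/(p-1) - 1) * d t) (at t)"
      proof (rule has_field_derivative_transform_within_open[where S = "{0<..<R}"])
        fix x assume x: "x \<in> {0<..<R}"
        then have "w x \<ge> 0" using wge[of x] fe mult_pos_pos[of "f \<epsilon> / n" x] by auto
        then show "w x powr (1/(p-1)) = y x" by (simp add: y_def pinv_eq)
      qed (use t in auto)
      have e: "w t powr (1/(p-1) - 1) * y t powr (p - 2) = 1"
      proof -
        have "y t powr (p - 2) = w t powr ((1/(p-1)) * (p - 2))"
          using wt by (simp add: y_def pinv_eq powr_powr)
        moreover have "(1/(p-1) - 1) + (1/(p-1)) * (p - 2) = 0" using p by (simp add: field_simps)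
        ultimately show ?thesis using wt by (simp flip: powr_add)
      qed
      have gy: "g (y t) > 0" using G(5) yt by simp
      have "c = (1/(p-1)) * (1/n)" by (simp add: c_def)
      also have "\<dots> \<le> (1/(p-1)) * (d t / g (y t))"
        using gd[of t] t n gy p by (intro mult_left_mono) (auto simp: y_def field_simps)
      also have "\<dots> = (1/(p-1)) * d t * (w t powr (1/(p-1) - 1) * y t powr (p - 2)) / g (y t)"
        unfolding e by simp
      also have "\<dots> = (1/(p-1)) * w t powr (1/(p-1) - 1) * d t * \<psi> (y t)"
        by (simp add: \<psi>_def)
      finally show "\<exists>d. (y has_real_derivative d) (at t) \<and> c \<le> d * \<psi> (y t)" using dy by blast
    qed (use R in auto)
    moreover have "c * (R - 1) = c + \<bar>C\<bar>" using c by (simp add: R_def field_simps)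
    ultimately show False using c by linarith
  qed
qed

text \<open>An energy argument: with v' = w^(1/(p-1)), the quantity n ((p-1)/p) w^(p/(p-1)) - F(v)
  has derivative v' (n w' - f(v)) >= 0. Thus w^(p/(p-1)) controls F(v) - F(\<epsilon>), and its p-th
  root is v' itself; once v >= a > \<epsilon> this reads v' >= c F(v)^(1/p).\<close>

lemma radial_blow_up_value:
  fixes f :: "real \<Rightarrow> real"
  assumes p: "1 < p" and n: "n > (0::real)"
    and f: "continuous_on {0..} f" "strict_mono_on {0..} f" "f 0 = 0"
    and \<epsilon>: "\<epsilon> > 0" and int: "(\<lambda>s. 1 / primF f s powr (1/p)) integrable_on {1..}"
  obtains R where "R > 0" "\<And>v w d. continuous_on {0..R} v \<Longrightarrow> continuous_on {0..R} w \<Longrightarrow> v 0 = \<epsilon> \<Longrightarrow> w 0 = 0 \<Longrightarrow>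
    (\<And>r. 0 < r \<Longrightarrow> r < R \<Longrightarrow> (v has_real_derivative pinv p (w r)) (at r)) \<Longrightarrow>
    (\<And>r. 0 < r \<Longrightarrow> r < R \<Longrightarrow> (w has_real_derivative d r) (at r)) \<Longrightarrow>
    (\<And>r. 0 \<le> r \<Longrightarrow> r \<le> R \<Longrightarrow> f \<epsilon> / n * r \<le> w r) \<Longrightarrow>
    (\<And>r. 0 < r \<Longrightarrow> r < R \<Longrightarrow> f (v r) \<le> n * d r) \<Longrightarrow> False"
proof -
  note F = primF_facts[OF f]
  let ?F = "primF f"
  define \<psi> where "\<psi> s = 1 / ?F s powr (1/p)" for s
  have Fne: "?F s \<noteq> 0" if "s > 0" for s using F(4)[OF that] by simp
  have c\<psi>: "continuous_on {0<..} \<psi>"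
    unfolding \<psi>_def
  proof (intro continuous_on_divide continuous_on_powr continuous_on_const)
    show "continuous_on {0<..} ?F" by (rule continuous_on_subset[OF F(1)]) auto
  qed (use Fne p in auto)
  have \<psi>pos: "\<psi> s > 0" if "s > 0" for s using F(4)[OF that] by (simp add: \<psi>_def)
  \<comment> \<open>A lower bound for v' on [1/2, 1]; it makes v climb by at least b1/2 there, so v
    has passed \<epsilon> by a definite amount at radius 1, when the clock starts.\<close>
  define b1 where "b1 = pinv p (f \<epsilon> / n * (1/2))"
  have fe: "f \<epsilon> / n > 0" using F(5)[OF \<epsilon>] n by simp
  have b1: "b1 > 0" using pinv_strict_mono[OF p _, of 0 "f \<epsilon> / n * (1/2)"] fe by (simp add: b1_def pinv_0)
  define a where "a = \<epsilon> + b1 * (1/2)"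
  have a: "a > \<epsilon>" "a > 0" using b1 \<epsilon> by (auto simp: a_def)
  have "\<psi> integrable_on {1..}" using int by (simp add: \<psi>_def[abs_def])
  then obtain C where C: "\<And>s. s \<ge> a \<Longrightarrow> integral {a..s} \<psi> \<le> C"
    using integral_bounded_if_integrable_on[OF c\<psi> less_imp_le[OF \<psi>pos] _ a(2)] by blast
  \<comment> \<open>For v >= a the difference F(v) - F(\<epsilon>) is at least \<theta> F(v), which
    removes the initial energy.\<close>
  define \<theta> where "\<theta> = 1 - ?F \<epsilon> / ?F a"
  have \<theta>: "\<theta> > 0" using F(3)[of \<epsilon> a] F(4)[of a] \<epsilon> a by (simp add: \<theta>_def)
  define \<kappa> where "\<kappa> = p / (n * (p - 1)) * \<theta>"
  have \<kappa>: "\<kappa> > 0" using p n \<theta> by (simp add: \<kappa>_def)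
  define c where "c = \<kappa> powr (1/p)"
  have c: "c > 0" using \<kappa> by (simp add: c_def)
  define R where "R = 2 + \<bar>C\<bar> / c"
  have R: "R \<ge> 2" using c by (simp add: R_def)
  show ?thesis
  proof (rule that[of R])
    show "R > 0" using R by simp
    fix v w d assume cv: "continuous_on {0..R} v" and cw: "continuous_on {0..R} w"
      and v0: "v 0 = \<epsilon>" and w0: "w 0 = 0"
      and dv: "\<And>r. 0 < r \<Longrightarrow> r < R \<Longrightarrow> (v has_real_derivative pinv p (w r)) (at r)"
      and dw: "\<And>r. 0 < r \<Longrightarrow> r < R \<Longrightarrow> (w has_real_derivative d r) (at r)"
      and wge: "\<And>r. 0 \<le> r \<Longrightarrow> r \<le> R \<Longrightarrow> f \<epsilon> / n * r \<le> w r"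
      and fd: "\<And>r. 0 < r \<Longrightarrow> r < R \<Longrightarrow> f (v r) \<le> n * d r"
    have wpos: "w t > 0" if "0 < t" "t \<le> R" for t
      using wge[of t] that fe mult_pos_pos[of "f \<epsilon> / n" t] by linarith
    have ypos: "pinv p (w t) > 0" if "0 < t" "t \<le> R" for t
      using pinv_strict_mono[OF p _ wpos[OF that]] by (simp add: pinv_0)
    have vinc: "v s < v t" if "0 \<le> s" "s < t" "t \<le> R" for s t
    proof (rule DERIV_pos_imp_increasing_open[OF that(2)])
      show "\<exists>y. (v has_real_derivative y) (at x) \<and> 0 < y" if "s < x" "x < t" for x
        using dv[of x] ypos[of x] that \<open>0 \<le> s\<close> \<open>t \<le> R\<close> by (intro exI conjI) auto
      show "continuous_on {s..t} v" by (rule continuous_on_subset[OF cv]) (use that in auto)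
    qed
    have vge: "v t \<ge> \<epsilon>" if "0 \<le> t" "t \<le> R" for t
      using vinc[of 0 t] that v0 by (cases "t = 0") auto
    have v1: "v 1 \<ge> a"
    proof -
      have "v (1/2) - b1 * (1/2) \<le> v 1 - b1 * 1"
      proof (rule DERIV_nonneg_imp_increasing_open[where f = "\<lambda>x. v x - b1 * x"])
        show "continuous_on {1/2..1} (\<lambda>x. v x - b1 * x)"
          using R by (intro continuous_intros continuous_on_subset[OF cv]) auto
        fix x :: real assume x: "1/2 < x" "x < 1"
        have D: "((\<lambda>x. v x - b1 * x) has_real_derivative pinv p (w x) - b1) (at x)"
          by (rule derivative_eq_intros dv refl | use x R in simp)+
        have "f \<epsilon> / n * (1/2) \<le> w x"
          using x R fe by (intro order.trans[OF mult_left_mono wge[of x]]) auto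
        then have "pinv p (w x) \<ge> b1" unfolding b1_def by (intro pinv_mono[OF p])
        then show "\<exists>y. ((\<lambda>x. v x - b1 * x) has_real_derivative y) (at x) \<and> 0 \<le> y"
          using D by (intro exI[of _ "pinv p (w x) - b1"]) simp
      qed simp
      then show ?thesis using vge[of "1/2"] R by (simp add: a_def)
    qed
    define E where "E r = n * ((p - 1) / p) * w r powr (p / (p - 1)) - ?F (v r)" for r
    have E: "E 0 \<le> E t" if t: "0 \<le> t" "t \<le> R" for t
    proof (rule DERIV_nonneg_imp_increasing_open[OF t(1)])
      have "continuous_on {0..t} (\<lambda>r. w r powr (p / (p - 1)))"
      proof (rule continuous_on_powr')
        show "\<forall>x\<in>{0..t}. 0 \<le> w x \<and> (w x = 0 \<longrightarrow> 0 < p / (p - 1))"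
        proof
          fix x assume "x \<in> {0..t}"
          then have "0 \<le> w x" using wpos[of x] w0 t by (cases "x = 0") auto
          then show "0 \<le> w x \<and> (w x = 0 \<longrightarrow> 0 < p / (p - 1))" using p by simp
        qed
        show "continuous_on {0..t} w" by (rule continuous_on_subset[OF cw]) (use t in auto)
      qed simp
      moreover have "continuous_on {0..t} (\<lambda>r. ?F (v r))"
      proof (rule continuous_on_compose2[OF F(1)])
        show "continuous_on {0..t} v" by (rule continuous_on_subset[OF cv]) (use t in auto)
        show "v ` {0..t} \<subseteq> {0..}"
        proof
          fix x assume "x \<in> v ` {0..t}"
          then obtain r where "x = v r" "r \<in> {0..t}" by auto
          then show "x \<in> {0..}" using vge[of r] t \<epsilon> by simp
        qed
      qed
      ultimately show "continuous_on {0..t} E"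
        unfolding E_def by (intro continuous_on_diff continuous_on_mult continuous_on_const)
      fix x assume x: "0 < x" "x < t"
      then have xR: "x < R" using t by simp
      have "((\<lambda>r. w r powr (p / (p - 1))) has_real_derivative (p / (p - 1)) * w x powr (p / (p - 1) - 1) * d x) (at x)"
        by (intro DERIV_chain2[OF has_real_derivative_powr dw]) (use wpos[of x] x xR in auto)
      moreover have "p / (p - 1) - 1 = 1 / (p - 1)" using p by (simp add: field_simps)
      moreover have "w x powr (1 / (p - 1)) = pinv p (w x)" using wpos[of x] x xR by (simp add: pinv_eq)
      ultimately have d1: "((\<lambda>r. w r powr (p / (p - 1))) has_real_derivative (p / (p - 1)) * pinv p (w x) * d x) (at x)"
        by simp
      have d2: "((\<lambda>r. ?F (v r)) has_real_derivative f (v x) * pinv p (w x)) (at x)"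
        by (rule DERIV_chain2[OF F(2) dv]) (use vge[of x] \<epsilon> x xR in auto)
      have "(E has_real_derivative n * ((p - 1) / p) * ((p / (p - 1)) * pinv p (w x) * d x) - f (v x) * pinv p (w x)) (at x)"
        unfolding E_def by (intro DERIV_diff DERIV_cmult d1 d2)
      moreover have "n * ((p - 1) / p) * ((p / (p - 1)) * pinv p (w x) * d x) - f (v x) * pinv p (w x)
          = pinv p (w x) * (n * d x - f (v x))" using p by (simp add: field_simps)
      moreover have "pinv p (w x) * (n * d x - f (v x)) \<ge> 0"
        using fd[of x] x xR by (intro mult_nonneg_nonneg pinv_nonneg) auto
      ultimately show "\<exists>y. (E has_real_derivative y) (at x) \<and> 0 \<le> y" by auto
    qed
    have "c * (R - 1) \<le> C"
    proof (rule blow_up_time[OF c\<psi> \<psi>pos C a(2)])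
      show "continuous_on {1..R} v" by (rule continuous_on_subset[OF cv]) auto
      show vt: "v t > a" if "1 < t" "t < R" for t using vinc[of 1 t] v1 that by simp
      show "v t \<ge> a" if "1 \<le> t" "t \<le> R" for t using vinc[of 1 t] v1 that by (cases "t = 1") auto
      fix t assume t: "1 < t" "t < R"
      have va: "v t > a" using vt t by simp
      have Fv: "?F (v t) > 0" using F(4) va a by simp
      have Fa: "?F a > 0" using F(4) a by simp
      have "?F \<epsilon> / ?F a * ?F (v t) \<ge> ?F \<epsilon> / ?F a * ?F a"
        using F(3)[of a "v t"] va a F(4)[OF \<epsilon>] Fa by (intro mult_left_mono) auto
      then have th: "?F (v t) - ?F \<epsilon> \<ge> \<theta> * ?F (v t)" using Fa by (simp add: \<theta>_def algebra_simps)
      have "n * ((p - 1) / p) * w t powr (p / (p - 1)) \<ge> ?F (v t) - ?F \<epsilon>"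
        using E[of t] t by (simp add: E_def v0 w0)
      with th have "n * ((p - 1) / p) * w t powr (p / (p - 1)) \<ge> \<theta> * ?F (v t)" by linarith
      then have "\<kappa> * ?F (v t) \<le> w t powr (p / (p - 1))"
        using n p unfolding \<kappa>_def by (simp add: field_simps)
      then have "(\<kappa> * ?F (v t)) powr (1/p) \<le> (w t powr (p / (p - 1))) powr (1/p)"
        using p \<kappa> Fv by (intro powr_mono2) auto
      also have "\<dots> = pinv p (w t)" using wpos[of t] t p by (simp add: powr_powr pinv_eq)
      also have "(\<kappa> * ?F (v t)) powr (1/p) = c * ?F (v t) powr (1/p)"
        using \<kappa> Fv by (simp add: powr_mult c_def)
      finally have "c \<le> pinv p (w t) * \<psi> (v t)" using Fv by (simp add: \<psi>_def field_simps)
      then show "\<exists>d. (v has_real_derivative d) (at t) \<and> c \<le> d * \<psi> (v t)" using dv[of t] t by auto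
    qed (use R in auto)
    moreover have "c * (R - 1) = c + \<bar>C\<bar>" using c by (simp add: R_def field_simps)
    ultimately show False using c by linarith
  qed
qed

text \<open>R is fixed before K. If the slope at R were below K, monotonicity of w would keep it
  below K on all of [0, R], so v would stay below \<epsilon> + R K and the cap would be inactive.
  The capped solution would then solve the full equation on [0, R], which the blow-up estimates
  exclude. Beyond R the slope bound persists because w increases.\<close>

lemma radial_supersolution:
  fixes f g :: "real \<Rightarrow> real" and m :: nat
  assumes p: "1 < p"
    and f: "continuous_on {0..} f" "strict_mono_on {0..} f" "f 0 = 0"
    and g: "continuous_on {0..} g" "strict_mono_on {0..} g" "g 0 = 0"
    and \<epsilon>: "\<epsilon> > 0"
    and int: "(\<lambda>s. 1 / primF f s powr (1/p)) integrable_on {1..} \<or>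
      (\<lambda>s. s powr (p - 2) / g s) integrable_on {1..}"
  obtains R where "R > 0" "\<And>K. K \<ge> 0 \<Longrightarrow> \<exists>v w h.
    continuous_on {0..} v \<and> continuous_on {0..} w \<and> continuous_on {0..} h \<and>
    (\<forall>r\<ge>0. v r = \<epsilon> + integral {0..r} (\<lambda>s. pinv p (w s)) \<and>
      w r = integral {0..r} (\<lambda>s. s ^ m * h s) / r ^ m \<and> 0 \<le> w r \<and> \<epsilon> \<le> v r \<and>
      h r \<le> f (v r) + g (pinv p (w r))) \<and> (\<forall>r\<ge>R. K \<le> pinv p (w r))"
proof -
  note F = primF_facts[OF f]
  note G = primF_facts[OF g]
  define n where "n = real (Suc m)"
  have n: "n > 0" by (simp add: n_def)
  \<comment> \<open>\<open>Q\<close> asks for the hypotheses of both blow-up lemmas at once, so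
    either integral condition yields the same impossibility statement.\<close>
  define Q where "Q R \<longleftrightarrow> (\<forall>v w d. continuous_on {0..R} v \<longrightarrow> continuous_on {0..R} w \<longrightarrow> v 0 = \<epsilon> \<longrightarrow> w 0 = 0 \<longrightarrow>
    (\<forall>r. 0 < r \<longrightarrow> r < R \<longrightarrow> (v has_real_derivative pinv p (w r)) (at r)) \<longrightarrow>
    (\<forall>r. 0 < r \<longrightarrow> r < R \<longrightarrow> (w has_real_derivative d r) (at r)) \<longrightarrow>
    (\<forall>r. 0 \<le> r \<longrightarrow> r \<le> R \<longrightarrow> f \<epsilon> / n * r \<le> w r) \<longrightarrow>
    (\<forall>r. 0 < r \<longrightarrow> r < R \<longrightarrow> f (v r) \<le> n * d r) \<longrightarrow>
    (\<forall>r. 0 < r \<longrightarrow> r < R \<longrightarrow> g (pinv p (w r)) \<le> n * d r) \<longrightarrow> False)" for R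
  have "\<exists>R>0. Q R"
    using int
  proof
    assume i: "(\<lambda>s. 1 / primF f s powr (1/p)) integrable_on {1..}"
    show ?thesis
      by (rule radial_blow_up_value[OF p n f \<epsilon> i]) (unfold Q_def, blast)
  next
    assume i: "(\<lambda>s. s powr (p - 2) / g s) integrable_on {1..}"
    show ?thesis
      by (rule radial_blow_up_gradient[OF p n f g \<epsilon> i]) (unfold Q_def, blast)
  qed
  then obtain R where R: "R > 0" and Q: "Q R" by blast
  note bad = Q[unfolded Q_def, rule_format]
  show ?thesis
  proof (rule that[OF R])
    fix K :: real assume K: "K \<ge> 0"
    \<comment> \<open>The largest value of the source as long as the slope is at most K up to radius
      R; below it the cap has no effect.\<close>
    define N where "N = f (\<epsilon> + R * K) + g K"
    have N: "N \<ge> 0" unfolding N_def using F(7)[of "\<epsilon> + R * K"] G(7)[of K] K R \<epsilon> by simp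
    obtain v w h where vwh: "continuous_on {0..} v" "continuous_on {0..} w" "continuous_on {0..} h"
      "\<And>r. r \<ge> 0 \<Longrightarrow> v r = \<epsilon> + integral {0..r} (\<lambda>s. pinv p (w s))"
      "\<And>r. r \<ge> 0 \<Longrightarrow> w r = integral {0..r} (\<lambda>s. s ^ m * h s) / r ^ m"
      "\<And>r. r \<ge> 0 \<Longrightarrow> 0 \<le> w r" "\<And>r. r \<ge> 0 \<Longrightarrow> \<epsilon> \<le> v r"
      "\<And>r. r \<ge> 0 \<Longrightarrow> h r = min (f (v r) + g (pinv p (w r))) N"
      "\<And>r r'. 0 \<le> r \<Longrightarrow> r \<le> r' \<Longrightarrow> w r \<le> w r'"
      by (rule radial_truncated_solution[OF p f g \<epsilon> N, of m]; blast)
    have cy: "continuous_on {0..} (\<lambda>s. pinv p (w s))"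
      by (rule continuous_on_compose2[OF continuous_on_pinv[OF p] vwh(2)]) auto
    have iy: "(\<lambda>s. pinv p (w s)) integrable_on {0..r}" for r
      by (intro integrable_continuous_real continuous_on_subset[OF cy]) auto
    have vmono: "v r \<le> v r'" if "0 \<le> r" "r \<le> r'" for r r'
    proof -
      have "integral {0..r} (\<lambda>s. pinv p (w s)) \<le> integral {0..r'} (\<lambda>s. pinv p (w s))"
        by (intro integral_subset_le iy) (use that pinv_nonneg in auto)
      then show ?thesis using vwh(4) that by simp
    qed
    have hmono: "h r \<le> h r'" if "0 \<le> r" "r \<le> r'" for r r'
    proof -
      have "f (v r) \<le> f (v r')" using vmono[OF that] vwh(7)[OF that(1)] \<epsilon> by (intro F(6)) auto
      moreover have "g (pinv p (w r)) \<le> g (pinv p (w r'))"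
        using vwh(9)[OF that] by (intro G(6) pinv_nonneg pinv_mono[OF p])
      ultimately show ?thesis using vwh(8)[of r] vwh(8)[of r'] that by auto
    qed
    have "K \<le> pinv p (w R)"
    proof (rule ccontr)
      assume "\<not> K \<le> pinv p (w R)"
      then have yK: "pinv p (w r) \<le> K" if "0 \<le> r" "r \<le> R" for r
        using pinv_mono[OF p vwh(9)[OF that]] by simp
      have vK: "v r \<le> \<epsilon> + R * K" if "0 \<le> r" "r \<le> R" for r
      proof -
        have "integral {0..r} (\<lambda>s. pinv p (w s)) \<le> integral {0..r} (\<lambda>s. K)"
          by (intro integral_le iy) (use yK that in auto)
        also have "\<dots> \<le> R * K" using that K by (simp add: mult_right_mono)
        finally show ?thesis using vwh(4)[OF that(1)] by simp
      qed
      have hN: "h r = f (v r) + g (pinv p (w r))" if "0 \<le> r" "r \<le> R" for r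
      proof -
        have "f (v r) \<le> f (\<epsilon> + R * K)" using vK[OF that] vwh(7)[OF that(1)] \<epsilon> by (intro F(6)) auto
        moreover have "g (pinv p (w r)) \<le> g K" using yK[OF that] by (intro G(6) pinv_nonneg)
        ultimately show ?thesis using vwh(8)[OF that(1)] by (simp add: N_def)
      qed
      define d where "d r = h r - real m * (w r / r)" for r
      have dw: "(w has_real_derivative d r) (at r)" if "0 < r" for r
        unfolding d_def by (rule radial_mean_has_derivative[OF vwh(3,5) that])
      have nd: "h r \<le> n * d r" if "0 < r" for r
        unfolding d_def n_def
        by (rule radial_mean_has_derivative_ge[OF vwh(3,5) hmono that])
      have hf: "f (v r) \<le> h r" "g (pinv p (w r)) \<le> h r" if "0 \<le> r" "r \<le> R" for r
        using hN[OF that] F(7)[of "v r"] G(7)[of "pinv p (w r)"] vwh(7)[of r] \<epsilon> that pinv_nonneg[of p] by auto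
      show False
      proof (rule bad[of v w d])
        show "continuous_on {0..R} v" by (rule continuous_on_subset[OF vwh(1)]) auto
        show "continuous_on {0..R} w" by (rule continuous_on_subset[OF vwh(2)]) auto
        show "v 0 = \<epsilon>" "w 0 = 0" using vwh(4)[of 0] vwh(5)[of 0] by auto
        show "(v has_real_derivative pinv p (w r)) (at r)" if "0 < r" for r
          by (rule primitive_has_real_derivative_at[OF cy that vwh(4)])
        show "(w has_real_derivative d r) (at r)" if "0 < r" for r by (rule dw[OF that])
        show "f (v r) \<le> n * d r" if "0 < r" "r < R" for r using hf(1)[of r] nd[of r] that by simp
        show "g (pinv p (w r)) \<le> n * d r" if "0 < r" "r < R" for r using hf(2)[of r] nd[of r] that by simp
        show "f \<epsilon> / n * r \<le> w r" if "0 \<le> r" "r \<le> R" for r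
        proof -
          have "w 0 - f \<epsilon> / n * 0 \<le> w r - f \<epsilon> / n * r"
          proof (rule DERIV_nonneg_imp_increasing_open[OF that(1), where f = "\<lambda>r. w r - f \<epsilon> / n * r"])
            show "continuous_on {0..r} (\<lambda>r. w r - f \<epsilon> / n * r)"
              by (intro continuous_on_diff continuous_on_mult continuous_on_const continuous_on_id
                  continuous_on_subset[OF vwh(2)]) auto
            fix x assume x: "0 < x" "x < r"
            have "((\<lambda>r. w r - f \<epsilon> / n * r) has_real_derivative d x - f \<epsilon> / n * 1) (at x)"
              by (intro DERIV_diff DERIV_cmult DERIV_ident dw x)
            moreover have "f \<epsilon> \<le> n * d x"
              using hf(1)[of x] nd[of x] F(6)[of \<epsilon> "v x"] vwh(7)[of x] \<epsilon> x that by simp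
            then have "f \<epsilon> / n \<le> d x" using n by (simp add: field_simps)
            ultimately show "\<exists>y. ((\<lambda>r. w r - f \<epsilon> / n * r) has_real_derivative y) (at x) \<and> 0 \<le> y"
              by (intro exI[of _ "d x - f \<epsilon> / n * 1"]) auto
          qed
          then show ?thesis using vwh(5)[of 0] by simp
        qed
      qed
    qed
    then have "K \<le> pinv p (w r)" if "r \<ge> R" for r
      using pinv_mono[OF p vwh(9)[of R r]] that R by simp
    then show "\<exists>v w h.
      continuous_on {0..} v \<and> continuous_on {0..} w \<and> continuous_on {0..} h \<and>
      (\<forall>r\<ge>0. v r = \<epsilon> + integral {0..r} (\<lambda>s. pinv p (w s)) \<and>
        w r = integral {0..r} (\<lambda>s. s ^ m * h s) / r ^ m \<and> 0 \<le> w r \<and> \<epsilon> \<le> v r \<and>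
        h r \<le> f (v r) + g (pinv p (w r))) \<and> (\<forall>r\<ge>R. K \<le> pinv p (w r))"
      using vwh(1-7) vwh(8) by (intro exI[of _ v] exI[of _ w] exI[of _ h] conjI allI impI) simp_all
  qed
qed

section \<open>Compactly supported functions, mollification and weak inequalities\<close>

text \<open>The squared positive part used in the comparison is only C^1, so this class stands
  between it and the smooth \<open>test_fun\<close>. The gradient is carried as an explicit argument
  and shares the support bound.\<close>

definition C1c :: "(real^'n::finite \<Rightarrow> real) \<Rightarrow> (real^'n \<Rightarrow> real^'n) \<Rightarrow> bool" where
  "C1c \<phi> G \<longleftrightarrow> (\<forall>x. (\<phi> has_derivative (\<lambda>h. G x \<bullet> h)) (at x)) \<and> continuous_on UNIV G \<and>
     (\<exists>R. \<forall>x. norm x > R \<longrightarrow> \<phi> x = 0 \<and> G x = 0)"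

lemma has_derivative_imp_grad:
  fixes \<phi> :: "real^'n::finite \<Rightarrow> real"
  assumes "(\<phi> has_derivative (\<lambda>h. G \<bullet> h)) (at x)"
  shows "partial_deriv i \<phi> x = G $ i" and "grad \<phi> x = G"
proof -
  have "frechet_derivative \<phi> (at x) = (\<lambda>h. G \<bullet> h)"
    using frechet_derivative_at[OF assms] by simp
  then show pd: "partial_deriv i \<phi> x = G $ i" for i
    by (simp add: partial_deriv_def inner_axis)
  show "grad \<phi> x = G" by (simp add: grad_def pd vec_eq_iff)
qed

lemma zero_grad_outside:
  fixes \<phi> :: "real^'n::finite \<Rightarrow> real"
  assumes "(\<phi> has_derivative (\<lambda>h. G \<bullet> h)) (at x)" "\<And>x. norm x > R \<Longrightarrow> \<phi> x = 0" "norm x > R"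
  shows "G = 0"
proof -
  have "((\<lambda>_. 0) has_derivative (\<lambda>h. G \<bullet> h)) (at x)"
    by (rule has_derivative_transform_within_open[OF assms(1), where s = "- cball 0 R"])
      (use assms(2,3) in \<open>auto simp: dist_norm\<close>)
  then have "(\<lambda>h. G \<bullet> h) = (\<lambda>_. 0)"
    by (rule has_derivative_unique) simp
  from fun_cong[OF this, of G] show ?thesis by simp
qed

lemma C1cI:
  fixes \<phi> :: "real^'n::finite \<Rightarrow> real"
  assumes "\<And>x. (\<phi> has_derivative (\<lambda>h. G x \<bullet> h)) (at x)" "continuous_on UNIV G"
    "\<And>x. norm x > R \<Longrightarrow> \<phi> x = 0"
  shows "C1c \<phi> G"
proof -
  have "\<phi> x = 0 \<and> G x = 0" if "norm x > R" for x
    using assms(3)[OF that] zero_grad_outside[OF assms(1) assms(3) that] by simp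
  then show ?thesis unfolding C1c_def using assms(1,2) by auto
qed

lemma continuous_integrable_lborel:
  fixes f :: "'a::euclidean_space \<Rightarrow> 'b::euclidean_space"
  assumes "continuous_on UNIV f" "\<And>x. norm x > R \<Longrightarrow> f x = 0"
  shows "integrable lborel f"
proof -
  have "integrable lborel (\<lambda>x. indicator (cball 0 R) x *\<^sub>R f x)"
    by (intro borel_integrable_compact continuous_on_subset[OF assms(1)]) auto
  moreover have "(\<lambda>x. indicator (cball 0 R) x *\<^sub>R f x) = f"
    using assms(2) by (auto simp: indicator_def fun_eq_iff not_le)
  ultimately show ?thesis by simp
qed

lemma continuous_compact_support_bounded:
  fixes f :: "'a::euclidean_space \<Rightarrow> 'b::euclidean_space"
  assumes "continuous_on UNIV f" "\<And>x. norm x > R \<Longrightarrow> f x = 0"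
  shows "\<exists>B\<ge>0. \<forall>x. norm (f x) \<le> B"
proof -
  have "bounded (f ` cball 0 R)"
    by (intro compact_imp_bounded compact_continuous_image continuous_on_subset[OF assms(1)]) auto
  then obtain B where B: "\<forall>y\<in>f ` cball 0 R. norm y \<le> B" unfolding bounded_iff by blast
  have "norm (f x) \<le> max 0 B" for x
  proof (cases "norm x \<le> R")
    case True
    then have "norm (f x) \<le> B" using B by simp
    then show ?thesis by simp
  qed (use assms(2) in auto)
  then show ?thesis by (intro exI[of _ "max 0 B"]) auto
qed

lemma continuous_compact_support_uniformly_continuous:
  fixes f :: "'a::euclidean_space \<Rightarrow> 'b::euclidean_space"
  assumes "continuous_on UNIV f" "\<And>x. norm x > R \<Longrightarrow> f x = 0"
  shows "uniformly_continuous_on UNIV f"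
proof -
  have u: "uniformly_continuous_on (cball 0 (R + 1)) f"
    by (intro compact_uniformly_continuous continuous_on_subset[OF assms(1)]) auto
  show ?thesis
    unfolding uniformly_continuous_on_def
  proof (intro allI impI)
    fix e :: real assume "e > 0"
    then obtain d where d: "d > 0" "\<And>x x'. x \<in> cball 0 (R + 1) \<Longrightarrow> x' \<in> cball 0 (R + 1) \<Longrightarrow> dist x' x < d \<Longrightarrow> dist (f x') (f x) < e"
      using u unfolding uniformly_continuous_on_def by metis
    show "\<exists>d>0. \<forall>x\<in>UNIV. \<forall>x'\<in>UNIV. dist x' x < d \<longrightarrow> dist (f x') (f x) < e"
    proof (intro exI[of _ "min d 1"] conjI ballI impI)
      fix x x' :: 'a assume dx: "dist x' x < min d 1"
      show "dist (f x') (f x) < e"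
      proof (cases "norm x \<le> R + 1 \<and> norm x' \<le> R + 1")
        case True
        then show ?thesis using d(2)[of x x'] dx by simp
      next
        case False
        have "norm x \<le> norm x' + dist x' x" "norm x' \<le> norm x + dist x' x"
          using norm_triangle_ineq2[of x x'] norm_triangle_ineq2[of x' x] by (auto simp: dist_norm norm_minus_commute)
        then have "norm x > R" "norm x' > R" using False dx by auto
        then show ?thesis using assms(2) \<open>e > 0\<close> by simp
      qed
    qed (use d in auto)
  qed
qed

text \<open>The gradient is uniformly continuous, so the Taylor remainder is uniform in the base
  point. Derivatives can then be taken through integrals by a direct estimate.\<close>

lemma C1c_uniform_differentiability:
  assumes "C1c \<phi> G" "e > 0"
  shows "\<exists>d>0. \<forall>x h. norm h < d \<longrightarrow> \<bar>\<phi> (x + h) - \<phi> x - G x \<bullet> h\<bar> \<le> e * norm h"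
proof -
  obtain R where c: "continuous_on UNIV G" and R: "\<And>x. norm x > R \<Longrightarrow> G x = 0"
    and D: "\<And>x. (\<phi> has_derivative (\<lambda>h. G x \<bullet> h)) (at x)"
    using assms(1) unfolding C1c_def by blast
  have "uniformly_continuous_on UNIV G"
    by (rule continuous_compact_support_uniformly_continuous[OF c R])
  from this[unfolded uniformly_continuous_on_def, rule_format, OF \<open>e > 0\<close>]
  obtain d where d: "d > 0" "\<And>x x'. dist x' x < d \<Longrightarrow> dist (G x') (G x) < e" by auto
  have "\<bar>\<phi> (x + h) - \<phi> x - G x \<bullet> h\<bar> \<le> e * norm h" if h: "norm h < d" for x h
  proof -
    have "norm (\<phi> (x + h) - \<phi> x - G x \<bullet> ((x + h) - x)) \<le> norm ((x + h) - x) * e"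
    proof (rule differentiable_bound_linearization[where S = "ball x d" and f' = "\<lambda>y h. G y \<bullet> h" and ?x0.0 = x])
      show "x + t *\<^sub>R (x + h - x) \<in> ball x d" if "t \<in> {0..1}" for t
      proof -
        have "\<bar>t\<bar> * norm h \<le> 1 * norm h" using that by (intro mult_right_mono) auto
        then show ?thesis using h by (simp add: dist_norm)
      qed
      show "(\<phi> has_derivative (\<lambda>h. G y \<bullet> h)) (at y within ball x d)" for y
        by (rule has_derivative_at_withinI[OF D])
      show "onorm ((\<lambda>h. G y \<bullet> h) - (\<lambda>h. G x \<bullet> h)) \<le> e" if "y \<in> ball x d" for y
      proof (rule onorm_bound)
        show "norm (((\<lambda>h. G y \<bullet> h) - (\<lambda>h. G x \<bullet> h)) h) \<le> e * norm h" for h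
        proof -
          have "norm ((G y - G x) \<bullet> h) \<le> norm (G y - G x) * norm h"
            using Cauchy_Schwarz_ineq2 by simp
          also have "\<dots> \<le> e * norm h"
            using d(2)[of y x] that by (intro mult_right_mono) (auto simp: dist_norm norm_minus_commute)
          finally show ?thesis by (simp add: inner_diff_left)
        qed
      qed (use \<open>e > 0\<close> in simp)
    qed (use d in auto)
    then show ?thesis by (simp add: mult.commute)
  qed
  then show ?thesis using d(1) by blast
qed

text \<open>The integral of \<open>\<phi>(x + t h)\<close> does not depend on \<open>t\<close>; differentiate at \<open>t = 0\<close>.\<close>

lemma C1c_integral_grad:
  assumes "C1c \<phi> G"
  shows "(LINT x|lborel. G x \<bullet> h) = 0"
proof -
  obtain R where c: "continuous_on UNIV G" and R: "\<And>x. norm x > R \<Longrightarrow> \<phi> x = 0" "\<And>x. norm x > R \<Longrightarrow> G x = 0"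
    and D: "\<And>x. (\<phi> has_derivative (\<lambda>h. G x \<bullet> h)) (at x)"
    using assms(1) unfolding C1c_def by blast
  have c\<phi>: "continuous_on UNIV \<phi>"
    using D by (meson continuous_at_imp_continuous_on has_derivative_continuous)
  have i\<phi>: "integrable lborel \<phi>" by (rule continuous_integrable_lborel[OF c\<phi> R(1)])
  have cGh: "continuous_on UNIV (\<lambda>x. G x \<bullet> h)" by (intro continuous_intros c)
  have iGh: "integrable lborel (\<lambda>x. G x \<bullet> h)" by (rule continuous_integrable_lborel[OF cGh, of R]) (use R in auto)
  have trans: "integrable lborel (\<lambda>x. \<phi> (x + t)) \<and> (LINT x|lborel. \<phi> (x + t)) = (LINT x|lborel. \<phi> x)" for t
  proof -
    have "distr lborel borel (\<lambda>x. t + x) = (lborel :: (real^'a) measure)" using lborel_distr_plus[of t] by simp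
    then have eq: "lborel = distr lborel borel (\<lambda>x. x + t)" by (simp add: add.commute)
    have m: "\<phi> \<in> borel_measurable borel" using c\<phi> by (rule borel_measurable_continuous_onI)
    have "integrable (distr lborel borel (\<lambda>x. x + t)) \<phi>" using i\<phi> eq by simp
    then have "integrable lborel (\<lambda>x. \<phi> (x + t))"
      by (subst (asm) integrable_distr_eq) (use m in auto)
    moreover have "(LINT x|lborel. \<phi> x) = (LINT x|distr lborel borel (\<lambda>x. x + t). \<phi> x)" using eq by simp
    then have "(LINT x|lborel. \<phi> x) = (LINT x|lborel. \<phi> (x + t))"
      by (subst (asm) integral_distr) (use m in auto)
    ultimately show ?thesis by simp
  qed
  \<comment> \<open>Contains the supports of all translates by t h with 0 <= t <= 1, so every
    difference quotient vanishes outside one set of finite measure.\<close>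
  define S where "S = cball (0::real^'a) (\<bar>R\<bar> + norm h)"
  have S: "emeasure lborel S < \<infinity>" "S \<in> sets lborel" unfolding S_def
    using emeasure_bounded_finite[OF bounded_cball] by (auto simp: less_top)
  have est: "\<bar>LINT x|lborel. G x \<bullet> h\<bar> \<le> e" if "e > 0" for e
  proof -
    define X where "X = (norm h + 1) * (measure lborel S + 1)"
    define e' where "e' = e / X"
    have den: "X > 0"
      unfolding X_def by (intro mult_pos_pos) (auto simp: add_nonneg_pos)
    have e': "e' > 0" unfolding e'_def using that den by simp
    obtain d where d: "d > 0" "\<And>x h. norm h < d \<Longrightarrow> \<bar>\<phi> (x + h) - \<phi> x - G x \<bullet> h\<bar> \<le> e' * norm h"
      using C1c_uniform_differentiability[OF assms e'] by blast
    define t where "t = min 1 (d / (2 * (norm h + 1)))"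
    have t: "t > 0" "t \<le> 1" using d(1) by (auto simp: t_def add_nonneg_pos)
    have "norm (t *\<^sub>R h) < d"
    proof -
      have "t * norm h \<le> d / (2 * (norm h + 1)) * norm h" by (intro mult_right_mono) (auto simp: t_def)
      also have "\<dots> \<le> d / 2"
      proof -
        have "norm h / (norm h + 1) \<le> 1" by (simp add: divide_le_eq_1 add_nonneg_pos)
        then have "d / 2 * (norm h / (norm h + 1)) \<le> d / 2 * 1" using d(1) by (intro mult_left_mono) auto
        then show ?thesis by simp
      qed
      also have "\<dots> < d" using d(1) by simp
      finally show ?thesis using t by simp
    qed
    note dd = d(2)[OF this]
    define q where "q x = (\<phi> (x + t *\<^sub>R h) - \<phi> x) / t - G x \<bullet> h" for x
    have iq: "integrable lborel q" unfolding q_def using trans i\<phi> iGh by auto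
    have "(LINT x|lborel. q x) = ((LINT x|lborel. \<phi> (x + t *\<^sub>R h)) - (LINT x|lborel. \<phi> x)) / t - (LINT x|lborel. G x \<bullet> h)"
      unfolding q_def using trans i\<phi> iGh by simp
    then have "(LINT x|lborel. q x) = - (LINT x|lborel. G x \<bullet> h)" using trans by simp
    moreover have "norm (q x) \<le> e' * norm h * indicator S x" for x
    proof (cases "x \<in> S")
      case True
      have "t * \<bar>q x\<bar> = \<bar>t * q x\<bar>" using t by (simp add: abs_mult)
      also have "t * q x = \<phi> (x + t *\<^sub>R h) - \<phi> x - G x \<bullet> (t *\<^sub>R h)" using t unfolding q_def by (subst right_diff_distrib) simp
      also have "\<bar>\<dots>\<bar> \<le> e' * norm (t *\<^sub>R h)" by (rule dd)
      also have "\<dots> = t * (e' * norm h)" using t by simp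
      finally show ?thesis using t True by simp
    next
      case False
      then have x: "norm x > \<bar>R\<bar> + norm h" by (simp add: S_def)
      have "norm (t *\<^sub>R h) \<le> norm h" using t by (simp add: mult_left_le_one_le)
      moreover have "norm x - norm (t *\<^sub>R h) \<le> norm (x + t *\<^sub>R h)" by (rule norm_diff_ineq)
      ultimately have "norm (x + t *\<^sub>R h) > R" "norm x > R" using x norm_ge_zero[of h] abs_ge_self[of R] by linarith+
      then show ?thesis using R False by (simp add: q_def)
    qed
    then have "norm (LINT x|lborel. q x) \<le> (LINT x|lborel. e' * norm h * indicator S x)"
      using S by (intro Bochner_Integration.integral_norm_bound_integral iq) auto
    ultimately have "\<bar>LINT x|lborel. G x \<bullet> h\<bar> \<le> e' * norm h * measure lborel S" using S by simp
    also have "\<dots> \<le> e' * (norm h + 1) * (measure lborel S + 1)"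
      using e' by (intro mult_mono) auto
    also have "\<dots> = e' * X" by (simp only: mult.assoc X_def)
    also have "\<dots> = e" using den by (simp add: e'_def)
    finally show ?thesis .
  qed
  have "\<bar>LINT x|lborel. G x \<bullet> h\<bar> \<le> 0" by (rule field_le_epsilon) (simp add: est)
  then show ?thesis by simp
qed

lemma C1cE:
  assumes "C1c \<phi> G"
  obtains R where "\<And>x. (\<phi> has_derivative (\<lambda>h. G x \<bullet> h)) (at x)" "continuous_on UNIV G" "continuous_on UNIV \<phi>"
    "R \<ge> 0" "\<And>x. norm x > R \<Longrightarrow> \<phi> x = 0" "\<And>x. norm x > R \<Longrightarrow> G x = 0"
proof -
  obtain R where R: "continuous_on UNIV G" "\<And>x. norm x > R \<Longrightarrow> \<phi> x = 0" "\<And>x. norm x > R \<Longrightarrow> G x = 0"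
    and D: "\<And>x. (\<phi> has_derivative (\<lambda>h. G x \<bullet> h)) (at x)"
    using assms(1) unfolding C1c_def by blast
  have "continuous_on UNIV \<phi>"
    using D by (meson continuous_at_imp_continuous_on has_derivative_continuous)
  then show ?thesis using that[of "max 0 R"] R D by simp
qed

lemma C1c_mult:
  assumes Du: "\<And>x. (u has_derivative (\<lambda>h. Gu x \<bullet> h)) (at x)" and cGu: "continuous_on UNIV Gu"
    and "C1c \<phi> G"
  shows "C1c (\<lambda>x. u x * \<phi> x) (\<lambda>x. u x *\<^sub>R G x + \<phi> x *\<^sub>R Gu x)"
proof -
  obtain R where R: "\<And>x. (\<phi> has_derivative (\<lambda>h. G x \<bullet> h)) (at x)" "continuous_on UNIV G" "continuous_on UNIV \<phi>"
    "R \<ge> 0" "\<And>x. norm x > R \<Longrightarrow> \<phi> x = 0" "\<And>x. norm x > R \<Longrightarrow> G x = 0"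
    by (rule C1cE[OF assms(3)]) (rule that; assumption)
  have cu: "continuous_on UNIV u"
    using Du by (meson continuous_at_imp_continuous_on has_derivative_continuous)
  show ?thesis
  proof (rule C1cI[of _ _ R])
    show "((\<lambda>x. u x * \<phi> x) has_derivative (\<lambda>h. (u x *\<^sub>R G x + \<phi> x *\<^sub>R Gu x) \<bullet> h)) (at x)" for x
      by (rule has_derivative_eq_rhs[OF has_derivative_mult[OF Du R(1)]])
        (auto simp: fun_eq_iff inner_add_left)
    show "continuous_on UNIV (\<lambda>x. u x *\<^sub>R G x + \<phi> x *\<^sub>R Gu x)"
      by (intro continuous_intros cu R cGu)
  qed (use R in auto)
qed

text \<open>Nothing is required of u at infinity: the product u \<phi> is compactly supported, and
  the integral of its gradient is zero.\<close>

lemma integration_by_parts_C1c: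
  fixes u :: "real^'n::finite \<Rightarrow> real"
  assumes Du: "\<And>x. (u has_derivative (\<lambda>h. Gu x \<bullet> h)) (at x)" and cGu: "continuous_on UNIV Gu"
    and "C1c \<phi> G"
  shows "(LINT x|lborel. u x * (G x \<bullet> h)) = - (LINT x|lborel. \<phi> x * (Gu x \<bullet> h))"
    and "integrable lborel (\<lambda>x. u x * (G x \<bullet> h))" "integrable lborel (\<lambda>x. \<phi> x * (Gu x \<bullet> h))"
proof -
  obtain R where R: "\<And>x. (\<phi> has_derivative (\<lambda>h. G x \<bullet> h)) (at x)" "continuous_on UNIV G" "continuous_on UNIV \<phi>"
    "R \<ge> 0" "\<And>x. norm x > R \<Longrightarrow> \<phi> x = 0" "\<And>x. norm x > R \<Longrightarrow> G x = 0"
    by (rule C1cE[OF assms(3)]) (rule that; assumption)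
  have cu: "continuous_on UNIV u"
    using Du by (meson continuous_at_imp_continuous_on has_derivative_continuous)
  have c1: "continuous_on UNIV (\<lambda>x. u x * (G x \<bullet> h))" by (intro continuous_intros cu R)
  have c2: "continuous_on UNIV (\<lambda>x. \<phi> x * (Gu x \<bullet> h))" by (intro continuous_intros cGu R)
  show i1: "integrable lborel (\<lambda>x. u x * (G x \<bullet> h))"
    by (rule continuous_integrable_lborel[OF c1, of R]) (use R in auto)
  show i2: "integrable lborel (\<lambda>x. \<phi> x * (Gu x \<bullet> h))"
    by (rule continuous_integrable_lborel[OF c2, of R]) (use R in auto)
  have "(LINT x|lborel. (u x *\<^sub>R G x + \<phi> x *\<^sub>R Gu x) \<bullet> h) = 0"
    by (rule C1c_integral_grad[OF C1c_mult[OF assms]])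
  then have "(LINT x|lborel. u x * (G x \<bullet> h) + \<phi> x * (Gu x \<bullet> h)) = 0" by (simp add: inner_add_left)
  then show "(LINT x|lborel. u x * (G x \<bullet> h)) = - (LINT x|lborel. \<phi> x * (Gu x \<bullet> h))"
    using i1 i2 by simp
qed

section \<open>Convolution of locally integrable functions with smooth kernels\<close>

definition loc_int :: "('a::euclidean_space \<Rightarrow> real) \<Rightarrow> bool" where
  "loc_int u \<longleftrightarrow> u \<in> borel_measurable lborel \<and> (\<forall>R. integrable lborel (\<lambda>x. indicator (cball 0 R) x * u x))"

lemma loc_int_integrable_mult:
  fixes u k :: "'a::euclidean_space \<Rightarrow> real"
  assumes u: "loc_int u" and k: "k \<in> borel_measurable lborel" "\<And>x. \<bar>k x\<bar> \<le> B" "\<And>x. norm x > R \<Longrightarrow> k x = 0"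
  shows "integrable lborel (\<lambda>x. u x * k x)"
    and "\<bar>LINT x|lborel. u x * k x\<bar> \<le> B * (LINT x|lborel. \<bar>indicator (cball 0 R) x * u x\<bar>)"
proof -
  have um: "u \<in> borel_measurable lborel" and ui: "integrable lborel (\<lambda>x. indicator (cball 0 R) x * u x)"
    using u by (auto simp: loc_int_def)
  have i: "integrable lborel (\<lambda>x. B * \<bar>indicator (cball 0 R) x * u x\<bar>)"
    using ui by auto
  have B: "\<bar>u x * k x\<bar> \<le> B * \<bar>indicator (cball 0 R) x * u x\<bar>" for x
  proof (cases "norm x > R")
    case False
    have "\<bar>u x\<bar> * \<bar>k x\<bar> \<le> \<bar>u x\<bar> * B" using k(2)[of x] by (intro mult_left_mono) auto
    then show ?thesis using False by (simp add: abs_mult mult.commute)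
  qed (use k(3) in simp)
  show I: "integrable lborel (\<lambda>x. u x * k x)"
  proof (rule Bochner_Integration.integrable_bound[OF i])
    show "(\<lambda>x. u x * k x) \<in> borel_measurable lborel" using um k(1) by simp
    show "AE x in lborel. norm (u x * k x) \<le> norm (B * \<bar>indicator (cball 0 R) x * u x\<bar>)"
    proof (rule AE_I2)
      fix x show "norm (u x * k x) \<le> norm (B * \<bar>indicator (cball 0 R) x * u x\<bar>)"
        using B[of x] by simp
    qed
  qed
  have "\<bar>LINT x|lborel. u x * k x\<bar> \<le> (LINT x|lborel. B * \<bar>indicator (cball 0 R) x * u x\<bar>)"
    by (rule integral_abs_bound_integral[OF I i B])
  then show "\<bar>LINT x|lborel. u x * k x\<bar> \<le> B * (LINT x|lborel. \<bar>indicator (cball 0 R) x * u x\<bar>)"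
    by simp
qed

lemma continuous_imp_loc_int:
  fixes u :: "'a::euclidean_space \<Rightarrow> real"
  assumes "continuous_on UNIV u"
  shows "loc_int u"
  unfolding loc_int_def
proof (intro conjI allI)
  show "u \<in> borel_measurable lborel" using assms by (simp add: borel_measurable_continuous_onI)
  show "integrable lborel (\<lambda>x. indicator (cball 0 R) x * u x)" for R
    using borel_integrable_compact[of "cball 0 R" u] continuous_on_subset[OF assms, of "cball 0 R"] by simp
qed

definition conv :: "('a::euclidean_space \<Rightarrow> real) \<Rightarrow> ('a \<Rightarrow> real) \<Rightarrow> 'a \<Rightarrow> real" where
  "conv u \<rho> x = (LINT y|lborel. u y * \<rho> (x - y))"

lemma conv_integrable:
  fixes u \<rho> :: "'a::euclidean_space \<Rightarrow> real"
  assumes u: "loc_int u" and \<rho>: "continuous_on UNIV \<rho>" "\<And>x. norm x > R \<Longrightarrow> \<rho> x = 0"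
  shows "integrable lborel (\<lambda>y. u y * \<rho> (x - y))"
proof -
  obtain B where B: "\<And>x. norm (\<rho> x) \<le> B" using continuous_compact_support_bounded[OF \<rho>] by blast
  have "continuous_on UNIV (\<lambda>y. \<rho> (x - y))"
    by (rule continuous_on_compose2[OF \<rho>(1)]) (auto intro!: continuous_intros)
  then have "(\<lambda>y. \<rho> (x - y)) \<in> borel_measurable lborel" by (simp add: borel_measurable_continuous_onI)
  then show ?thesis
  proof (rule loc_int_integrable_mult(1)[OF u, where R = "R + norm x"])
    show "\<bar>\<rho> (x - y)\<bar> \<le> B" for y using B by simp
    show "\<rho> (x - y) = 0" if "norm y > R + norm x" for y
      using that norm_triangle_ineq2[of y x] by (intro \<rho>(2)) (simp add: norm_minus_commute)
  qed
qed

lemma conv_continuous: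
  fixes u \<rho> :: "'a::euclidean_space \<Rightarrow> real"
  assumes u: "loc_int u" and \<rho>: "continuous_on UNIV \<rho>" "\<And>x. norm x > R \<Longrightarrow> \<rho> x = 0"
  shows "continuous_on UNIV (conv u \<rho>)"
  unfolding continuous_on_iff
proof (intro ballI allI impI)
  fix x :: 'a and e :: real assume e: "e > 0"
  define I where "I = (LINT y|lborel. \<bar>indicator (cball 0 (R + norm x + 1)) y * u y\<bar>)"
  have I: "I \<ge> 0" unfolding I_def by (intro integral_nonneg_AE) auto
  define J where "J = I + 1"
  have J: "J > 0" "I \<le> J" using I by (auto simp: J_def)
  define e' where "e' = e / 2 / J"
  have e': "e' > 0" using e J by (simp add: e'_def)
  have "uniformly_continuous_on UNIV \<rho>"
    by (rule continuous_compact_support_uniformly_continuous[OF \<rho>])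
  from this[unfolded uniformly_continuous_on_def, rule_format, OF e']
  obtain d where d: "d > 0" "\<And>x x'. dist x' x < d \<Longrightarrow> dist (\<rho> x') (\<rho> x) < e'" by auto
  show "\<exists>d>0. \<forall>x'\<in>UNIV. dist x' x < d \<longrightarrow> dist (conv u \<rho> x') (conv u \<rho> x) < e"
  proof (intro exI[of _ "min d 1"] conjI ballI impI)
    fix x' assume x': "dist x' x < min d 1"
    have "conv u \<rho> x' - conv u \<rho> x = (LINT y|lborel. u y * (\<rho> (x' - y) - \<rho> (x - y)))"
      unfolding conv_def using conv_integrable[OF u \<rho>] by (simp add: right_diff_distrib)
    also have "\<bar>\<dots>\<bar> \<le> e' * I"
      unfolding I_def
    proof (rule loc_int_integrable_mult(2)[OF u])
      have "continuous_on UNIV (\<lambda>y. \<rho> (x' - y) - \<rho> (x - y))"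
        by (intro continuous_intros continuous_on_compose2[OF \<rho>(1)]) auto
      then show "(\<lambda>y. \<rho> (x' - y) - \<rho> (x - y)) \<in> borel_measurable lborel"
        by (simp add: borel_measurable_continuous_onI)
      show "\<bar>\<rho> (x' - y) - \<rho> (x - y)\<bar> \<le> e'" for y
        using d(2)[of "x' - y" "x - y"] x' by (simp add: dist_norm)
      show "\<rho> (x' - y) - \<rho> (x - y) = 0" if "norm y > R + norm x + 1" for y
      proof -
        have "norm (x' - y) > R" "norm (x - y) > R"
          using that norm_triangle_ineq2[of y x] norm_triangle_ineq2[of y x'] norm_triangle_ineq2[of x' x] x'
          by (simp_all add: norm_minus_commute dist_norm)
        then show ?thesis using \<rho>(2) by simp
      qed
    qed
    also have "\<dots> \<le> e' * J" using e' J by simp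
    also have "\<dots> = e / 2" using J by (simp add: e'_def)
    also have "\<dots> < e" using e by simp
    finally show "dist (conv u \<rho> x') (conv u \<rho> x) < e" by (simp add: dist_norm)
  qed (use d in auto)
qed

text \<open>The derivative falls on the kernel. Its remainder is uniformly small, so the error is at
  most that remainder times the L1 norm of u on one ball that serves all increments of length below
  1.\<close>

lemma conv_has_derivative:
  fixes u :: "real^'n::finite \<Rightarrow> real"
  assumes u: "loc_int u" and \<rho>: "C1c \<rho> G"
  shows "(conv u \<rho> has_derivative (\<lambda>h. (\<chi> i. conv u (\<lambda>z. G z $ i) x) \<bullet> h)) (at x)"
  unfolding has_derivative_at_alt
proof (intro conjI allI impI)
  show "bounded_linear (\<lambda>h. (\<chi> i. conv u (\<lambda>z. G z $ i) x) \<bullet> h)" by (rule bounded_linear_inner_right)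
  obtain R where R: "\<And>x. (\<rho> has_derivative (\<lambda>h. G x \<bullet> h)) (at x)" "continuous_on UNIV G" "continuous_on UNIV \<rho>"
    "R \<ge> 0" "\<And>x. norm x > R \<Longrightarrow> \<rho> x = 0" "\<And>x. norm x > R \<Longrightarrow> G x = 0"
    by (rule C1cE[OF \<rho>]) (rule that; assumption)
  have cG: "continuous_on UNIV (\<lambda>z. G z $ i)" for i by (intro continuous_intros R)
  have iG: "integrable lborel (\<lambda>y. u y * (G (x - y) $ i))" for i
    by (rule conv_integrable[OF u cG, of R]) (use R in auto)
  have lin: "(\<chi> i. conv u (\<lambda>z. G z $ i) x) \<bullet> h = (LINT y|lborel. u y * (G (x - y) \<bullet> h))"
    and ilin: "integrable lborel (\<lambda>y. u y * (G (x - y) \<bullet> h))" for h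
  proof -
    have eq: "(\<lambda>y. u y * (G (x - y) \<bullet> h)) = (\<lambda>y. \<Sum>i\<in>UNIV. u y * (G (x - y) $ i) * h $ i)"
      by (simp add: inner_vec_def sum_distrib_left mult.assoc)
    show "integrable lborel (\<lambda>y. u y * (G (x - y) \<bullet> h))" unfolding eq
      by (intro Bochner_Integration.integrable_sum integrable_mult_left iG)
    show "(\<chi> i. conv u (\<lambda>z. G z $ i) x) \<bullet> h = (LINT y|lborel. u y * (G (x - y) \<bullet> h))"
      unfolding eq using iG by (simp add: inner_vec_def conv_def)
  qed
  fix e :: real assume e: "e > 0"
  define I where "I = (LINT y|lborel. \<bar>indicator (cball 0 (R + norm x + 1)) y * u y\<bar>)"
  have I: "I \<ge> 0" unfolding I_def by (intro integral_nonneg_AE) auto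
  define e' where "e' = e / (I + 1)"
  have e': "e' > 0" using e I by (simp add: e'_def)
  obtain d where d: "d > 0" "\<And>x h. norm h < d \<Longrightarrow> \<bar>\<rho> (x + h) - \<rho> x - G x \<bullet> h\<bar> \<le> e' * norm h"
    using C1c_uniform_differentiability[OF \<rho> e'] by blast
  show "\<exists>d>0. \<forall>y. norm (y - x) < d \<longrightarrow>
    norm (conv u \<rho> y - conv u \<rho> x - (\<chi> i. conv u (\<lambda>z. G z $ i) x) \<bullet> (y - x)) \<le> e * norm (y - x)"
  proof (intro exI[of _ "min d 1"] conjI allI impI)
    fix x' assume x': "norm (x' - x) < min d 1"
    let ?h = "x' - x"
    have "conv u \<rho> x' - conv u \<rho> x - (\<chi> i. conv u (\<lambda>z. G z $ i) x) \<bullet> ?h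
      = (LINT y|lborel. u y * (\<rho> (x' - y) - \<rho> (x - y) - G (x - y) \<bullet> ?h))"
      unfolding conv_def[of u \<rho>] lin using conv_integrable[OF u R(3,5)] ilin by (simp add: right_diff_distrib)
    also have "\<bar>\<dots>\<bar> \<le> (e' * norm ?h) * I"
      unfolding I_def
    proof (rule loc_int_integrable_mult(2)[OF u])
      have "continuous_on UNIV (\<lambda>y. \<rho> (x' - y) - \<rho> (x - y) - G (x - y) \<bullet> ?h)"
        by (intro continuous_intros continuous_on_compose2[OF R(3)] continuous_on_compose2[OF R(2)]) auto
      then show "(\<lambda>y. \<rho> (x' - y) - \<rho> (x - y) - G (x - y) \<bullet> ?h) \<in> borel_measurable lborel"
        by (simp add: borel_measurable_continuous_onI)
      show "\<bar>\<rho> (x' - y) - \<rho> (x - y) - G (x - y) \<bullet> ?h\<bar> \<le> e' * norm ?h" for y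
        using d(2)[of ?h "x - y"] x' by simp
      show "\<rho> (x' - y) - \<rho> (x - y) - G (x - y) \<bullet> ?h = 0" if "norm y > R + norm x + 1" for y
      proof -
        have "norm (x' - y) > R" "norm (x - y) > R"
          using that norm_triangle_ineq2[of y x] norm_triangle_ineq2[of y x'] norm_triangle_ineq2[of x' x] x'
          by (simp_all add: norm_minus_commute)
        then show ?thesis using R by simp
      qed
    qed
    also have "\<dots> \<le> (e' * norm ?h) * (I + 1)" using e' by (intro mult_left_mono) auto
    also have "\<dots> = e * norm ?h" using I by (simp add: e'_def)
    finally show "norm (conv u \<rho> x' - conv u \<rho> x - (\<chi> i. conv u (\<lambda>z. G z $ i) x) \<bullet> (x' - x)) \<le> e * norm (x' - x)"
      by simp
  qed (use d in auto)
qed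

lemma smooth_fun_partial_deriv: "smooth_fun \<phi> \<Longrightarrow> smooth_fun (partial_deriv i \<phi>)"
  unfolding smooth_fun_def
proof (intro allI)
  fix js and x assume "\<forall>js x. fold partial_deriv js \<phi> differentiable at x"
  from this[rule_format, of "i # js" x] show "fold partial_deriv js (partial_deriv i \<phi>) differentiable at x"
    by simp
qed

lemma smooth_fun_has_derivative_grad:
  assumes "smooth_fun \<phi>"
  shows "(\<phi> has_derivative (\<lambda>h. grad \<phi> x \<bullet> h)) (at x)"
proof -
  have "\<phi> differentiable at x" using assms[unfolded smooth_fun_def, rule_format, of "[]"] by simp
  then have D: "(\<phi> has_derivative frechet_derivative \<phi> (at x)) (at x)"
    by (simp add: frechet_derivative_works)
  then interpret L: linear "frechet_derivative \<phi> (at x)" by (rule has_derivative_linear)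
  have "frechet_derivative \<phi> (at x) h = grad \<phi> x \<bullet> h" for h
  proof -
    have "frechet_derivative \<phi> (at x) h = frechet_derivative \<phi> (at x) (\<Sum>i\<in>UNIV. h $ i *s axis i 1)"
      by (simp add: basis_expansion)
    also have "\<dots> = (\<Sum>i\<in>UNIV. h $ i * frechet_derivative \<phi> (at x) (axis i 1))"
      by (simp add: L.sum L.scale scalar_mult_eq_scaleR)
    finally show ?thesis by (simp add: grad_def partial_deriv_def inner_vec_def mult.commute)
  qed
  then show ?thesis using D by (metis (no_types, lifting) ext)
qed

lemma smooth_fun_imp_C1c:
  assumes "smooth_fun \<phi>" "\<And>x. norm x > R \<Longrightarrow> \<phi> x = 0"
  shows "C1c \<phi> (grad \<phi>)"
proof (rule C1cI[OF smooth_fun_has_derivative_grad[OF assms(1)] _ assms(2)])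
  have "continuous_on UNIV (partial_deriv i \<phi>)" for i
    using smooth_fun_has_derivative_grad[OF smooth_fun_partial_deriv[OF assms(1), of i]]
    by (meson continuous_at_imp_continuous_on has_derivative_continuous)
  then show "continuous_on UNIV (grad \<phi>)"
    unfolding grad_def by (intro continuous_on_vec_lambda) auto
qed

text \<open>The induction carries more than smoothness: every iterated derivative of the convolution
  is the convolution with the iterated derivative of the kernel, which is again smooth and vanishes
  outside the same ball.\<close>

lemma smooth_fun_conv:
  fixes u :: "real^'n::finite \<Rightarrow> real"
  assumes u: "loc_int u"
  shows "smooth_fun \<rho> \<Longrightarrow> (\<And>x. norm x > R \<Longrightarrow> \<rho> x = 0) \<Longrightarrow> smooth_fun (conv u \<rho>)"
proof -
  have *: "fold partial_deriv js (conv u \<rho>) = conv u (fold partial_deriv js \<rho>) \<and> smooth_fun (fold partial_deriv js \<rho>) \<and>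
     (\<forall>x. norm x > R \<longrightarrow> fold partial_deriv js \<rho> x = 0)"
    if "smooth_fun \<rho>" "\<And>x. norm x > R \<Longrightarrow> \<rho> x = 0" for js \<rho>
    using that
  proof (induction js arbitrary: \<rho>)
    case (Cons i js)
    note C = smooth_fun_imp_C1c[OF Cons.prems]
    have "partial_deriv i (conv u \<rho>) x = conv u (partial_deriv i \<rho>) x" for x
    proof -
      have "(\<lambda>z. grad \<rho> z $ i) = partial_deriv i \<rho>" by (simp add: grad_def)
      then show ?thesis using has_derivative_imp_grad(1)[OF conv_has_derivative[OF u C], where i = i] by simp
    qed
    then have eq: "partial_deriv i (conv u \<rho>) = conv u (partial_deriv i \<rho>)" by auto
    have z: "partial_deriv i \<rho> x = 0" if "norm x > R" for x
    proof -
      have "grad \<rho> x = 0"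
        by (rule zero_grad_outside[OF smooth_fun_has_derivative_grad[OF Cons.prems(1)] Cons.prems(2) that])
      then have "grad \<rho> x $ i = 0" by simp
      then show ?thesis by (simp add: grad_def)
    qed
    show ?case using Cons.IH[OF smooth_fun_partial_deriv[OF Cons.prems(1)] z] by (simp add: eq)
  qed simp
  assume \<rho>: "smooth_fun \<rho>" "\<And>x. norm x > R \<Longrightarrow> \<rho> x = 0"
  show "smooth_fun (conv u \<rho>)"
    unfolding smooth_fun_def
  proof (intro allI)
    fix js x
    have "C1c (fold partial_deriv js \<rho>) (grad (fold partial_deriv js \<rho>))"
      using *[OF \<rho>, of js] by (intro smooth_fun_imp_C1c) auto
    from conv_has_derivative[OF u this, of x]
    show "fold partial_deriv js (conv u \<rho>) differentiable at x"
      using *[OF \<rho>, of js] by (auto intro: differentiableI)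
  qed
qed

lemma conv_support:
  fixes u \<rho> :: "'a::euclidean_space \<Rightarrow> real"
  assumes "\<And>x. norm x > R1 \<Longrightarrow> u x = 0" "\<And>x. norm x > R2 \<Longrightarrow> \<rho> x = 0" "norm x > R1 + R2"
  shows "conv u \<rho> x = 0"
proof -
  have "u y * \<rho> (x - y) = 0" for y
  proof (cases "norm y > R1")
    case False
    then have "norm (x - y) > R2" using assms(3) norm_triangle_ineq2[of x y] by simp
    then show ?thesis using assms(2) by simp
  qed (use assms(1) in simp)
  then have "(\<lambda>y. u y * \<rho> (x - y)) = (\<lambda>_. 0)" by (rule ext)
  then show ?thesis unfolding conv_def by (simp only: Bochner_Integration.integral_zero)
qed

lemma test_funI:
  assumes "smooth_fun \<phi>" "\<And>x. norm x > R \<Longrightarrow> \<phi> x = 0"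
  shows "test_fun \<phi>"
  unfolding test_fun_def
proof (intro conjI assms)
  have "{x. \<phi> x \<noteq> 0} \<subseteq> cball 0 R" using assms(2) by (force simp: not_less[symmetric])
  then have "bounded {x. \<phi> x \<noteq> 0}" using bounded_subset bounded_cball by blast
  then show "compact (closure {x. \<phi> x \<noteq> 0})" by simp
qed

lemma test_fun_support:
  assumes "test_fun \<phi>"
  obtains R where "R \<ge> 0" "\<And>x. norm x > R \<Longrightarrow> \<phi> x = 0"
proof -
  have "bounded {x. \<phi> x \<noteq> 0}"
    using assms unfolding test_fun_def by (meson bounded_subset closure_subset compact_imp_bounded)
  then obtain R where R: "\<forall>x\<in>{x. \<phi> x \<noteq> 0}. norm x \<le> R" unfolding bounded_iff by blast
  show ?thesis
  proof (rule that[of "max 0 R"])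
    show "\<phi> x = 0" if "norm x > max 0 R" for x using R that by fastforce
  qed simp
qed

section \<open>Bump functions and mollifiers\<close>

definition bump :: "real \<Rightarrow> real poly \<Rightarrow> nat \<Rightarrow> real \<Rightarrow> real" where
  "bump \<delta> P k t = (if \<bar>t\<bar> < \<delta> then poly P t * (1 / (\<delta>\<^sup>2 - t\<^sup>2)) ^ k * exp (- (1 / (\<delta>\<^sup>2 - t\<^sup>2))) else 0)"

text \<open>
  With \<open>q = 1 / (\<delta>^2 - t^2)\<close> one has \<open>q' = 2 t q^2\<close>, so the derivative of \<open>P q^k exp(-q)\<close> has again this shape,
  with exponent \<open>k + 2\<close>.
\<close>

definition bump_deriv :: "real \<Rightarrow> real poly \<Rightarrow> nat \<Rightarrow> real poly" where
  "bump_deriv \<delta> P k = pderiv P * [:\<delta>\<^sup>2, 0, -1:]\<^sup>2 + smult (2 * real k) (P * [:0, 1:] * [:\<delta>\<^sup>2, 0, -1:])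
     - smult 2 ([:0, 1:] * P)"

text \<open>Quadratic contact with zero forces value and derivative to vanish at t. It serves at the
  edge of the bump and at the corner of the squared positive part.\<close>

lemma has_real_derivative_zeroI:
  fixes f :: "real \<Rightarrow> real"
  assumes "\<And>y. \<bar>f y\<bar> \<le> C * (y - t)\<^sup>2"
  shows "(f has_real_derivative 0) (at t)"
proof -
  have ft: "f t = 0" using assms[of t] by simp
  have "((\<lambda>y. (f y - f t) / (y - t)) \<longlongrightarrow> 0) (at t)"
  proof (rule Lim_null_comparison)
    show "\<forall>\<^sub>F y in at t. norm ((f y - f t) / (y - t)) \<le> C * \<bar>y - t\<bar>"
    proof (rule eventually_at_topological[THEN iffD2], intro exI[of _ UNIV] conjI ballI impI)
      fix y :: real assume y: "y \<noteq> t"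
      have "\<bar>f y\<bar> / \<bar>y - t\<bar> \<le> C * (y - t)\<^sup>2 / \<bar>y - t\<bar>" using assms[of y] by (intro divide_right_mono) auto
      also have "\<dots> = C * \<bar>y - t\<bar>" using y abs_mult_self_eq[of "y - t"]
        by (simp only: power2_eq_square) (simp add: field_simps)
      finally show "norm ((f y - f t) / (y - t)) \<le> C * \<bar>y - t\<bar>" using ft by simp
    qed auto
    have "((\<lambda>y. C * \<bar>y - t\<bar>) \<longlongrightarrow> C * \<bar>t - t\<bar>) (at t)" by (intro tendsto_intros)
    then show "((\<lambda>y. C * \<bar>y - t\<bar>) \<longlongrightarrow> 0) (at t)" by simp
  qed
  then show ?thesis by (simp add: has_field_derivative_iff)
qed

text \<open>From (1 + x/n)^n <= exp x; an explicit bound saying that the exponential beats every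
  power of 1/(\<delta>^2 - t^2).\<close>

lemma power_mult_exp_minus_le:
  fixes x :: real
  assumes "x \<ge> 0"
  shows "x ^ n * exp (- x) \<le> real n ^ n"
proof (cases "n = 0")
  case False
  have "(x / real n) ^ n \<le> (1 + x / real n) ^ n" using assms by (intro power_mono) auto
  also have "\<dots> \<le> exp x" using assms False by (intro exp_ge_one_plus_x_over_n_power_n) auto
  finally have "x ^ n \<le> real n ^ n * exp x" using False by (simp add: power_divide field_simps)
  then show ?thesis by (simp add: exp_minus field_simps)
qed (use assms in simp)

text \<open>The case |t| = \<delta> needs the idea. With s = \<delta>^2 - y^2, two further powers of
  1/s are still bounded against the exponential, so the bump is at most a constant times s^2; and s
  = (t + y)(t - y) makes this quadratic in y - t.\<close>

lemma bump_has_derivative: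
  assumes \<delta>: "\<delta> > 0"
  shows "(bump \<delta> P k has_real_derivative bump \<delta> (bump_deriv \<delta> P k) (k + 2) t) (at t)"
proof -
  consider "\<bar>t\<bar> < \<delta>" | "\<bar>t\<bar> > \<delta>" | "\<bar>t\<bar> = \<delta>" by linarith
  then show ?thesis
  proof cases
    case 1
    have "t\<^sup>2 < \<delta>\<^sup>2" using 1 \<delta> power_strict_mono[of "\<bar>t\<bar>" \<delta> 2] by simp
    define s where "s = \<delta>\<^sup>2 - t\<^sup>2"
    have s: "s > 0" using \<open>t\<^sup>2 < \<delta>\<^sup>2\<close> by (simp add: s_def)
    let ?q = "\<lambda>t. 1 / (\<delta>\<^sup>2 - t\<^sup>2)"
    have dq: "(?q has_real_derivative 2 * t * (1 / s)\<^sup>2) (at t)"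
      using s by (auto intro!: derivative_eq_intros simp: s_def power2_eq_square field_simps)
    have dqk: "((\<lambda>t. ?q t ^ k) has_real_derivative real k * (?q t ^ (k - 1)) * (2 * t * (1 / s)\<^sup>2)) (at t)"
      using DERIV_power[OF dq, of k] by (simp add: mult_ac)
    have de: "((\<lambda>t. exp (- ?q t)) has_real_derivative exp (- ?q t) * (- (2 * t * (1 / s)\<^sup>2))) (at t)"
      by (intro DERIV_chain2[OF DERIV_exp] DERIV_minus dq)
    have "((\<lambda>t. poly P t * ?q t ^ k * exp (- ?q t)) has_real_derivative
      (poly (pderiv P) t * ?q t ^ k + (real k * (?q t ^ (k - 1)) * (2 * t * (1 / s)\<^sup>2)) * poly P t) * exp (- ?q t)
        + (exp (- ?q t) * (- (2 * t * (1 / s)\<^sup>2))) * (poly P t * ?q t ^ k)) (at t)"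
      by (intro DERIV_mult poly_DERIV dqk de)
    also have "(poly (pderiv P) t * ?q t ^ k + (real k * (?q t ^ (k - 1)) * (2 * t * (1 / s)\<^sup>2)) * poly P t) * exp (- ?q t)
        + (exp (- ?q t) * (- (2 * t * (1 / s)\<^sup>2))) * (poly P t * ?q t ^ k)
      = bump \<delta> (bump_deriv \<delta> P k) (k + 2) t"
    proof -
      have k1: "real k * (1 / s) ^ (k - 1) = real k * s * (1 / s) ^ k"
        using s by (cases k) auto
      have k2: "(1 / s) ^ k = s\<^sup>2 * (1 / s) ^ (k + 2)"
        using s by (simp add: power_divide power2_eq_square)
      have eq1: "(poly (pderiv P) t * (1 / s) ^ k + (real k * ((1 / s) ^ (k - 1)) * (2 * t * (1 / s)\<^sup>2)) * poly P t)
          + - (2 * t * (1 / s)\<^sup>2) * (poly P t * (1 / s) ^ k)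
        = (poly (pderiv P) t * s\<^sup>2 + 2 * real k * (poly P t * t * s) - 2 * (t * poly P t)) * (1 / s) ^ (k + 2)"
        unfolding k1 using s by (simp add: power_add power_divide power2_eq_square field_simps)
      have eq2: "poly (bump_deriv \<delta> P k) t = poly (pderiv P) t * s\<^sup>2 + 2 * real k * (poly P t * t * s) - 2 * (t * poly P t)"
        by (simp add: bump_deriv_def s_def power2_eq_square algebra_simps)
      have gen: "(a + b) * e + (e * (- c)) * d = ((a + b) + - c * d) * e" for a b c d e :: real
        by (simp add: algebra_simps)
      show ?thesis unfolding bump_def s_def[symmetric] by (simp only: gen eq1 eq2 1 if_True)
    qed
    finally show ?thesis
      by (rule has_field_derivative_transform_within_open[where S = "{- \<delta><..<\<delta>}"])
        (use 1 in \<open>auto simp: bump_def abs_less_iff\<close>)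
  next
    case 2
    have "((\<lambda>_. 0) has_real_derivative 0) (at t)" by simp
    then have "(bump \<delta> P k has_real_derivative 0) (at t)"
      by (rule has_field_derivative_transform_within_open[where S = "- {- \<delta>..\<delta>}"])
        (use 2 in \<open>auto simp: bump_def\<close>)
    then show ?thesis using 2 by (simp add: bump_def)
  next
    case 3
    have "continuous_on {-\<delta>..\<delta>} (\<lambda>t. poly P t)" by (intro continuous_intros)
    then have "bounded (poly P ` {-\<delta>..\<delta>})"
      by (intro compact_imp_bounded compact_continuous_image) auto
    then obtain B where B: "\<And>y. y \<in> {-\<delta>..\<delta>} \<Longrightarrow> \<bar>poly P y\<bar> \<le> B" unfolding bounded_iff by force
    have B0: "B \<ge> 0" using B[of 0] \<delta> by simp
    have "\<bar>bump \<delta> P k y\<bar> \<le> (B * real (k + 2) ^ (k + 2) * (2 * \<delta>)\<^sup>2) * (y - t)\<^sup>2" for y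
    proof (cases "\<bar>y\<bar> < \<delta>")
      case True
      define s where "s = \<delta>\<^sup>2 - y\<^sup>2"
      have s: "s > 0" using True \<delta> power_strict_mono[of "\<bar>y\<bar>" \<delta> 2] by (simp add: s_def)
      have "t\<^sup>2 = \<delta>\<^sup>2" using 3 by (metis power2_abs)
      then have "s = (t + y) * (t - y)" by (simp add: s_def power2_eq_square algebra_simps)
      then have "s\<^sup>2 = (t + y)\<^sup>2 * (t - y)\<^sup>2" by (simp add: power_mult_distrib)
      also have "\<dots> \<le> (2 * \<delta>)\<^sup>2 * (t - y)\<^sup>2"
      proof (intro mult_right_mono)
        have "\<bar>t + y\<bar> \<le> \<bar>2 * \<delta>\<bar>" using 3 True by auto
        then show "(t + y)\<^sup>2 \<le> (2 * \<delta>)\<^sup>2" by (simp add: abs_le_square_iff)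
      qed auto
      finally have s2: "s\<^sup>2 \<le> (2 * \<delta>)\<^sup>2 * (y - t)\<^sup>2" by (simp add: power2_commute)
      have "\<bar>bump \<delta> P k y\<bar> = \<bar>poly P y\<bar> * ((1 / s) ^ k * exp (- (1 / s)))"
        using True s by (simp add: bump_def s_def[symmetric] abs_mult)
      also have "\<dots> \<le> B * ((1 / s) ^ k * exp (- (1 / s)))"
        using B[of y] True s by (intro mult_right_mono B) auto
      also have "(1 / s) ^ k * exp (- (1 / s)) = ((1 / s) ^ (k + 2) * exp (- (1 / s))) * s\<^sup>2"
        using s by (simp add: power_divide power2_eq_square)
      also have "B * \<dots> \<le> B * (real (k + 2) ^ (k + 2) * s\<^sup>2)"
        using s B0 by (intro mult_left_mono mult_right_mono power_mult_exp_minus_le) auto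
      also have "\<dots> \<le> B * (real (k + 2) ^ (k + 2) * ((2 * \<delta>)\<^sup>2 * (y - t)\<^sup>2))"
        using B0 s2 by (intro mult_left_mono) auto
      finally show ?thesis by (simp only: mult.assoc)
    next
      case False
      then show ?thesis using B0 by (simp add: bump_def)
    qed
    then have "(bump \<delta> P k has_real_derivative 0) (at t)" by (rule has_real_derivative_zeroI)
    then show ?thesis using 3 by (simp add: bump_def)
  qed
qed

text \<open>A partial derivative in coordinate k replaces only the k-th factor. If the one-variable
  family S is closed under derivation, the products over S are therefore closed under partial
  derivatives, and all of them are differentiable.\<close>

lemma smooth_fun_product:
  fixes \<psi> :: "'n::finite \<Rightarrow> real \<Rightarrow> real" and S :: "(real \<Rightarrow> real) set"
  assumes S: "\<And>\<psi>. \<psi> \<in> S \<Longrightarrow> \<exists>\<psi>'\<in>S. \<forall>t. (\<psi> has_real_derivative \<psi>' t) (at t)"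
    and \<psi>: "\<And>i. \<psi> i \<in> S"
  shows "smooth_fun (\<lambda>x::real^'n. c * (\<Prod>i\<in>UNIV. \<psi> i (x $ i)))"
proof -
  let ?p = "\<lambda>\<psi> x. c * (\<Prod>i\<in>UNIV. \<psi> i ((x::real^'n) $ i))"
  have D: "\<exists>\<psi>'. (\<forall>i. \<psi>' i \<in> S) \<and> (\<forall>x. (?p \<psi> has_derivative
      (\<lambda>h. c * (\<Sum>i\<in>UNIV. \<psi>' i (x $ i) * h $ i * (\<Prod>j\<in>UNIV - {i}. \<psi> j (x $ j))))) (at x))"
    if a: "\<And>i. \<psi> i \<in> S" for \<psi>
  proof -
    have "\<forall>i. \<exists>\<psi>'. \<psi>' \<in> S \<and> (\<forall>t. (\<psi> i has_real_derivative \<psi>' t) (at t))"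
      using S[OF a] by auto
    from choice[OF this] obtain \<psi>' where
      p': "\<And>i. \<psi>' i \<in> S" "\<And>i t. (\<psi> i has_real_derivative \<psi>' i t) (at t)" by auto
    have "(?p \<psi> has_derivative
      (\<lambda>h. c * (\<Sum>i\<in>UNIV. \<psi>' i (x $ i) * h $ i * (\<Prod>j\<in>UNIV - {i}. \<psi> j (x $ j))))) (at x)" for x
    proof (intro has_derivative_mult_right has_derivative_prod)
      fix i
      show "((\<lambda>x. \<psi> i (x $ i)) has_derivative (\<lambda>h. \<psi>' i (x $ i) * h $ i)) (at x)"
        using has_derivative_compose[OF bounded_linear_imp_has_derivative[OF bounded_linear_vec_nth]
            p'(2)[of i "x $ i", unfolded has_field_derivative_def]] by simp
    qed
    then show ?thesis using p'(1) by blast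
  qed
  have "\<forall>x. fold partial_deriv js (?p \<psi>) differentiable at x" if "\<And>i. \<psi> i \<in> S" for js \<psi>
    using that
  proof (induction js arbitrary: \<psi>)
    case Nil
    from D[of \<psi>, OF Nil] show ?case unfolding differentiable_def fold_simps by blast
  next
    case (Cons k js)
    obtain \<psi>' where p': "\<And>i. \<psi>' i \<in> S" and D': "\<And>x. (?p \<psi> has_derivative
      (\<lambda>h. c * (\<Sum>i\<in>UNIV. \<psi>' i (x $ i) * h $ i * (\<Prod>j\<in>UNIV - {i}. \<psi> j (x $ j))))) (at x)"
      using D[of \<psi>, OF Cons.prems] by auto
    have "partial_deriv k (?p \<psi>) = ?p (\<psi>(k := \<psi>' k))"
    proof
      fix x
      have "partial_deriv k (?p \<psi>) x = c * (\<Sum>i\<in>UNIV. \<psi>' i (x $ i) * axis k 1 $ i * (\<Prod>j\<in>UNIV - {i}. \<psi> j (x $ j)))"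
        unfolding partial_deriv_def frechet_derivative_at[OF D', symmetric] ..
      also have "(\<Sum>i\<in>UNIV. \<psi>' i (x $ i) * axis k 1 $ i * (\<Prod>j\<in>UNIV - {i}. \<psi> j (x $ j)))
        = (\<Sum>i\<in>UNIV. if i = k then \<psi>' k (x $ k) * (\<Prod>j\<in>UNIV - {k}. \<psi> j (x $ j)) else 0)"
        by (rule sum.cong) (auto simp: axis_def)
      also have "\<dots> = \<psi>' k (x $ k) * (\<Prod>j\<in>UNIV - {k}. \<psi> j (x $ j))" by simp
      also have "\<dots> = (\<Prod>i\<in>UNIV. (\<psi>(k := \<psi>' k)) i (x $ i))"
        by (subst prod.remove[of _ k]) (auto intro!: prod.cong)
      finally show "partial_deriv k (?p \<psi>) x = ?p (\<psi>(k := \<psi>' k)) x" .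
    qed
    then show ?case using Cons.IH[of "\<psi>(k := \<psi>' k)"] Cons.prems p' by simp
  qed
  then show ?thesis using \<psi> by (simp add: smooth_fun_def)
qed

definition mollifier :: "real \<Rightarrow> (real^'n::finite \<Rightarrow> real) \<Rightarrow> bool" where
  "mollifier d \<rho> \<longleftrightarrow> smooth_fun \<rho> \<and> (\<forall>x. 0 \<le> \<rho> x) \<and> (\<forall>x. norm x > d \<longrightarrow> \<rho> x = 0) \<and>
     integrable lborel \<rho> \<and> (LINT x|lborel. \<rho> x) = 1"

lemma mollifier_exists:
  assumes "d > 0"
  obtains \<rho> :: "real^'n::finite \<Rightarrow> real" where "mollifier d \<rho>"
proof -
  \<comment> \<open>The product is supported in a cube. The Euclidean norm is at most the sum of the
    coordinates' absolute values, so this side length puts the cube into the ball of radius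
    d.\<close>
  define \<delta> where "\<delta> = d / real CARD('n)"
  have \<delta>: "\<delta> > 0" using assms by (simp add: \<delta>_def)
  let ?S = "{bump \<delta> P k | P k. True}"
  define \<beta> where "\<beta> x = (\<Prod>i\<in>(UNIV :: 'n set). bump \<delta> 1 0 (x $ i))" for x
  have sm: "smooth_fun (\<lambda>x::real^'n. c * \<beta> x)" for c
    unfolding \<beta>_def by (rule smooth_fun_product[where S = ?S]) (use bump_has_derivative[OF \<delta>] in blast)+
  have nn: "\<beta> x \<ge> 0" for x unfolding \<beta>_def by (intro prod_nonneg) (auto simp: bump_def)
  have z: "\<beta> x = 0" if "norm x > d" for x
  proof -
    have "\<exists>i. \<bar>x $ i\<bar> \<ge> \<delta>"
    proof (rule ccontr)
      assume "\<not> ?thesis"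
      then have "(\<Sum>i\<in>UNIV. \<bar>x $ i\<bar>) \<le> (\<Sum>i\<in>(UNIV::'n set). \<delta>)" by (intro sum_mono) (auto simp: not_le less_imp_le)
      then show False using norm_le_l1_cart[of x] that by (simp add: \<delta>_def)
    qed
    then obtain i where "\<bar>x $ i\<bar> \<ge> \<delta>" by blast
    then have "bump \<delta> 1 0 (x $ i) = 0" by (simp add: bump_def)
    then show ?thesis unfolding \<beta>_def by (intro prod_zero) auto
  qed
  have D: "C1c \<beta> (grad \<beta>)" by (rule smooth_fun_imp_C1c[OF _ z]) (use sm[of 1] in simp)
  then have c: "continuous_on UNIV \<beta>" using C1cE by blast
  have i: "integrable lborel \<beta>" by (rule continuous_integrable_lborel[OF c z])
  \<comment> \<open>Normalisation needs a nonzero mass: zero mass would make the nonempty open set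
    where \<beta> is nonzero a null set.\<close>
  have "(LINT x|lborel. \<beta> x) \<noteq> 0"
  proof
    assume "(LINT x|lborel. \<beta> x) = 0"
    then have ae: "AE x in lborel. \<beta> x = 0" using integral_nonneg_eq_0_iff_AE[OF i] nn by auto
    have op: "open {x. \<beta> x \<noteq> 0}"
      using open_Collect_neq[OF c continuous_on_const[of UNIV 0]] by simp
    have "0 \<in> {x. \<beta> x \<noteq> 0}" using \<delta> by (simp add: \<beta>_def bump_def)
    moreover have "{x. \<beta> x \<noteq> 0} \<in> null_sets lborel"
      by (subst AE_iff_null_sets) (use op ae in auto)
    then have "negligible {x. \<beta> x \<noteq> 0}"
      by (simp add: negligible_iff_null_sets null_sets_completionI)
    ultimately show False using open_not_negligible[OF op] by blast
  qed
  moreover have "(LINT x|lborel. \<beta> x) \<ge> 0" using nn by (intro integral_nonneg_AE) auto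
  ultimately have pos: "(LINT x|lborel. \<beta> x) > 0" by simp
  let ?c = "1 / (LINT x|lborel. \<beta> x)"
  show ?thesis
  proof (rule that[of "\<lambda>x. ?c * \<beta> x"], unfold mollifier_def, intro conjI allI impI)
    show "smooth_fun (\<lambda>x. ?c * \<beta> x)" by (rule sm)
    show "integrable lborel (\<lambda>x. ?c * \<beta> x)" using i by (rule integrable_mult_right)
    have "(LINT x|lborel. ?c * \<beta> x) = ?c * (LINT x|lborel. \<beta> x)" by (rule integral_mult_right_zero)
    then show "(LINT x|lborel. ?c * \<beta> x) = 1" using pos by simp
  qed (use nn z pos in auto)
qed

lemma mollifier_sequence_exists:
  obtains \<rho> :: "nat \<Rightarrow> real^'n::finite \<Rightarrow> real" where "\<And>j. mollifier (1 / real (Suc j)) (\<rho> j)"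
proof -
  have "\<forall>j. \<exists>\<rho>::real^'n \<Rightarrow> real. mollifier (1 / real (Suc j)) \<rho>"
  proof
    fix j
    have "1 / real (Suc j) > 0" by simp
    then obtain \<rho> :: "real^'n \<Rightarrow> real" where "mollifier (1 / real (Suc j)) \<rho>" by (rule mollifier_exists)
    then show "\<exists>\<rho>::real^'n \<Rightarrow> real. mollifier (1 / real (Suc j)) \<rho>" by blast
  qed
  from choice[OF this] show ?thesis using that by blast
qed

section \<open>Averaging properties and local L1 convergence of mollifications\<close>

lemma lborel_reflect:
  fixes x :: "'a::euclidean_space"
  shows "distr lborel borel (\<lambda>y. x - y) = lborel"
proof -
  show ?thesis using lborel_affine[of "-1" x] by (simp add: density_1)
qed

lemma integral_lborel_reflect:
  fixes k :: "'a::euclidean_space \<Rightarrow> real"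
  assumes "k \<in> borel_measurable borel"
  shows "(LINT y|lborel. k (x - y)) = (LINT y|lborel. k y)"
    and "integrable lborel k \<Longrightarrow> integrable lborel (\<lambda>y. k (x - y))"
proof -
  have "(LINT y|distr lborel borel (\<lambda>y. x - y). k y) = (LINT y|lborel. k (x - y))"
    by (rule integral_distr) (use assms in auto)
  then show "(LINT y|lborel. k (x - y)) = (LINT y|lborel. k y)" by (simp add: lborel_reflect)
  assume "integrable lborel k"
  then have "integrable (distr lborel borel (\<lambda>y. x - y)) k" by (simp add: lborel_reflect)
  then show "integrable lborel (\<lambda>y. k (x - y))"
    by (subst (asm) integrable_distr_eq) (use assms in auto)
qed

lemma integral_lborel_translate:
  fixes k :: "'a::euclidean_space \<Rightarrow> real"
  assumes "k \<in> borel_measurable borel"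
  shows "(LINT y|lborel. k (y - x)) = (LINT y|lborel. k y)"
    and "integrable lborel k \<Longrightarrow> integrable lborel (\<lambda>y. k (y - x))"
proof -
  have "(\<lambda>y. y - x) = (+) (- x)" by auto
  then have eq: "distr lborel borel (\<lambda>y. y - x) = lborel" using lborel_distr_plus[of "- x"] by simp
  have "(LINT y|distr lborel borel (\<lambda>y. y - x). k y) = (LINT y|lborel. k (y - x))"
    by (rule integral_distr) (use assms in auto)
  then show "(LINT y|lborel. k (y - x)) = (LINT y|lborel. k y)" by (simp add: eq)
  assume "integrable lborel k"
  then have "integrable (distr lborel borel (\<lambda>y. y - x)) k" by (simp add: eq)
  then show "integrable lborel (\<lambda>y. k (y - x))"
    by (subst (asm) integrable_distr_eq) (use assms in auto)
qed

lemma mollifierD: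
  assumes "mollifier d \<rho>"
  shows "smooth_fun \<rho>" "\<And>x. 0 \<le> \<rho> x" "\<And>x. norm x > d \<Longrightarrow> \<rho> x = 0" "integrable lborel \<rho>"
    "(LINT x|lborel. \<rho> x) = 1" "C1c \<rho> (grad \<rho>)" "continuous_on UNIV \<rho>" "\<rho> \<in> borel_measurable borel"
    "(LINT y|lborel. \<rho> (x - y)) = 1" "(LINT y|lborel. \<rho> (y - x)) = 1"
    "integrable lborel (\<lambda>y. \<rho> (x - y))" "integrable lborel (\<lambda>y. \<rho> (y - x))"
proof -
  show *: "smooth_fun \<rho>" "\<And>x. 0 \<le> \<rho> x" "\<And>x. norm x > d \<Longrightarrow> \<rho> x = 0" "integrable lborel \<rho>"
    "(LINT x|lborel. \<rho> x) = 1"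
    using assms by (auto simp: mollifier_def)
  show "C1c \<rho> (grad \<rho>)" by (rule smooth_fun_imp_C1c[OF *(1,3)])
  show c: "continuous_on UNIV \<rho>"
    using smooth_fun_has_derivative_grad[OF *(1)]
    by (meson continuous_at_imp_continuous_on has_derivative_continuous)
  show m: "\<rho> \<in> borel_measurable borel" using c by (rule borel_measurable_continuous_onI)
  show "(LINT y|lborel. \<rho> (x - y)) = 1" "integrable lborel (\<lambda>y. \<rho> (x - y))"
    using integral_lborel_reflect[OF m, of x] * by auto
  show "(LINT y|lborel. \<rho> (y - x)) = 1" "integrable lborel (\<lambda>y. \<rho> (y - x))"
    using integral_lborel_translate[OF m, of x] * by auto
qed

text \<open>An average of unit mass inherits deviation bounds. The bound is needed almost everywhere
  only; with c = 0 it gives the sup bound for mollified bounded functions, with c = k x it gives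
  convergence for continuous k.\<close>

lemma conv_approx:
  fixes k :: "real^'n::finite \<Rightarrow> real"
  assumes k: "loc_int k" and \<rho>: "mollifier d \<rho>" and c: "AE y in lborel. dist y x \<le> d \<longrightarrow> \<bar>k y - c\<bar> \<le> e"
  shows "\<bar>conv k \<rho> x - c\<bar> \<le> e"
proof -
  note M = mollifierD[OF \<rho>]
  have i1: "integrable lborel (\<lambda>y. k y * \<rho> (x - y))" by (rule conv_integrable[OF k M(7,3)])
  have "conv k \<rho> x - c = (LINT y|lborel. k y * \<rho> (x - y)) - (LINT y|lborel. c * \<rho> (x - y))"
    using M(9)[of x] by (simp add: conv_def)
  also have "\<dots> = (LINT y|lborel. (k y - c) * \<rho> (x - y))"
    using i1 M(11)[of x] by (simp add: left_diff_distrib)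
  also have "\<bar>\<dots>\<bar> \<le> (LINT y|lborel. \<bar>(k y - c) * \<rho> (x - y)\<bar>)" by (rule integral_abs_bound)
  also have "\<dots> \<le> (LINT y|lborel. e * \<rho> (x - y))"
  proof (rule integral_mono_AE)
    show "integrable lborel (\<lambda>y. \<bar>(k y - c) * \<rho> (x - y)\<bar>)"
      using i1 M(11)[of x] by (intro integrable_abs) (simp add: left_diff_distrib)
    show "integrable lborel (\<lambda>y. e * \<rho> (x - y))" using M(11)[of x] by simp
    show "AE y in lborel. \<bar>(k y - c) * \<rho> (x - y)\<bar> \<le> e * \<rho> (x - y)"
      using c
    proof eventually_elim
      case (elim y)
      show ?case
      proof (cases "dist y x \<le> d")
        case True
        then show ?thesis using elim M(2)[of "x - y"] by (simp add: abs_mult mult_right_mono)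
      next
        case False
        then have "\<rho> (x - y) = 0" by (intro M(3)) (simp add: dist_norm norm_minus_commute)
        then show ?thesis by simp
      qed
    qed
  qed
  also have "\<dots> = e" using M(9)[of x] by simp
  finally show ?thesis .
qed

lemma conv_diff:
  assumes "loc_int u" "loc_int k" "mollifier d \<rho>"
  shows "conv u \<rho> x - conv k \<rho> x = conv (\<lambda>x. u x - k x) \<rho> x"
  using conv_integrable[OF assms(1) mollifierD(7,3)[OF assms(3)]]
    conv_integrable[OF assms(2) mollifierD(7,3)[OF assms(3)]]
  by (simp add: conv_def left_diff_distrib)

lemma loc_int_diff: "loc_int u \<Longrightarrow> loc_int k \<Longrightarrow> loc_int (\<lambda>x. u x - k x)"
  by (auto simp: loc_int_def right_diff_distrib)

text \<open>A local form of Young's inequality, by exchanging the two integrals. The ball grows by 1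
  because the kernel has radius at most 1.\<close>

lemma conv_L1_bound:
  fixes w :: "real^'n::finite \<Rightarrow> real"
  assumes w: "loc_int w" and \<rho>: "mollifier d \<rho>" and d: "d \<le> 1"
  shows "(LINT x|lborel. \<bar>indicator (cball 0 R) x * conv w \<rho> x\<bar>) \<le> (LINT x|lborel. \<bar>indicator (cball 0 (R + 1)) x * w x\<bar>)"
proof -
  note M = mollifierD[OF \<rho>]
  define w' where "w' y = \<bar>indicator (cball 0 (R + 1)) y * w y\<bar>" for y
  have iw': "integrable lborel w'" unfolding w'_def using w by (auto simp: loc_int_def)
  have w'0: "w' y \<ge> 0" for y by (simp add: w'_def)
  have mw': "w' \<in> borel_measurable borel" using iw' by auto
  define Q where "Q = (\<lambda>(y, x). w' y * \<rho> (x - y))"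
  have mQ: "Q \<in> borel_measurable (lborel \<Otimes>\<^sub>M lborel)"
    unfolding Q_def using mw' M(8) by measurable
  have inner: "(LINT x|lborel. Q (y, x)) = w' y" for y
    using M(10)[of y] by (simp add: Q_def)
  have iQ: "integrable (lborel \<Otimes>\<^sub>M lborel) Q"
  proof (rule lborel_pair.Fubini_integrable[OF mQ])
    have "(\<lambda>y. LINT x|lborel. norm (Q (y, x))) = w'"
    proof
      fix y
      have "(\<lambda>x. norm (Q (y, x))) = (\<lambda>x. Q (y, x))" using w'0 M(2) by (auto simp: Q_def)
      then show "(LINT x|lborel. norm (Q (y, x))) = w' y" using inner by simp
    qed
    then show "integrable lborel (\<lambda>y. LINT x|lborel. norm (Q (y, x)))" using iw' by simp
    show "AE y in lborel. integrable lborel (\<lambda>x. Q (y, x))"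
      using M(12) by (auto simp: Q_def intro!: AE_I2)
  qed
  have iQ': "integrable (lborel \<Otimes>\<^sub>M lborel) (\<lambda>(y, x). Q (y, x))" using iQ by simp
  have F: "(LINT x|lborel. (LINT y|lborel. Q (y, x))) = (LINT y|lborel. (LINT x|lborel. Q (y, x)))"
    using lborel_pair.Fubini_integral[of "\<lambda>y x. Q (y, x)"] iQ' by simp
  have isnd: "integrable lborel (\<lambda>x. LINT y|lborel. Q (y, x))"
    by (rule lborel_pair.integrable_snd[OF iQ'])
  have cc: "continuous_on UNIV (conv w \<rho>)" by (rule conv_continuous[OF w M(7,3)])
  have "(LINT x|lborel. \<bar>indicator (cball 0 R) x * conv w \<rho> x\<bar>) \<le> (LINT x|lborel. (LINT y|lborel. Q (y, x)))"
  proof (rule integral_mono[OF _ isnd])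
    show "integrable lborel (\<lambda>x. \<bar>indicator (cball 0 R) x * conv w \<rho> x\<bar>)"
      using continuous_imp_loc_int[OF cc] by (auto simp: loc_int_def)
    fix x :: "real^'n"
    show "\<bar>indicator (cball 0 R) x * conv w \<rho> x\<bar> \<le> (LINT y|lborel. Q (y, x))"
    proof (cases "norm x \<le> R")
      case True
      have eq: "\<bar>w y * \<rho> (x - y)\<bar> = Q (y, x)" for y
      proof (cases "norm y \<le> R + 1")
        case True
        then show ?thesis using M(2)[of "x - y"] by (simp add: Q_def w'_def abs_mult)
      next
        case False
        then have "norm (x - y) > d"
          using \<open>norm x \<le> R\<close> norm_triangle_ineq2[of y x] d by (simp add: norm_minus_commute)
        then show ?thesis using M(3) by (simp add: Q_def)
      qed
      have "\<bar>conv w \<rho> x\<bar> \<le> (LINT y|lborel. \<bar>w y * \<rho> (x - y)\<bar>)" unfolding conv_def by (rule integral_abs_bound)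
      then show ?thesis using True by (simp only: eq) simp
    next
      case False
      have "0 \<le> (LINT y|lborel. Q (y, x))" using w'0 M(2) by (intro integral_nonneg_AE) (auto simp: Q_def)
      then show ?thesis using False by simp
    qed
  qed
  also have "\<dots> = (LINT y|lborel. w' y)" unfolding F inner ..
  finally show ?thesis by (simp add: w'_def)
qed

text \<open>A measurable function is almost everywhere the limit of continuous ones. Clamping these
  to [-C', C'] does not disturb the limit where |u| <= C' and furnishes the dominating
  function.\<close>

lemma continuous_L1_approx:
  fixes u :: "real^'n::finite \<Rightarrow> real"
  assumes u: "loc_int u" and C: "AE x in lborel. norm x \<le> R \<longrightarrow> \<bar>u x\<bar> \<le> C" and e: "e > 0"
  shows "\<exists>k. continuous_on UNIV k \<and> (LINT x|lborel. \<bar>indicator (cball 0 R) x * (u x - k x)\<bar>) < e"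
proof -
  define C' where "C' = max 0 C"
  have mu: "u \<in> borel_measurable borel" using u by (simp add: loc_int_def)
  have "u \<in> borel_measurable lebesgue" using mu by (intro measurable_completion) simp
  then have "u measurable_on UNIV" by (rule lebesgue_measurable_imp_measurable_on_real) auto
  then obtain N g where N: "negligible N" and cg: "\<And>n. continuous_on UNIV (g n)"
    and lim: "\<And>x. x \<notin> N \<Longrightarrow> (\<lambda>n. g n x) \<longlonglongrightarrow> u x"
    unfolding measurable_on_def by auto
  define k where "k n x = max (- C') (min C' (g n x))" for n x
  have ck: "continuous_on UNIV (k n)" for n unfolding k_def by (intro continuous_intros cg)
  have AEN: "AE x in lborel. x \<notin> N"
  proof -
    have "N \<in> null_sets lebesgue" using N by (simp add: negligible_iff_null_sets)
    then have "AE x in lebesgue. x \<notin> N" by (rule AE_not_in)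
    then show ?thesis by (simp add: AE_completion_iff)
  qed
  have "(\<lambda>n. LINT x|lborel. \<bar>indicator (cball 0 R) x * (u x - k n x)\<bar>) \<longlonglongrightarrow> (LINT x|(lborel :: (real^'n) measure). (0::real))"
  proof (rule integral_dominated_convergence[where w = "\<lambda>x::real^'n. indicator (cball 0 R) x * (2 * C')"])
    have mk: "k n \<in> borel_measurable lborel" for n
      using borel_measurable_continuous_onI[OF ck] by simp
    have mu': "u \<in> borel_measurable lborel" using mu by simp
    show "(\<lambda>x. \<bar>indicator (cball 0 R) x * (u x - k n x)\<bar>) \<in> borel_measurable lborel" for n
      by (intro borel_measurable_abs borel_measurable_times borel_measurable_diff borel_measurable_indicator mk mu') auto
    show "integrable lborel (\<lambda>x::real^'n. indicator (cball 0 R) x * (2 * C'))"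
      using continuous_imp_loc_int[OF continuous_on_const, of "2 * C'"] unfolding loc_int_def by blast
    show "AE x in lborel. (\<lambda>n. \<bar>indicator (cball 0 R) x * (u x - k n x)\<bar>) \<longlonglongrightarrow> 0"
      using AEN C
    proof eventually_elim
      case (elim x)
      show ?case
      proof (cases "norm x \<le> R")
        case True
        then have "\<bar>u x\<bar> \<le> C'" using elim by (simp add: C'_def)
        have "(\<lambda>n. k n x) \<longlonglongrightarrow> max (- C') (min C' (u x))"
          unfolding k_def by (intro tendsto_intros lim elim)
        also have "max (- C') (min C' (u x)) = u x" using \<open>\<bar>u x\<bar> \<le> C'\<close> by auto
        finally have "(\<lambda>n. \<bar>indicator (cball 0 R) x * (u x - k n x)\<bar>) \<longlonglongrightarrow> \<bar>indicator (cball 0 R) x * (u x - u x)\<bar>"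
          by (intro tendsto_intros)
        then show ?thesis by simp
      qed simp
    qed
    show "AE x in lborel. norm \<bar>indicator (cball 0 R) x * (u x - k n x)\<bar> \<le> indicator (cball 0 R) x * (2 * C')" for n
      using C
    proof eventually_elim
      case (elim x)
      have "\<bar>k n x\<bar> \<le> C'" by (auto simp: k_def C'_def)
      then show ?case using elim by (auto simp: indicator_def C'_def)
    qed
  qed simp
  then have "\<forall>\<^sub>F n in sequentially. (LINT x|lborel. \<bar>indicator (cball 0 R) x * (u x - k n x)\<bar>) < e"
    using e by (intro order_tendstoD(2)[where y = "LINT x|(lborel :: (real^'n) measure). (0::real)"]) auto
  then obtain n where "(LINT x|lborel. \<bar>indicator (cball 0 R) x * (u x - k n x)\<bar>) < e"
    by (auto simp: eventually_sequentially)
  then show ?thesis using ck by blast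
qed

text \<open>Three thirds of e: for a continuous k close to u, the error is the mollification of u -
  k, plus the error for k, minus u - k. The outer two are small by the choice of k and the L1 bound,
  the middle one by uniform continuity.\<close>

lemma mollification_L1_convergence:
  fixes u :: "real^'n::finite \<Rightarrow> real"
  assumes u: "loc_int u" and C: "AE x in lborel. norm x \<le> R + 1 \<longrightarrow> \<bar>u x\<bar> \<le> C" and e: "e > 0"
  shows "\<exists>d0>0. \<forall>d \<rho>. d \<le> d0 \<longrightarrow> mollifier d \<rho> \<longrightarrow>
    (LINT x|lborel. \<bar>indicator (cball 0 R) x * (conv u \<rho> x - u x)\<bar>) < e"
proof -
  obtain k where ck: "continuous_on UNIV k"
    and k: "(LINT x|lborel. \<bar>indicator (cball 0 (R + 1)) x * (u x - k x)\<bar>) < e / 3"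
    using continuous_L1_approx[OF u C, of "e / 3"] e by auto
  have lk: "loc_int k" by (rule continuous_imp_loc_int[OF ck])
  define m where "m = measure lborel (cball (0::real^'n) R) + 1"
  have m: "m > 0" by (simp add: m_def add_nonneg_pos)
  have "uniformly_continuous_on (cball 0 (R + 1)) k"
    by (intro compact_uniformly_continuous continuous_on_subset[OF ck]) auto
  moreover have "e / 3 / m > 0" using e m by simp
  ultimately obtain d1 where d1: "d1 > 0" "\<And>x y. x \<in> cball 0 (R + 1) \<Longrightarrow> y \<in> cball 0 (R + 1) \<Longrightarrow> dist y x < d1 \<Longrightarrow> dist (k y) (k x) < e / 3 / m"
    unfolding uniformly_continuous_on_def by meson
  define d0 where "d0 = min 1 (d1 / 2)"
  have d0: "d0 > 0" "d0 \<le> 1" "d0 < d1" using d1 by (auto simp: d0_def)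
  have "(LINT x|lborel. \<bar>indicator (cball 0 R) x * (conv u \<rho> x - u x)\<bar>) < e" if d: "d \<le> d0" and \<rho>: "mollifier d \<rho>" for d \<rho>
  proof -
    let ?I = "\<lambda>x. indicator (cball (0::real^'n) R) x :: real"
    have luk: "loc_int (\<lambda>x. u x - k x)" by (rule loc_int_diff[OF u lk])
    have cuk: "loc_int (conv (\<lambda>x. u x - k x) \<rho>)"
      by (intro continuous_imp_loc_int conv_continuous[OF luk mollifierD(7,3)[OF \<rho>]])
    have cu: "loc_int (conv u \<rho>)" by (intro continuous_imp_loc_int conv_continuous[OF u mollifierD(7,3)[OF \<rho>]])
    have i1: "integrable lborel (\<lambda>x. \<bar>?I x * conv (\<lambda>x. u x - k x) \<rho> x\<bar>)" using cuk by (auto simp: loc_int_def)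
    have i2: "integrable lborel (\<lambda>x. ?I x * (e / 3 / m))"
      using continuous_imp_loc_int[of "\<lambda>_::real^'n. e / 3 / m"] by (simp add: loc_int_def)
    have i3: "integrable lborel (\<lambda>x. \<bar>indicator (cball 0 (R+1)) x * (u x - k x)\<bar>)" using luk by (auto simp: loc_int_def)
    have "(LINT x|lborel. \<bar>?I x * (conv u \<rho> x - u x)\<bar>) \<le>
      (LINT x|lborel. \<bar>?I x * conv (\<lambda>x. u x - k x) \<rho> x\<bar> + ?I x * (e / 3 / m) + \<bar>indicator (cball 0 (R+1)) x * (u x - k x)\<bar>)"
    proof (rule integral_mono)
      show "integrable lborel (\<lambda>x. \<bar>?I x * (conv u \<rho> x - u x)\<bar>)"
        using loc_int_diff[OF cu u] by (auto simp: loc_int_def)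
      fix x :: "real^'n"
      show "\<bar>?I x * (conv u \<rho> x - u x)\<bar> \<le> \<bar>?I x * conv (\<lambda>x. u x - k x) \<rho> x\<bar> + ?I x * (e / 3 / m) + \<bar>indicator (cball 0 (R+1)) x * (u x - k x)\<bar>"
      proof (cases "norm x \<le> R")
        case True
        have "\<bar>conv k \<rho> x - k x\<bar> \<le> e / 3 / m"
        proof (rule conv_approx[OF lk \<rho>], rule AE_I2, rule impI)
          fix y assume y: "dist y x \<le> d"
          have "norm y \<le> norm x + dist y x" using norm_triangle_ineq2[of y x] by (simp add: dist_norm)
          then have "y \<in> cball 0 (R + 1)" using True y d d0 by simp
          moreover have "x \<in> cball 0 (R + 1)" using True by simp
          ultimately show "\<bar>k y - k x\<bar> \<le> e / 3 / m" using d1(2)[of x y] y d d0 by (simp add: dist_norm)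
        qed
        moreover have "conv u \<rho> x - u x = conv (\<lambda>x. u x - k x) \<rho> x + (conv k \<rho> x - k x) - (u x - k x)"
          using conv_diff[OF u lk \<rho>, of x] by simp
        ultimately have "\<bar>conv u \<rho> x - u x\<bar> \<le> \<bar>conv (\<lambda>x. u x - k x) \<rho> x\<bar> + e / 3 / m + \<bar>u x - k x\<bar>" by linarith
        then show ?thesis using True by simp
      qed simp
    qed (use i1 i2 i3 in auto)
    also have "\<dots> = (LINT x|lborel. \<bar>?I x * conv (\<lambda>x. u x - k x) \<rho> x\<bar>) + (LINT x|lborel. ?I x * (e / 3 / m))
       + (LINT x|lborel. \<bar>indicator (cball 0 (R+1)) x * (u x - k x)\<bar>)"
      using i1 i2 i3 by (simp only: Bochner_Integration.integral_add Bochner_Integration.integrable_add)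
    also have "\<dots> < e / 3 + e / 3 + e / 3"
    proof (intro add_less_le_mono add_strict_mono add_less_le_mono)
      show "(LINT x|lborel. \<bar>?I x * conv (\<lambda>x. u x - k x) \<rho> x\<bar>) < e / 3"
        using conv_L1_bound[OF luk \<rho>, of R] d d0 k by linarith
      have "(LINT x|lborel. ?I x * (e / 3 / m)) = (m - 1) * (e / 3 / m)" by (simp add: m_def)
      also have "\<dots> \<le> m * (e / 3 / m)" using e m by (intro mult_right_mono) auto
      also have "\<dots> = e / 3" using m by simp
      finally show "(LINT x|lborel. ?I x * (e / 3 / m)) \<le> e / 3" .
      show "(LINT x|lborel. \<bar>indicator (cball 0 (R+1)) x * (u x - k x)\<bar>) \<le> e / 3" using k by simp
    qed
    finally show ?thesis by simp
  qed
  then show ?thesis using d0(1) by blast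
qed

section \<open>Weak gradients and weak inequalities under mollification\<close>

lemma has_derivative_reflect:
  fixes \<rho> :: "real^'n::finite \<Rightarrow> real"
  assumes "smooth_fun \<rho>"
  shows "((\<lambda>y. c * \<rho> (x - y)) has_derivative (\<lambda>h. (- c *\<^sub>R grad \<rho> (x - y)) \<bullet> h)) (at y)"
proof -
  have 1: "((\<lambda>y. x - y) has_derivative (\<lambda>h. - h)) (at y)"
    by (auto intro!: derivative_eq_intros)
  have "((\<lambda>y. \<rho> (x - y)) has_derivative (\<lambda>h. grad \<rho> (x - y) \<bullet> (- h))) (at y)"
    by (rule has_derivative_compose[OF 1 smooth_fun_has_derivative_grad[OF assms]])
  from has_derivative_mult_right[OF this, of c] show ?thesis by simp
qed

lemma smooth_fun_reflect:
  fixes \<rho> :: "real^'n::finite \<Rightarrow> real"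
  assumes "smooth_fun \<rho>"
  shows "smooth_fun (\<lambda>y. c * \<rho> (x - y))"
proof -
  have "\<forall>y. fold partial_deriv js (\<lambda>y. c * \<rho> (x - y)) differentiable at y" if "smooth_fun \<rho>" for js c \<rho>
    using that
  proof (induction js arbitrary: c \<rho>)
    case Nil
    then show ?case using has_derivative_reflect[OF Nil, of c x] unfolding differentiable_def fold_simps by blast
  next
    case (Cons i js)
    have eq: "partial_deriv i (\<lambda>y. c * \<rho> (x - y)) = (\<lambda>y. (- c) * partial_deriv i \<rho> (x - y))"
      using has_derivative_imp_grad(1)[OF has_derivative_reflect[OF Cons.prems], where i = i]
      by (auto simp: grad_def)
    show ?case using Cons.IH[OF smooth_fun_partial_deriv[OF Cons.prems], of "- c"]
      by (simp only: fold_simps eq simp_thms)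
  qed
  then show ?thesis using assms by (simp add: smooth_fun_def)
qed

text \<open>The definition of weak gradient is applied to the reflected kernel y -> \<rho>(x - y);
  the sign produced by the reflection cancels the minus sign of the definition.\<close>

lemma conv_weak_gradient:
  fixes u :: "real^'n::finite \<Rightarrow> real"
  assumes "has_weak_gradient u Du" "mollifier d \<rho>"
  shows "conv u (\<lambda>z. grad \<rho> z $ i) x = conv (\<lambda>y. Du y $ i) \<rho> x"
proof -
  note M = mollifierD[OF assms(2)]
  let ?\<phi> = "\<lambda>y. 1 * \<rho> (x - y)"
  have "test_fun ?\<phi>"
  proof (rule test_funI[OF smooth_fun_reflect[OF M(1)], of "norm x + d"])
    fix y :: "real^'n" assume "norm y > norm x + d"
    then have "norm (x - y) > d" using norm_triangle_ineq2[of y x] by (simp add: norm_minus_commute)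
    then show "1 * \<rho> (x - y) = 0" using M(3) by simp
  qed
  then have "(LINT y|lborel. u y * partial_deriv i ?\<phi> y) = - (LINT y|lborel. (Du y $ i) * ?\<phi> y)"
    using assms(1) unfolding has_weak_gradient_def by blast
  moreover have "partial_deriv i ?\<phi> y = - (grad \<rho> (x - y) $ i)" for y
    using has_derivative_imp_grad(1)[OF has_derivative_reflect[OF M(1), where c = 1 and x = x and y = y], where i = i] by simp
  ultimately show ?thesis by (simp add: conv_def)
qed

lemma C1_has_weak_gradient:
  fixes u :: "real^'n::finite \<Rightarrow> real"
  assumes "\<And>x. (u has_derivative (\<lambda>h. G x \<bullet> h)) (at x)" "continuous_on UNIV G"
  shows "has_weak_gradient u G"
  unfolding has_weak_gradient_def
proof (intro conjI allI impI)
  show "G \<in> borel_measurable lborel" using assms(2) by (simp add: borel_measurable_continuous_onI)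
  fix \<phi> :: "real^'n \<Rightarrow> real" and i assume t: "test_fun \<phi>"
  then obtain R where R: "\<And>x. norm x > R \<Longrightarrow> \<phi> x = 0" using test_fun_support by blast
  have "smooth_fun \<phi>" using t by (simp add: test_fun_def)
  then have C: "C1c \<phi> (grad \<phi>)" using R by (rule smooth_fun_imp_C1c)
  show "(LINT x|lborel. u x * partial_deriv i \<phi> x) = - (LINT x|lborel. G x $ i * \<phi> x)"
    using integration_by_parts_C1c(1)[OF assms C, of "axis i 1"]
    by (simp add: inner_axis grad_def mult.commute)
qed

lemma conv_tendsto:
  fixes k :: "real^'n::finite \<Rightarrow> real"
  assumes k: "continuous_on UNIV k" and \<rho>: "\<And>j. mollifier (1 / real (Suc j)) (\<rho> j)"
  shows "(\<lambda>j. conv k (\<rho> j) x) \<longlonglongrightarrow> k x"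
  unfolding LIMSEQ_iff
proof (intro allI impI)
  fix e :: real assume e: "e > 0"
  then have "e / 2 > 0" by simp
  with k obtain d where d: "d > 0" "\<And>y. dist y x < d \<Longrightarrow> dist (k y) (k x) < e / 2"
    unfolding continuous_on_iff by (metis UNIV_I)
  obtain N where N: "1 / real (Suc N) < d" using nat_approx_posE[OF d(1)] by auto
  show "\<exists>N. \<forall>j\<ge>N. norm (conv k (\<rho> j) x - k x) < e"
  proof (intro exI[of _ N] allI impI)
    fix j assume j: "j \<ge> N"
    then have "1 / real (Suc j) \<le> 1 / real (Suc N)" by (simp add: frac_le)
    then have dj: "1 / real (Suc j) < d" using N by linarith
    have "\<bar>conv k (\<rho> j) x - k x\<bar> \<le> e / 2"
    proof (rule conv_approx[OF continuous_imp_loc_int[OF k] \<rho>], rule AE_I2, rule impI)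
      fix y assume "dist y x \<le> 1 / real (Suc j)"
      then have "dist y x < d" using dj by linarith
      then show "\<bar>k y - k x\<bar> \<le> e / 2" using d(2)[of y] by (simp add: dist_norm)
    qed
    then show "norm (conv k (\<rho> j) x - k x) < e" using e by simp
  qed
qed

text \<open>The mollified functions keep the sup bound of k and are supported in one ball of radius
  R + 1, so dominated convergence applies against any locally integrable a.\<close>

lemma conv_pairing_tendsto:
  fixes k a :: "real^'n::finite \<Rightarrow> real"
  assumes a: "loc_int a" and k: "continuous_on UNIV k" "\<And>x. norm x > R \<Longrightarrow> k x = 0"
    and \<rho>: "\<And>j. mollifier (1 / real (Suc j)) (\<rho> j)"
  shows "(\<lambda>j. LINT x|lborel. a x * conv k (\<rho> j) x) \<longlonglongrightarrow> (LINT x|lborel. a x * k x)"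
    and "integrable lborel (\<lambda>x. a x * conv k (\<rho> j) x)" and "integrable lborel (\<lambda>x. a x * k x)"
proof -
  note M = mollifierD[OF \<rho>]
  have lk: "loc_int k" by (rule continuous_imp_loc_int[OF k(1)])
  obtain B where B: "B \<ge> 0" "\<And>x. norm (k x) \<le> B" using continuous_compact_support_bounded[OF k] by blast
  have cB: "\<bar>conv k (\<rho> j) x\<bar> \<le> B" for j x
    using conv_approx[OF lk \<rho>, of x j 0 B] B(2) by simp
  have c0: "conv k (\<rho> j) x = 0" if "norm x > R + 1" for j x
  proof (rule conv_support[OF k(2) M(3)])
    have "1 / real (Suc j) \<le> 1" by simp
    then show "norm x > R + 1 / real (Suc j)" using that by linarith
  qed
  have cc: "continuous_on UNIV (conv k (\<rho> j))" for j by (rule conv_continuous[OF lk M(7,3)])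
  have mc: "conv k (\<rho> j) \<in> borel_measurable lborel" for j
    using borel_measurable_continuous_onI[OF cc] by simp
  have mk: "k \<in> borel_measurable lborel" using borel_measurable_continuous_onI[OF k(1)] by simp
  have ma: "a \<in> borel_measurable lborel" using a by (simp add: loc_int_def)
  show "integrable lborel (\<lambda>x. a x * conv k (\<rho> j) x)"
    by (rule loc_int_integrable_mult(1)[OF a mc cB c0])
  show "integrable lborel (\<lambda>x. a x * k x)"
    by (rule loc_int_integrable_mult(1)[OF a mk _ k(2)]) (use B in simp)
  show "(\<lambda>j. LINT x|lborel. a x * conv k (\<rho> j) x) \<longlonglongrightarrow> (LINT x|lborel. a x * k x)"
  proof (rule integral_dominated_convergence[where w = "\<lambda>x. B * \<bar>indicator (cball 0 (R + 1)) x * a x\<bar>"])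
    show "integrable lborel (\<lambda>x. B * \<bar>indicator (cball 0 (R + 1)) x * a x\<bar>)"
      using a by (auto simp: loc_int_def)
    show "AE x in lborel. (\<lambda>j. a x * conv k (\<rho> j) x) \<longlonglongrightarrow> a x * k x"
      by (intro AE_I2 tendsto_intros conv_tendsto[OF k(1) \<rho>])
    show "AE x in lborel. norm (a x * conv k (\<rho> j) x) \<le> B * \<bar>indicator (cball 0 (R + 1)) x * a x\<bar>" for j
    proof (rule AE_I2)
      fix x
      show "norm (a x * conv k (\<rho> j) x) \<le> B * \<bar>indicator (cball 0 (R + 1)) x * a x\<bar>"
      proof (cases "norm x > R + 1")
        case True
        then show ?thesis using c0 B by simp
      next
        case False
        have "\<bar>a x\<bar> * \<bar>conv k (\<rho> j) x\<bar> \<le> \<bar>a x\<bar> * B" using cB by (intro mult_left_mono) auto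
        then show ?thesis using False by (simp add: abs_mult mult.commute)
      qed
    qed
  qed (use ma mc mk in auto)
qed

text \<open>Mollifying the test function makes it smooth and keeps it nonnegative, and the gradient
  of the mollification is the mollification of its gradient. Both sides of the inequality therefore
  pass to the limit.\<close>

lemma weak_inequality_C1c:
  fixes a :: "real^'n::finite \<Rightarrow> real^'n"
  assumes a: "\<And>i. loc_int (\<lambda>x. a x $ i)" and b: "loc_int b"
    and ineq: "\<And>\<phi>. test_fun \<phi> \<Longrightarrow> (\<And>x. \<phi> x \<ge> 0) \<Longrightarrow> (LINT x|lborel. a x \<bullet> grad \<phi> x) \<le> - (LINT x|lborel. b x * \<phi> x)"
    and \<phi>: "C1c \<phi> G" and nn: "\<And>x. \<phi> x \<ge> 0"
  shows "(LINT x|lborel. a x \<bullet> G x) \<le> - (LINT x|lborel. b x * \<phi> x)"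
    and "integrable lborel (\<lambda>x. a x \<bullet> G x)" and "integrable lborel (\<lambda>x. b x * \<phi> x)"
proof -
  obtain R where R: "\<And>x. (\<phi> has_derivative (\<lambda>h. G x \<bullet> h)) (at x)" "continuous_on UNIV G" "continuous_on UNIV \<phi>"
    "R \<ge> 0" "\<And>x. norm x > R \<Longrightarrow> \<phi> x = 0" "\<And>x. norm x > R \<Longrightarrow> G x = 0"
    by (rule C1cE[OF \<phi>]) (rule that; assumption)
  obtain \<rho> :: "nat \<Rightarrow> real^'n \<Rightarrow> real" where \<rho>: "\<And>j. mollifier (1 / real (Suc j)) (\<rho> j)"
    by (rule mollifier_sequence_exists) (rule that; assumption)
  note M = mollifierD[OF \<rho>]
  have l\<phi>: "loc_int \<phi>" by (rule continuous_imp_loc_int[OF R(3)])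
  have cG: "continuous_on UNIV (\<lambda>x. G x $ i)" for i by (intro continuous_intros R)
  have G0: "G x $ i = 0" if "norm x > R" for x i using R(6)[OF that] by simp
  have grad: "grad (conv \<phi> (\<rho> j)) x = (\<chi> i. conv (\<lambda>x. G x $ i) (\<rho> j) x)" for j x
    using has_derivative_imp_grad(2)[OF conv_has_derivative[OF l\<phi> M(6)], of j x]
      conv_weak_gradient[OF C1_has_weak_gradient[OF R(1,2)] \<rho>, of j _ x] by simp
  have le: "(LINT x|lborel. a x \<bullet> grad (conv \<phi> (\<rho> j)) x) \<le> - (LINT x|lborel. b x * conv \<phi> (\<rho> j) x)" for j
  proof (rule ineq)
    show "test_fun (conv \<phi> (\<rho> j))"
      by (rule test_funI[OF smooth_fun_conv[OF l\<phi> M(1,3)] conv_support[OF R(5) M(3)]])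
    show "conv \<phi> (\<rho> j) x \<ge> 0" for x
      unfolding conv_def using nn M(2) by (intro integral_nonneg_AE) auto
  qed
  note P = conv_pairing_tendsto[OF a cG G0 \<rho>]
  have e1: "(LINT x|lborel. a x \<bullet> grad (conv \<phi> (\<rho> j)) x) = (\<Sum>i\<in>UNIV. LINT x|lborel. a x $ i * conv (\<lambda>x. G x $ i) (\<rho> j) x)" for j
    unfolding grad inner_vec_def using P(2) by simp
  have e2: "(LINT x|lborel. a x \<bullet> G x) = (\<Sum>i\<in>UNIV. LINT x|lborel. a x $ i * G x $ i)"
    unfolding inner_vec_def using P(3) by simp
  show "integrable lborel (\<lambda>x. a x \<bullet> G x)" unfolding inner_vec_def using P(3) by simp
  show "integrable lborel (\<lambda>x. b x * \<phi> x)" by (rule conv_pairing_tendsto(3)[OF b R(3,5) \<rho>])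
  have l1: "(\<lambda>j. LINT x|lborel. a x \<bullet> grad (conv \<phi> (\<rho> j)) x) \<longlonglongrightarrow> (LINT x|lborel. a x \<bullet> G x)"
    unfolding e1 e2 by (intro tendsto_sum P(1))
  have l2: "(\<lambda>j. - (LINT x|lborel. b x * conv \<phi> (\<rho> j) x)) \<longlonglongrightarrow> - (LINT x|lborel. b x * \<phi> x)"
    by (intro tendsto_minus conv_pairing_tendsto(1)[OF b R(3,5) \<rho>])
  show "(LINT x|lborel. a x \<bullet> G x) \<le> - (LINT x|lborel. b x * \<phi> x)"
    by (rule LIMSEQ_le[OF l1 l2]) (use le in auto)
qed

section \<open>Radial functions\<close>

lemma continuous_on_radial:
  fixes k :: "real \<Rightarrow> real"
  assumes "continuous_on {0..} k"
  shows "continuous_on UNIV (\<lambda>x::'a::real_normed_vector. k (norm x))"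
  by (rule continuous_on_compose2[OF assms]) (auto intro!: continuous_intros)

lemma small_near_zero:
  fixes k :: "real \<Rightarrow> real"
  assumes "continuous_on {0..} k" "e > 0"
  obtains d where "d > 0" "\<And>r. 0 \<le> r \<Longrightarrow> r < d \<Longrightarrow> \<bar>k r - k 0\<bar> < e"
proof -
  obtain d where "d > 0" "\<forall>r\<in>{0..}. dist r 0 < d \<longrightarrow> dist (k r) (k 0) < e"
    using assms unfolding continuous_on_iff by (metis atLeast_iff order.refl)
  then show ?thesis using that[of d] by (simp add: dist_real_def)
qed

text \<open>A direction field discontinuous at the origin becomes continuous when multiplied by a
  modulus that vanishes there, as long as the field is bounded. It is applied to x/|x| and to x_i
  x/|x|^2.\<close>

lemma continuous_on_radial_direction:
  fixes q :: "real \<Rightarrow> real" and b :: "'a::real_inner \<Rightarrow> 'b::real_normed_vector"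
  assumes q: "continuous_on {0..} q" "q 0 = 0" and b: "continuous_on (- {0}) b" "\<And>x. norm (b x) \<le> 1"
  shows "continuous_on UNIV (\<lambda>x. q (norm x) *\<^sub>R b x)"
proof -
  have "continuous (at x) (\<lambda>x. q (norm x) *\<^sub>R b x)" for x
  proof (cases "x = 0")
    case False
    have "continuous_on (- {0}) (\<lambda>x. q (norm x) *\<^sub>R b x)"
      by (intro continuous_intros b continuous_on_subset[OF continuous_on_radial[OF q(1)]]) auto
    then show ?thesis using False by (simp add: continuous_on_eq_continuous_at open_Compl)
  next
    case True
    have "((\<lambda>x. q (norm x) *\<^sub>R b x) \<longlongrightarrow> 0) (at (0::'a))"
    proof (rule Lim_null_comparison)
      show "\<forall>\<^sub>F x in at 0. norm (q (norm x) *\<^sub>R b x) \<le> \<bar>q (norm x)\<bar>"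
        using b(2) by (auto intro!: always_eventually mult_left_le)
      have "continuous_on UNIV (\<lambda>x::'a. \<bar>q (norm x)\<bar>)"
        by (intro continuous_intros continuous_on_radial[OF q(1)])
      then have "continuous (at (0::'a)) (\<lambda>x. \<bar>q (norm x)\<bar>)"
        by (simp add: continuous_on_eq_continuous_at)
      then show "((\<lambda>x. \<bar>q (norm x)\<bar>) \<longlongrightarrow> 0) (at (0::'a))" using q(2) by (simp add: isCont_def)
    qed
    then show ?thesis using True q(2) by (simp add: isCont_def)
  qed
  then show ?thesis by (simp add: continuous_at_imp_continuous_on)
qed

lemma has_derivative_radial:
  fixes x :: "'a::real_inner"
  assumes "(k has_real_derivative k') (at (norm x))" "x \<noteq> 0"
  shows "((\<lambda>x. k (norm x)) has_derivative (\<lambda>h. (k' / norm x) * (x \<bullet> h))) (at x)"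
proof -
  have "((\<lambda>x. k (norm x)) has_derivative (\<lambda>h. k' * (h \<bullet> sgn x))) (at x)"
    using has_derivative_compose[OF has_derivative_norm[OF assms(2)] assms(1)[unfolded has_field_derivative_def]]
    by simp
  moreover have "(\<lambda>h. k' * (h \<bullet> sgn x)) = (\<lambda>h. (k' / norm x) * (x \<bullet> h))"
    by (auto simp: sgn_div_norm inner_commute divide_inverse)
  ultimately show ?thesis by simp
qed

lemma has_derivative_at_zeroI:
  fixes u :: "'a::real_normed_vector \<Rightarrow> real"
  assumes "bounded_linear L" "\<And>e. e > 0 \<Longrightarrow> \<exists>d>0. \<forall>x. norm x < d \<longrightarrow> \<bar>u x - u 0 - L x\<bar> \<le> e * norm x"
  shows "(u has_derivative L) (at 0)"
  unfolding has_derivative_at_alt using assms by simp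

text \<open>\<open>y 0 = 0\<close> is what removes the cone singularity at the centre. There
  division by zero yields the value 0, which is the correct gradient.\<close>

lemma radial_gradient:
  fixes v y :: "real \<Rightarrow> real" and x0 :: "real^'n::finite"
  assumes cy: "continuous_on {0..} y" and y0: "y 0 = 0" and v: "\<And>r. r \<ge> 0 \<Longrightarrow> v r = c + integral {0..r} y"
  defines "Du \<equiv> \<lambda>x. (y (norm (x - x0)) / norm (x - x0)) *\<^sub>R (x - x0)"
  shows "((\<lambda>x. v (norm (x - x0))) has_derivative (\<lambda>h. Du x \<bullet> h)) (at x)"
    and "continuous_on UNIV Du"
proof -
  define D where "D x = (y (norm x) / norm x) *\<^sub>R x" for x :: "real^'n"
  have Du: "Du = (\<lambda>x. D (x - x0))" by (simp add: Du_def D_def)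
  have D: "((\<lambda>x. v (norm x)) has_derivative (\<lambda>h. D x \<bullet> h)) (at x)" for x
  proof (cases "x = 0")
    case False
    have "(v has_real_derivative y (norm x)) (at (norm x))"
      by (rule primitive_has_real_derivative_at[OF cy _ v]) (use False in auto)
    from has_derivative_radial[OF this False] show ?thesis by (simp add: D_def)
  next
    case True
    have "((\<lambda>x. v (norm x)) has_derivative (\<lambda>h. 0)) (at (0::real^'n))"
    proof (rule has_derivative_at_zeroI)
      fix e :: real assume e: "e > 0"
      obtain d where d: "d > 0" "\<And>r. 0 \<le> r \<Longrightarrow> r < d \<Longrightarrow> \<bar>y r - y 0\<bar> < e"
        using small_near_zero[OF cy e] by blast
      have "\<bar>v r - v 0\<bar> \<le> e * r" if r: "0 \<le> r" "r < d" for r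
      proof -
        have "norm (integral {0..r} y) \<le> e * (r - 0)"
        proof (rule integral_bound[OF r(1)])
          show "continuous_on {0..r} y" by (rule continuous_on_subset[OF cy]) auto
          show "norm (y t) \<le> e" if "t \<in> {0..r}" for t using d(2)[of t] that r y0 by simp
        qed
        then show ?thesis using v[of r] v[of 0] r by simp
      qed
      then show "\<exists>d>0. \<forall>x::real^'n. norm x < d \<longrightarrow> \<bar>v (norm x) - v (norm (0::real^'n)) - 0\<bar> \<le> e * norm x"
        using d(1) by (intro exI[of _ d]) auto
    qed simp
    then show ?thesis using True by (simp add: D_def)
  qed
  have cD: "continuous_on UNIV D"
  proof -
    have "D = (\<lambda>x. y (norm x) *\<^sub>R (inverse (norm x) *\<^sub>R x))" by (auto simp: D_def divide_inverse)
    moreover have "continuous_on UNIV (\<lambda>x::real^'n. y (norm x) *\<^sub>R (inverse (norm x) *\<^sub>R x))"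
    proof (rule continuous_on_radial_direction[OF cy y0])
      show "norm (inverse (norm x) *\<^sub>R x) \<le> 1" for x :: "real^'n" by (cases "x = 0") auto
    qed (auto intro!: continuous_intros)
    ultimately show ?thesis by simp
  qed
  show "continuous_on UNIV Du" unfolding Du
    by (rule continuous_on_compose2[OF cD]) (auto intro!: continuous_intros)
  have "((\<lambda>x. x - x0) has_derivative (\<lambda>h. h)) (at x)" by (auto intro!: derivative_eq_intros)
  from has_derivative_compose[OF this D] show "((\<lambda>x. v (norm (x - x0))) has_derivative (\<lambda>h. Du x \<bullet> h)) (at x)"
    unfolding Du .
qed

text \<open>Written as \<kappa>(|x|) x, the field w(|x|) x/|x| has coordinates that are C^1 on the
  whole space, so integration by parts applies to each of them with no ball cut out around the
  origin. The trace of their gradients is n \<kappa> + q = h.\<close>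

lemma radial_divergence_aux:
  fixes h w :: "real \<Rightarrow> real" and \<phi> :: "real^'n::finite \<Rightarrow> real"
  assumes ch: "continuous_on {0..} h" and cw: "continuous_on {0..} w"
    and w: "\<And>r. r \<ge> 0 \<Longrightarrow> w r = integral {0..r} (\<lambda>s. s ^ (CARD('n) - 1) * h s) / r ^ (CARD('n) - 1)"
    and \<phi>: "C1c \<phi> G"
  shows "(LINT x|lborel. ((w (norm x) / norm x) *\<^sub>R x) \<bullet> G x) = - (LINT x|lborel. h (norm x) * \<phi> x)"
proof -
  obtain R where R: "\<And>x. (\<phi> has_derivative (\<lambda>h. G x \<bullet> h)) (at x)" "continuous_on UNIV G" "continuous_on UNIV \<phi>"
    "R \<ge> 0" "\<And>x. norm x > R \<Longrightarrow> \<phi> x = 0" "\<And>x. norm x > R \<Longrightarrow> G x = 0"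
    by (rule C1cE[OF \<phi>]) (rule that; assumption)
  define n where "n = real (CARD('n))"
  have n: "n > 0" "real (Suc (CARD('n) - 1)) = n" "real (CARD('n) - 1) = n - 1" by (auto simp: n_def)
  \<comment> \<open>The value at 0 is the limit of w(r)/r, so \<kappa> is continuous up to the
    centre.\<close>
  define \<kappa> where "\<kappa> r = (if r = 0 then h 0 / n else w r / r)" for r
  \<comment> \<open>For r > 0 this is r \<kappa>'(r). It vanishes at 0, which makes the gradients
    \<open>Gi\<close> continuous there although x_i x/|x|^2 is not.\<close>
  define q where "q r = h r - n * \<kappa> r" for r
  have c\<kappa>: "continuous_on {0..} \<kappa>"
    unfolding continuous_on_eq_continuous_within
  proof
    fix r :: real assume r: "r \<in> {0..}"
    show "continuous (at r within {0..}) \<kappa>"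
    proof (cases "r = 0")
      case True
      have "((\<lambda>r. w r / r) \<longlongrightarrow> h 0 / n) (at_right 0)"
        using radial_mean_div_tendsto[OF ch w] n by simp
      moreover have "\<forall>\<^sub>F r in at_right 0. w r / r = \<kappa> r"
        by (auto simp: eventually_at_filter \<kappa>_def)
      ultimately have "(\<kappa> \<longlongrightarrow> h 0 / n) (at_right 0)" by (rule Lim_transform_eventually)
      moreover have "at (0::real) within {0..} = at_right 0"
        by (metis Diff_cancel Diff_insert_absorb at_within_eq_bot_iff at_within_Ici_at_right)
      ultimately show ?thesis using True by (simp add: continuous_within \<kappa>_def)
    next
      case False
      then have r: "r > 0" using r by simp
      have "isCont w r" using continuous_on_interior[OF cw, of r] r by (simp add: interior_Ici)
      then have "isCont (\<lambda>r. w r / r) r" using r by (intro continuous_intros) auto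
      moreover have "\<forall>\<^sub>F s in nhds r. s \<in> {0<..}" by (rule eventually_nhds_in_open) (use r in auto)
      then have "\<forall>\<^sub>F s in nhds r. w s / s = \<kappa> s" by eventually_elim (auto simp: \<kappa>_def)
      ultimately have "isCont \<kappa> r" by (simp add: isCont_cong)
      then show ?thesis by (rule continuous_at_imp_continuous_at_within)
    qed
  qed
  have cq: "continuous_on {0..} q" unfolding q_def by (intro continuous_intros ch c\<kappa>)
  have q0: "q 0 = 0" using n(1) by (simp add: q_def \<kappa>_def)
  have d\<kappa>: "(\<kappa> has_real_derivative q r / r) (at r)" if "r > 0" for r
  proof -
    have "(w has_real_derivative h r - real (CARD('n) - 1) * (w r / r)) (at r)"
      by (rule radial_mean_has_derivative[OF ch w that])
    then have "((\<lambda>r. w r / r) has_real_derivative ((h r - (n - 1) * (w r / r)) * r - w r * 1) / (r * r)) (at r)"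
      using that unfolding n(3) by (intro DERIV_divide DERIV_ident) auto
    also have "((h r - (n - 1) * (w r / r)) * r - w r * 1) / (r * r) = q r / r"
      using that by (simp add: q_def \<kappa>_def field_simps)
    finally show ?thesis
      by (rule has_field_derivative_transform_within_open[where S = "{0<..}"]) (use that in \<open>auto simp: \<kappa>_def\<close>)
  qed
  define Gi where "Gi i x = \<kappa> (norm x) *\<^sub>R axis i 1 + q (norm x) *\<^sub>R ((x $ i / (norm x)\<^sup>2) *\<^sub>R x)" for i and x :: "real^'n"
  have dX: "((\<lambda>x. \<kappa> (norm x) * x $ i) has_derivative (\<lambda>h. Gi i x \<bullet> h)) (at x)" for i x
  proof (cases "x = 0")
    case False
    have d1: "((\<lambda>x. \<kappa> (norm x)) has_derivative (\<lambda>h. (q (norm x) / norm x / norm x) * (x \<bullet> h))) (at x)"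
      by (rule has_derivative_radial[OF d\<kappa> False]) (use False in simp)
    have d2: "((\<lambda>x. x $ i) has_derivative (\<lambda>h. h $ i)) (at x)"
      by (rule bounded_linear_imp_has_derivative[OF bounded_linear_vec_nth])
    show ?thesis
      by (rule has_derivative_eq_rhs[OF has_derivative_mult[OF d1 d2]])
        (auto simp: Gi_def fun_eq_iff inner_add_left inner_axis' power2_eq_square)
  next
    case True
    have "((\<lambda>x. \<kappa> (norm x) * x $ i) has_derivative (\<lambda>h. \<kappa> 0 * h $ i)) (at (0::real^'n))"
    proof (rule has_derivative_at_zeroI)
      show "bounded_linear (\<lambda>h::real^'n. \<kappa> 0 * h $ i)"
        by (intro bounded_linear_const_mult bounded_linear_vec_nth)
      fix e :: real assume e: "e > 0"
      obtain d where d: "d > 0" "\<And>r. 0 \<le> r \<Longrightarrow> r < d \<Longrightarrow> \<bar>\<kappa> r - \<kappa> 0\<bar> < e"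
        using small_near_zero[OF c\<kappa> e] by blast
      have "\<bar>\<kappa> (norm x) * x $ i - \<kappa> 0 * x $ i\<bar> \<le> e * norm x" if "norm x < d" for x :: "real^'n"
      proof -
        have "\<bar>\<kappa> (norm x) * x $ i - \<kappa> 0 * x $ i\<bar> = \<bar>\<kappa> (norm x) - \<kappa> 0\<bar> * \<bar>x $ i\<bar>"
          by (simp add: abs_mult flip: left_diff_distrib)
        also have "\<dots> \<le> e * norm x"
          using d(2)[of "norm x"] that component_le_norm_cart[of x i] e by (intro mult_mono) auto
        finally show ?thesis .
      qed
      then show "\<exists>d>0. \<forall>x::real^'n. norm x < d \<longrightarrow>
        \<bar>\<kappa> (norm x) * x $ i - \<kappa> (norm (0::real^'n)) * 0 $ i - \<kappa> 0 * x $ i\<bar> \<le> e * norm x"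
        using d(1) by (intro exI[of _ d]) auto
    qed
    then show ?thesis using True q0 by (simp add: Gi_def inner_axis')
  qed
  have cGi: "continuous_on UNIV (Gi i)" for i
  proof -
    have "norm ((x $ i / (norm x)\<^sup>2) *\<^sub>R x) \<le> 1" for x :: "real^'n"
    proof (cases "x = 0")
      case False
      have "\<bar>x $ i\<bar> * norm x \<le> norm x * norm x" using component_le_norm_cart[of x i] by (intro mult_right_mono) auto
      then show ?thesis using False by (simp add: power2_eq_square divide_le_eq)
    qed simp
    then have "continuous_on UNIV (\<lambda>x::real^'n. q (norm x) *\<^sub>R ((x $ i / (norm x)\<^sup>2) *\<^sub>R x))"
      by (intro continuous_on_radial_direction[OF cq q0]) (auto intro!: continuous_intros)
    then show ?thesis unfolding Gi_def 
      by (intro continuous_on_add continuous_on_scaleR[OF continuous_on_radial[OF c\<kappa>]] continuous_on_const)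
  qed
  note ibp = integration_by_parts_C1c[OF dX cGi \<phi>]
  have div: "(\<Sum>i\<in>UNIV. Gi i x \<bullet> axis i 1) = h (norm x)" for x
  proof -
    have "(\<Sum>i\<in>UNIV. Gi i x \<bullet> axis i 1) = (\<Sum>i\<in>(UNIV::'n set). \<kappa> (norm x) + q (norm x) * (x $ i * x $ i / (norm x)\<^sup>2))"
      by (simp add: Gi_def inner_add_left inner_axis inner_axis_axis mult.assoc)
    also have "\<dots> = n * \<kappa> (norm x) + q (norm x) * ((\<Sum>i\<in>UNIV. x $ i * x $ i) / (norm x)\<^sup>2)"
      by (simp add: sum.distrib n_def sum_distrib_left sum_divide_distrib)
    also have "(\<Sum>i\<in>UNIV. x $ i * x $ i) = (norm x)\<^sup>2"
      by (simp add: power2_norm_eq_inner inner_vec_def)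
    also have "n * \<kappa> (norm x) + q (norm x) * ((norm x)\<^sup>2 / (norm x)\<^sup>2) = h (norm x)"
      using q0 by (cases "x = 0") (auto simp: q_def)
    finally show ?thesis .
  qed
  have X: "((w (norm x) / norm x) *\<^sub>R x) \<bullet> G x = (\<Sum>i\<in>UNIV. (\<kappa> (norm x) * x $ i) * (G x \<bullet> axis i 1))" for x
  proof -
    have "G x \<bullet> axis i 1 = G x $ i" for i by (simp add: inner_axis)
    then show ?thesis by (cases "x = 0") (auto simp: \<kappa>_def inner_vec_def sum_distrib_left mult.assoc)
  qed
  have "(LINT x|lborel. ((w (norm x) / norm x) *\<^sub>R x) \<bullet> G x) = (\<Sum>i\<in>UNIV. LINT x|lborel. (\<kappa> (norm x) * x $ i) * (G x \<bullet> axis i 1))"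
    unfolding X using ibp(2) by (intro Bochner_Integration.integral_sum)
  also have "\<dots> = - (\<Sum>i\<in>UNIV. LINT x|lborel. \<phi> x * (Gi i x \<bullet> axis i 1))"
    unfolding ibp(1) by (rule sum_negf)
  also have "(\<Sum>i\<in>UNIV. LINT x|lborel. \<phi> x * (Gi i x \<bullet> axis i 1)) = (LINT x|lborel. (\<Sum>i\<in>UNIV. \<phi> x * (Gi i x \<bullet> axis i 1)))"
    using ibp(3) by (intro Bochner_Integration.integral_sum[symmetric])
  also have "(\<lambda>x. \<Sum>i\<in>UNIV. \<phi> x * (Gi i x \<bullet> axis i 1)) = (\<lambda>x. h (norm x) * \<phi> x)"
    by (simp add: div mult.commute flip: sum_distrib_left)
  finally show ?thesis .
qed


lemma C1c_translate:
  assumes "C1c \<phi> G"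
  shows "C1c (\<lambda>x. \<phi> (x + x0)) (\<lambda>x. G (x + x0))"
proof -
  obtain R where R: "\<And>x. (\<phi> has_derivative (\<lambda>h. G x \<bullet> h)) (at x)" "continuous_on UNIV G" "continuous_on UNIV \<phi>"
    "R \<ge> 0" "\<And>x. norm x > R \<Longrightarrow> \<phi> x = 0" "\<And>x. norm x > R \<Longrightarrow> G x = 0"
    by (rule C1cE[OF assms]) (rule that; assumption)
  show ?thesis
  proof (rule C1cI[where R = "R + norm x0"])
    fix x
    have "((\<lambda>x. x + x0) has_derivative (\<lambda>h. h)) (at x)" by (auto intro!: derivative_eq_intros)
    from has_derivative_compose[OF this R(1)]
    show "((\<lambda>x. \<phi> (x + x0)) has_derivative (\<lambda>h. G (x + x0) \<bullet> h)) (at x)" .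
    show "continuous_on UNIV (\<lambda>x. G (x + x0))"
      by (rule continuous_on_compose2[OF R(2)]) (auto intro!: continuous_intros)
    assume "norm x > R + norm x0"
    then show "\<phi> (x + x0) = 0" using norm_diff_ineq[of x x0] by (intro R(5)) simp
  qed
qed

lemma radial_field_continuous:
  fixes w :: "real \<Rightarrow> real"
  assumes "continuous_on {0..} w" "w 0 = 0"
  shows "continuous_on UNIV (\<lambda>x::'a::real_inner. (w (norm (x - x0)) / norm (x - x0)) *\<^sub>R (x - x0))"
proof -
  have "continuous_on UNIV (\<lambda>x::'a. w (norm x) *\<^sub>R (inverse (norm x) *\<^sub>R x))"
  proof (rule continuous_on_radial_direction[OF assms])
    show "norm (inverse (norm x) *\<^sub>R x) \<le> 1" for x :: 'a by (cases "x = 0") auto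
  qed (auto intro!: continuous_intros)
  then have "continuous_on UNIV (\<lambda>x::'a. (w (norm x) / norm x) *\<^sub>R x)" by (simp add: divide_inverse)
  moreover have "continuous_on UNIV (\<lambda>x::'a. x - x0)" by (intro continuous_intros)
  ultimately show ?thesis by (rule continuous_on_compose2) auto
qed

lemma radial_divergence:
  fixes h w :: "real \<Rightarrow> real" and \<phi> :: "real^'n::finite \<Rightarrow> real" and x0 :: "real^'n"
  assumes ch: "continuous_on {0..} h" and cw: "continuous_on {0..} w"
    and w: "\<And>r. r \<ge> 0 \<Longrightarrow> w r = integral {0..r} (\<lambda>s. s ^ (CARD('n) - 1) * h s) / r ^ (CARD('n) - 1)"
    and \<phi>: "C1c \<phi> G"
  shows "(LINT x|lborel. ((w (norm (x - x0)) / norm (x - x0)) *\<^sub>R (x - x0)) \<bullet> G x) = - (LINT x|lborel. h (norm (x - x0)) * \<phi> x)"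
    and "integrable lborel (\<lambda>x. ((w (norm (x - x0)) / norm (x - x0)) *\<^sub>R (x - x0)) \<bullet> G x)"
    and "integrable lborel (\<lambda>x. h (norm (x - x0)) * \<phi> x)"
proof -
  obtain R where R: "\<And>x. (\<phi> has_derivative (\<lambda>h. G x \<bullet> h)) (at x)" "continuous_on UNIV G" "continuous_on UNIV \<phi>"
    "R \<ge> 0" "\<And>x. norm x > R \<Longrightarrow> \<phi> x = 0" "\<And>x. norm x > R \<Longrightarrow> G x = 0"
    by (rule C1cE[OF \<phi>]) (rule that; assumption)
  have w0: "w 0 = 0" using w[of 0] by simp
  have cX: "continuous_on UNIV (\<lambda>x. (w (norm (x - x0)) / norm (x - x0)) *\<^sub>R (x - x0))"
    by (rule radial_field_continuous[OF cw w0])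
  have ch0: "continuous_on UNIV (\<lambda>x. h (norm (x - x0)))"
    by (rule continuous_on_compose2[OF ch]) (auto intro!: continuous_intros)
  show "integrable lborel (\<lambda>x. ((w (norm (x - x0)) / norm (x - x0)) *\<^sub>R (x - x0)) \<bullet> G x)"
    by (rule continuous_integrable_lborel[OF continuous_on_inner[OF cX R(2)], of R]) (simp add: R(6))
  show "integrable lborel (\<lambda>x. h (norm (x - x0)) * \<phi> x)"
    by (rule continuous_integrable_lborel[of _ R]) (use R in \<open>auto intro!: continuous_on_mult ch0\<close>)
  define k1 where "k1 x = ((w (norm x) / norm x) *\<^sub>R x) \<bullet> G (x + x0)" for x
  define k2 where "k2 x = h (norm x) * \<phi> (x + x0)" for x
  note T = C1c_translate[OF \<phi>, of x0]
  have eq: "(LINT x|lborel. k1 x) = - (LINT x|lborel. k2 x)"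
    unfolding k1_def k2_def by (rule radial_divergence_aux[OF ch cw w T])
  have "continuous_on UNIV k1"
    unfolding k1_def using radial_field_continuous[OF cw w0, of 0]
    by (intro continuous_on_inner continuous_on_compose2[OF R(2)]) (auto intro!: continuous_intros)
  then have m1: "k1 \<in> borel_measurable borel" by (rule borel_measurable_continuous_onI)
  have "continuous_on UNIV k2"
    unfolding k2_def
    by (intro continuous_on_mult continuous_on_radial[OF ch] continuous_on_compose2[OF R(3)]) (auto intro!: continuous_intros)
  then have m2: "k2 \<in> borel_measurable borel" by (rule borel_measurable_continuous_onI)
  show "(LINT x|lborel. ((w (norm (x - x0)) / norm (x - x0)) *\<^sub>R (x - x0)) \<bullet> G x) = - (LINT x|lborel. h (norm (x - x0)) * \<phi> x)"
    using integral_lborel_translate(1)[OF m1, of x0] integral_lborel_translate(1)[OF m2, of x0] eq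
    by (simp add: k1_def k2_def)
qed

text \<open>w was chosen as the flux variable so that |D|^(p-2) D is w(|x|) x/|x|. At zeros of w or
  of x both sides vanish, through \<open>0 powr _\<close> = 0 and division by zero, even when p <
  2.\<close>

lemma radial_flux:
  fixes x :: "'a::real_normed_vector"
  assumes p: "1 < p" and w: "w (norm x) \<ge> 0" and w0: "w 0 = 0"
  defines "D \<equiv> (pinv p (w (norm x)) / norm x) *\<^sub>R x"
  shows "norm D powr (p - 2) *\<^sub>R D = (w (norm x) / norm x) *\<^sub>R x" and "norm D = pinv p (w (norm x))"
proof -
  show n: "norm D = pinv p (w (norm x))"
    unfolding D_def using w0 by (cases "x = 0") (auto simp: pinv_0 pinv_nonneg)
  have "pinv p (w (norm x)) powr (p - 2) * pinv p (w (norm x)) = w (norm x)"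
  proof (cases "w (norm x) = 0")
    case True
    then show ?thesis by (simp add: pinv_0)
  next
    case False
    then have pos: "pinv p (w (norm x)) > 0" using pinv_strict_mono[OF p, of 0 "w (norm x)"] w by (simp add: pinv_0)
    then have "pinv p (w (norm x)) powr (p - 2) * pinv p (w (norm x)) = pinv p (w (norm x)) powr (p - 2) * pinv p (w (norm x)) powr 1"
      by simp
    also have "\<dots> = pinv p (w (norm x)) powr (p - 1)" by (simp only: powr_add[symmetric]) simp
    finally show ?thesis using powr_pinv[OF p w] by simp
  qed
  then show "norm D powr (p - 2) *\<^sub>R D = (w (norm x) / norm x) *\<^sub>R x"
    unfolding n by (simp add: D_def)
qed

lemma continuous_Lp_loc:
  fixes u :: "real^'n::finite \<Rightarrow> real"
  assumes "continuous_on UNIV u" "p > 0"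
  shows "Lp_loc p u"
  unfolding Lp_loc_def
proof (intro conjI allI impI)
  show "u \<in> borel_measurable lborel" using assms by (simp add: borel_measurable_continuous_onI)
  fix K :: "(real^'n) set" assume K: "compact K"
  have c: "continuous_on UNIV (\<lambda>x. \<bar>u x\<bar> powr p)"
    by (intro continuous_on_powr' continuous_intros assms) (use assms in auto)
  show "set_integrable lborel K (\<lambda>x. \<bar>u x\<bar> powr p)"
    unfolding set_integrable_def by (intro borel_integrable_compact K continuous_on_subset[OF c]) auto
qed

text \<open>The divergence identity is an equality for test functions of either sign, so the sub-
  and the supersolution inequality come from the same computation.\<close>

lemma radial_weak_solution:
  fixes f g v w :: "real \<Rightarrow> real"
  assumes p: "1 < p"
    and f: "continuous_on {0..} f" and g: "continuous_on {0..} g"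
    and s0: "s0 > 0" and cv: "continuous_on {0..} v" and cw: "continuous_on {0..} w"
    and v: "\<And>r. r \<ge> 0 \<Longrightarrow> v r = s0 + integral {0..r} (\<lambda>s. pinv p (w s))"
    and w: "\<And>r. r \<ge> 0 \<Longrightarrow> w r = integral {0..r} (\<lambda>s. s ^ (CARD('n) - 1) * (f (v s) + g (pinv p (w s)))) / r ^ (CARD('n) - 1)"
    and w0: "\<And>r. r \<ge> 0 \<Longrightarrow> 0 \<le> w r" and vs: "\<And>r. r \<ge> 0 \<Longrightarrow> s0 \<le> v r"
  shows "\<exists>(u :: real^'n::finite \<Rightarrow> real) Du. weak_solution p f g u Du \<and> (\<forall>x. u x > 0)"
proof -
  define u where "u x = v (norm x)" for x :: "real^'n"
  define Du where "Du x = (pinv p (w (norm x)) / norm x) *\<^sub>R x" for x :: "real^'n"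
  define h where "h r = f (v r) + g (pinv p (w r))" for r
  have wz: "w 0 = 0" using w[of 0] by simp
  have cy: "continuous_on {0..} (\<lambda>s. pinv p (w s))"
    by (rule continuous_on_compose2[OF continuous_on_pinv[OF p] cw]) auto
  have y0: "pinv p (w 0) = 0" by (simp add: wz pinv_0)
  have ch: "continuous_on {0..} h"
    unfolding h_def
  proof (intro continuous_on_add)
    have "v r \<ge> 0" if "r \<ge> 0" for r using vs[OF that] s0 by simp
    then show "continuous_on {0..} (\<lambda>r. f (v r))" by (intro continuous_on_compose2[OF f cv]) auto
    show "continuous_on {0..} (\<lambda>r. g (pinv p (w r)))"
      by (intro continuous_on_compose2[OF g cy]) (auto simp: pinv_nonneg)
  qed
  have der: "(u has_derivative (\<lambda>h. Du x \<bullet> h)) (at x)" and cDu: "continuous_on UNIV Du" for x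
    using radial_gradient[OF cy y0 v, where ?x0.0 = "0::real^'n"]
    unfolding u_def[abs_def] Du_def[abs_def] by simp_all
  have cu: "continuous_on UNIV u"
    unfolding u_def by (rule continuous_on_radial[OF cv])
  have W: "W1p_loc p u Du"
    unfolding W1p_loc_def
    using p by (intro conjI continuous_Lp_loc cu continuous_on_norm cDu C1_has_weak_gradient[OF der cDu]) auto
  have lhs: "plap_lhs p Du \<phi> x = ((w (norm (x - 0)) / norm (x - 0)) *\<^sub>R (x - 0)) \<bullet> grad \<phi> x"
    and rhs: "plap_rhs f g u Du \<phi> x = h (norm (x - 0)) * \<phi> x" for \<phi> x
    using radial_flux[where w = w and x = x, OF p w0[OF norm_ge_zero] wz, folded Du_def]
    by (simp_all add: plap_lhs_def plap_rhs_def u_def h_def flip: inner_scaleR_left)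
  have "integrable lborel (plap_lhs p Du \<phi>) \<and> integrable lborel (plap_rhs f g u Du \<phi>) \<and>
    (LINT x|lborel. plap_lhs p Du \<phi> x) = - (LINT x|lborel. plap_rhs f g u Du \<phi> x)" if t: "test_fun \<phi>" for \<phi>
  proof -
    obtain R where R: "\<And>x. norm x > R \<Longrightarrow> \<phi> x = 0" using test_fun_support[OF t] by blast
    have C: "C1c \<phi> (grad \<phi>)" using t R by (intro smooth_fun_imp_C1c) (auto simp: test_fun_def)
    have e1: "plap_lhs p Du \<phi> = (\<lambda>x. ((w (norm (x - 0)) / norm (x - 0)) *\<^sub>R (x - 0)) \<bullet> grad \<phi> x)"
      and e2: "plap_rhs f g u Du \<phi> = (\<lambda>x. h (norm (x - 0)) * \<phi> x)"
      using lhs rhs by (auto simp only: fun_eq_iff)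
    show ?thesis unfolding e1 e2
      using radial_divergence[OF ch cw w[folded h_def] C, of 0] by blast
  qed
  then have "weak_solution p f g u Du"
    unfolding weak_solution_def weak_subsolution_def weak_supersolution_def using W by simp
  moreover have "u x > 0" for x using vs[of "norm x"] s0 by (simp add: u_def)
  ultimately show ?thesis by blast
qed

section \<open>Mollification of locally bounded functions\<close>

lemma bounded_imp_loc_int:
  fixes u :: "'a::euclidean_space \<Rightarrow> real"
  assumes m: "u \<in> borel_measurable lborel" and bd: "\<And>R. \<exists>C. AE x in lborel. norm x \<le> R \<longrightarrow> \<bar>u x\<bar> \<le> C"
  shows "loc_int u"
  unfolding loc_int_def
proof (intro conjI allI m)
  fix R
  obtain C where C: "AE x in lborel. norm x \<le> R \<longrightarrow> \<bar>u x\<bar> \<le> C" using bd by blast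
  have "integrable lborel (\<lambda>x::'a. indicator (cball 0 R) x * C)"
    using continuous_imp_loc_int[OF continuous_on_const, of C] unfolding loc_int_def by blast
  then show "integrable lborel (\<lambda>x. indicator (cball 0 R) x * u x)"
  proof (rule Bochner_Integration.integrable_bound)
    show "(\<lambda>x. indicator (cball 0 R) x * u x) \<in> borel_measurable lborel"
      using m by (intro borel_measurable_times borel_measurable_indicator) auto
    show "AE x in lborel. norm (indicator (cball 0 R) x * u x) \<le> norm (indicator (cball 0 R) x * C)"
      using C by eventually_elim (auto simp: indicator_def)
  qed
qed

lemma conv_le:
  fixes k :: "real^'n::finite \<Rightarrow> real"
  assumes k: "loc_int k" and \<rho>: "mollifier d \<rho>" and c: "AE y in lborel. dist y x \<le> d \<longrightarrow> k y \<le> c"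
  shows "conv k \<rho> x \<le> c"
proof -
  note M = mollifierD[OF \<rho>]
  have "conv k \<rho> x \<le> (LINT y|lborel. c * \<rho> (x - y))"
    unfolding conv_def
  proof (rule integral_mono_AE)
    show "integrable lborel (\<lambda>y. k y * \<rho> (x - y))" by (rule conv_integrable[OF k M(7,3)])
    show "integrable lborel (\<lambda>y. c * \<rho> (x - y))" using M(11)[of x] by simp
    show "AE y in lborel. k y * \<rho> (x - y) \<le> c * \<rho> (x - y)"
      using c
    proof eventually_elim
      case (elim y)
      show ?case
      proof (cases "dist y x \<le> d")
        case True
        then show ?thesis using elim M(2)[of "x - y"] by (simp add: mult_right_mono)
      next
        case False
        then have "\<rho> (x - y) = 0" by (intro M(3)) (simp add: dist_norm norm_minus_commute)
        then show ?thesis by simp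
      qed
    qed
  qed
  also have "\<dots> = c" using M(9)[of x] by simp
  finally show ?thesis .
qed

text \<open>The sum over the finite index i converges to zero in L1, so one subsequence converges
  almost everywhere for all i together; this is how u and every component of its gradient are
  treated at once. The parameter \<open>r0\<close> permits refining a subsequence already
  chosen.\<close>

lemma mollification_AE_subseq:
  fixes k :: "'i::finite \<Rightarrow> real^'n::finite \<Rightarrow> real"
  assumes k: "\<And>i. k i \<in> borel_measurable lborel" "\<And>i R. \<exists>C. AE x in lborel. norm x \<le> R \<longrightarrow> \<bar>k i x\<bar> \<le> C"
    and \<rho>: "\<And>j. mollifier (1 / real (Suc j)) (\<rho> j)" and r0: "strict_mono (r0 :: nat \<Rightarrow> nat)"
  obtains r where "strict_mono (r :: nat \<Rightarrow> nat)"
    "AE x in lborel. norm x \<le> R \<longrightarrow> (\<forall>i. (\<lambda>j. conv (k i) (\<rho> (r0 (r j))) x) \<longlonglongrightarrow> k i x)"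
proof -
  let ?I = "\<lambda>x. indicator (cball (0::real^'n) R) x :: real"
  have lk: "loc_int (k i)" for i by (rule bounded_imp_loc_int[OF k])
  define T where "T j x = (\<Sum>i\<in>UNIV. \<bar>?I x * (conv (k i) (\<rho> (r0 j)) x - k i x)\<bar>)" for j x
  have it: "integrable lborel (\<lambda>x. \<bar>?I x * (conv (k i) (\<rho> j) x - k i x)\<bar>)" for i j
  proof -
    have "loc_int (conv (k i) (\<rho> j))"
      by (intro continuous_imp_loc_int conv_continuous[OF lk mollifierD(7,3)[OF \<rho>]])
    from loc_int_diff[OF this lk] show ?thesis by (auto simp: loc_int_def)
  qed
  have lim: "(\<lambda>j. LINT x|lborel. \<bar>?I x * (conv (k i) (\<rho> j) x - k i x)\<bar>) \<longlonglongrightarrow> 0" for i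
    unfolding LIMSEQ_iff
  proof (intro allI impI)
    fix e :: real assume e: "e > 0"
    obtain C where C: "AE x in lborel. norm x \<le> R + 1 \<longrightarrow> \<bar>k i x\<bar> \<le> C" using k(2) by blast
    obtain d0 where d0: "d0 > 0" "\<And>d \<rho>. d \<le> d0 \<Longrightarrow> mollifier d \<rho> \<Longrightarrow>
      (LINT x|lborel. \<bar>?I x * (conv (k i) \<rho> x - k i x)\<bar>) < e"
      using mollification_L1_convergence[OF lk C e] by blast
    obtain N where N: "1 / real (Suc N) < d0" using nat_approx_posE[OF d0(1)] by auto
    show "\<exists>N. \<forall>j\<ge>N. norm ((LINT x|lborel. \<bar>?I x * (conv (k i) (\<rho> j) x - k i x)\<bar>) - 0) < e"
    proof (intro exI[of _ N] allI impI)
      fix j assume j: "j \<ge> N"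
      then have "1 / real (Suc j) \<le> 1 / real (Suc N)" by (simp add: frac_le)
      then have "1 / real (Suc j) \<le> d0" using N by linarith
      then have "(LINT x|lborel. \<bar>?I x * (conv (k i) (\<rho> j) x - k i x)\<bar>) < e" by (rule d0(2)[OF _ \<rho>])
      moreover have "0 \<le> (LINT x|lborel. \<bar>?I x * (conv (k i) (\<rho> j) x - k i x)\<bar>)" by (intro integral_nonneg_AE) auto
      ultimately show "norm ((LINT x|lborel. \<bar>?I x * (conv (k i) (\<rho> j) x - k i x)\<bar>) - 0) < e" by simp
    qed
  qed
  have T0: "T j x \<ge> 0" for j x by (auto simp: T_def intro: sum_nonneg)
  have "(\<lambda>j. LINT x|lborel. norm (T j x)) \<longlonglongrightarrow> 0"
  proof -
    have "(\<lambda>j. \<Sum>i\<in>UNIV. LINT x|lborel. \<bar>?I x * (conv (k i) (\<rho> (r0 j)) x - k i x)\<bar>) \<longlonglongrightarrow> (\<Sum>i\<in>(UNIV::'i set). 0)"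
      by (intro tendsto_sum LIMSEQ_subseq_LIMSEQ[OF lim r0, unfolded comp_def])
    moreover have "(\<Sum>i\<in>UNIV. LINT x|lborel. \<bar>?I x * (conv (k i) (\<rho> (r0 j)) x - k i x)\<bar>) = (LINT x|lborel. norm (T j x))" for j
    proof -
      have "(LINT x|lborel. norm (T j x)) = (LINT x|lborel. T j x)" using T0 by simp
      also have "\<dots> = (\<Sum>i\<in>UNIV. LINT x|lborel. \<bar>?I x * (conv (k i) (\<rho> (r0 j)) x - k i x)\<bar>)"
        unfolding T_def using it by (intro Bochner_Integration.integral_sum)
      finally show ?thesis by simp
    qed
    ultimately show ?thesis by simp
  qed
  moreover have "integrable lborel (T j)" for j
    unfolding T_def using it by (intro Bochner_Integration.integrable_sum)
  ultimately obtain r where r: "strict_mono r" "AE x in lborel. (\<lambda>j. T (r j) x) \<longlonglongrightarrow> 0"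
    using tendsto_L1_AE_subseq[of lborel T] by blast
  show ?thesis
  proof (rule that[OF r(1)])
    show "AE x in lborel. norm x \<le> R \<longrightarrow> (\<forall>i. (\<lambda>j. conv (k i) (\<rho> (r0 (r j))) x) \<longlonglongrightarrow> k i x)"
      using r(2)
    proof (eventually_elim, intro impI allI)
      fix x i assume l: "(\<lambda>j. T (r j) x) \<longlonglongrightarrow> 0" and x: "norm x \<le> R"
      have "\<bar>conv (k i) (\<rho> (r0 (r j))) x - k i x\<bar> \<le> T (r j) x" for j
      proof -
        have "\<bar>?I x * (conv (k i) (\<rho> (r0 (r j))) x - k i x)\<bar> \<le> T (r j) x"
          unfolding T_def by (rule member_le_sum) auto
        then show ?thesis using x by simp
      qed
      then have "(\<lambda>j. conv (k i) (\<rho> (r0 (r j))) x - k i x) \<longlonglongrightarrow> 0"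
        by (intro Lim_null_comparison[OF _ l]) auto
      then show "(\<lambda>j. conv (k i) (\<rho> (r0 (r j))) x) \<longlonglongrightarrow> k i x" by (simp add: LIM_zero_iff)
    qed
  qed
qed

section \<open>Comparison with radial supersolutions\<close>

definition flux :: "real \<Rightarrow> 'a::real_inner \<Rightarrow> 'a" where
  "flux p \<xi> = norm \<xi> powr (p - 2) *\<^sub>R \<xi>"

lemma norm_powr_mult:
  fixes \<xi> :: "'a::real_normed_vector"
  shows "norm \<xi> powr (p - 2) * norm \<xi> = norm \<xi> powr (p - 1)"
proof (cases "\<xi> = 0")
  case False
  have "norm \<xi> powr (p - 2) * norm \<xi> = norm \<xi> powr (p - 2) * norm \<xi> powr 1" using False by simp
  also have "\<dots> = norm \<xi> powr (p - 1)" by (simp only: powr_add[symmetric]) simp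
  finally show ?thesis .
qed simp

text \<open>For p < 2 the factor |\<xi>|^(p-2) is singular at 0; regrouping as |\<xi>|^(p-1) times a
  unit direction shows continuity.\<close>

lemma continuous_on_flux:
  assumes "1 < p"
  shows "continuous_on UNIV (flux p :: 'a::real_inner \<Rightarrow> 'a)"
proof -
  have "continuous_on UNIV (\<lambda>\<xi>::'a. norm \<xi> powr (p - 1) *\<^sub>R (inverse (norm \<xi>) *\<^sub>R \<xi>))"
  proof (rule continuous_on_radial_direction)
    show "continuous_on {0..} (\<lambda>r::real. r powr (p - 1))"
      by (intro continuous_on_powr' continuous_intros) (use assms in auto)
    show "norm (inverse (norm x) *\<^sub>R x) \<le> 1" for x :: 'a by (cases "x = 0") auto
  qed (auto intro!: continuous_intros)
  moreover have "norm \<xi> powr (p - 1) *\<^sub>R (inverse (norm \<xi>) *\<^sub>R \<xi>) = flux p \<xi>" for \<xi> :: 'a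
    unfolding norm_powr_mult[symmetric] by (cases "\<xi> = 0") (auto simp: flux_def)
  ultimately show ?thesis by simp
qed

text \<open>For different norms a and b, Cauchy-Schwarz reduces the claim to (a^(p-1) - b^(p-1)) (a
  - b) > 0. For equal norms the two weights coincide and the product is a positive multiple of
  |\<xi> - \<zeta>|^2.\<close>

lemma flux_strictly_monotone:
  fixes \<xi> \<zeta> :: "'a::real_inner"
  assumes p: "1 < p" and ne: "\<xi> \<noteq> \<zeta>"
  shows "(flux p \<xi> - flux p \<zeta>) \<bullet> (\<xi> - \<zeta>) > 0"
proof -
  define a b A B where "a = norm \<xi>" and "b = norm \<zeta>" and "A = norm \<xi> powr (p - 2)" and "B = norm \<zeta> powr (p - 2)"
  have eq: "(flux p \<xi> - flux p \<zeta>) \<bullet> (\<xi> - \<zeta>) = A * a\<^sup>2 + B * b\<^sup>2 - (A + B) * (\<xi> \<bullet> \<zeta>)"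
    by (simp add: flux_def A_def B_def a_def b_def power2_norm_eq_inner algebra_simps inner_commute)
  show ?thesis
  proof (cases "a = b")
    case False
    have Aa: "A * a = a powr (p - 1)" "B * b = b powr (p - 1)"
      using norm_powr_mult[of \<xi> p] norm_powr_mult[of \<zeta> p] by (auto simp: A_def a_def B_def b_def)
    have "(A + B) * (\<xi> \<bullet> \<zeta>) \<le> (A + B) * (a * b)"
      using norm_cauchy_schwarz[of \<xi> \<zeta>] by (intro mult_left_mono) (auto simp: a_def b_def A_def B_def)
    moreover have "A * a\<^sup>2 + B * b\<^sup>2 - (A + B) * (a * b) = (A * a - B * b) * (a - b)"
      by (simp add: algebra_simps power2_eq_square)
    moreover have "(A * a - B * b) * (a - b) > 0"
    proof (cases "a < b")
      case True
      then have "a powr (p - 1) < b powr (p - 1)" using p by (intro powr_less_mono2) (auto simp: a_def)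
      then show ?thesis unfolding Aa using True by (intro mult_neg_neg) auto
    next
      case F: False
      then have "b < a" using False by simp
      then have "b powr (p - 1) < a powr (p - 1)" using p by (intro powr_less_mono2) (auto simp: b_def)
      then show ?thesis unfolding Aa using \<open>b < a\<close> by (intro mult_pos_pos) auto
    qed
    ultimately show ?thesis unfolding eq by linarith
  next
    case True
    then have AB: "A = B" by (simp add: A_def B_def a_def b_def)
    have "a > 0"
    proof (rule ccontr)
      assume "\<not> a > 0"
      then show False using True ne by (simp add: a_def b_def)
    qed
    then have "A > 0" by (simp add: A_def a_def)
    have "A * a\<^sup>2 + B * b\<^sup>2 - (A + B) * (\<xi> \<bullet> \<zeta>) = A * ((\<xi> - \<zeta>) \<bullet> (\<xi> - \<zeta>))"
      by (simp add: AB[symmetric] a_def b_def power2_norm_eq_inner algebra_simps inner_commute)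
    also have "\<dots> > 0" using \<open>A > 0\<close> ne by simp
    finally show ?thesis unfolding eq .
  qed
qed

text \<open>Strict monotonicity and compactness replace the usual quantitative estimates for the \<open>p\<close>-Laplacian.\<close>

lemma flux_absorbs_linear:
  fixes p L T c :: real
  assumes p: "1 < p" and L: "L \<ge> 0" and T: "T \<ge> 0" and c: "c > 0"
  obtains \<eta> where "\<eta> > 0" "\<And>s \<xi> \<zeta> :: 'a::euclidean_space. 0 \<le> s \<Longrightarrow> s \<le> \<eta> \<Longrightarrow> norm \<xi> \<le> T \<Longrightarrow> norm \<zeta> \<le> T \<Longrightarrow>
    L * norm (\<xi> - \<zeta>) * s \<le> 2 * ((flux p \<xi> - flux p \<zeta>) \<bullet> (\<xi> - \<zeta>)) + c / 2 * s"
proof -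
  let ?A = "\<lambda>z::'a \<times> 'a. (flux p (fst z) - flux p (snd z)) \<bullet> (fst z - snd z)"
  \<comment> \<open>Pairs for which the linear term is not already covered by c/2. They stay off the
    diagonal, so the flux product has a positive minimum \<alpha> on this compact set.\<close>
  define S where "S = (cball 0 T \<times> cball 0 T) \<inter> (\<lambda>z::'a \<times> 'a. L * norm (fst z - snd z)) -` {c / 2..}"
  have "closed ((\<lambda>z::'a \<times> 'a. L * norm (fst z - snd z)) -` {c / 2..})"
    by (intro closed_vimage continuous_intros)
  then have cS: "compact S" unfolding S_def by (intro compact_Int_closed compact_Times compact_cball)
  have cA: "continuous_on S ?A"
    by (intro continuous_intros continuous_on_compose2[OF continuous_on_flux[OF p]]) auto
  have pos: "?A z > 0" if "z \<in> S" for z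
  proof -
    have "L * norm (fst z - snd z) > 0" using that c by (auto simp: S_def)
    then have "fst z \<noteq> snd z" by auto
    then show ?thesis by (rule flux_strictly_monotone[OF p])
  qed
  have nn: "?A z \<ge> 0" for z
    using flux_strictly_monotone[OF p, of "fst z" "snd z"] by (cases "fst z = snd z") auto
  obtain \<alpha> where \<alpha>: "\<alpha> > 0" "\<And>z. z \<in> S \<Longrightarrow> \<alpha> \<le> ?A z"
  proof (cases "S = {}")
    case True
    then show ?thesis using that[of 1] by simp
  next
    case False
    obtain z where z: "z \<in> S" "\<And>z'. z' \<in> S \<Longrightarrow> ?A z \<le> ?A z'"
      using continuous_attains_inf[OF cS False cA] by blast
    show ?thesis by (rule that[of "?A z"]) (use z pos in auto)
  qed
  \<comment> \<open>|\<xi> - \<zeta>| <= 2 T, so this makes L |\<xi> - \<zeta>| s at most 2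
    \<alpha>; the + 1 keeps the denominator positive.\<close>
  define \<eta> where "\<eta> = \<alpha> / (L * T + 1)"
  have LT: "L * T + 1 > 0" using L T by (simp add: add_nonneg_pos)
  have \<eta>: "\<eta> > 0" using \<alpha> LT by (simp add: \<eta>_def)
  show ?thesis
  proof (rule that[OF \<eta>])
    fix s and \<xi> \<zeta> :: 'a assume s: "0 \<le> s" "s \<le> \<eta>" and b: "norm \<xi> \<le> T" "norm \<zeta> \<le> T"
    show "L * norm (\<xi> - \<zeta>) * s \<le> 2 * ((flux p \<xi> - flux p \<zeta>) \<bullet> (\<xi> - \<zeta>)) + c / 2 * s"
    proof (cases "L * norm (\<xi> - \<zeta>) \<ge> c / 2")
      case True
      then have "(\<xi>, \<zeta>) \<in> S" using b by (simp add: S_def)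
      then have A: "\<alpha> \<le> (flux p \<xi> - flux p \<zeta>) \<bullet> (\<xi> - \<zeta>)" using \<alpha>(2)[of "(\<xi>, \<zeta>)"] by simp
      have "norm (\<xi> - \<zeta>) \<le> 2 * T" using norm_triangle_ineq4[of \<xi> \<zeta>] b by linarith
      then have "L * norm (\<xi> - \<zeta>) * s \<le> L * (2 * T) * \<eta>"
        using s L T by (intro mult_mono) auto
      also have "\<dots> = 2 * (L * T * \<eta>)" by simp
      also have "L * T * \<eta> \<le> (L * T + 1) * \<eta>" using \<eta> by (intro mult_right_mono) auto
      also have "(L * T + 1) * \<eta> = \<alpha>" using LT by (simp add: \<eta>_def)
      finally have "L * norm (\<xi> - \<zeta>) * s \<le> 2 * \<alpha>" by simp
      moreover have "c / 2 * s \<ge> 0" using c s by simp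
      ultimately show ?thesis using A by linarith
    next
      case False
      then have "L * norm (\<xi> - \<zeta>) * s \<le> c / 2 * s" using s by (intro mult_right_mono) auto
      then show ?thesis using nn[of "(\<xi>, \<zeta>)"] by simp
    qed
  qed
qed

lemma has_real_derivative_pos_square: "((\<lambda>s::real. (max 0 s)\<^sup>2) has_real_derivative 2 * max 0 s) (at s)"
proof -
  consider "s > 0" | "s < 0" | "s = 0" by linarith
  then show ?thesis
  proof cases
    case 1
    have "((\<lambda>s::real. s\<^sup>2) has_real_derivative 2 * max 0 s) (at s)" using 1 by (auto intro!: derivative_eq_intros)
    then show ?thesis
      by (rule has_field_derivative_transform_within_open[where S = "{0<..}"]) (use 1 in auto)
  next
    case 2
    have "((\<lambda>s::real. 0) has_real_derivative 2 * max 0 s) (at s)" using 2 by auto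
    then show ?thesis
      by (rule has_field_derivative_transform_within_open[where S = "{..<0}"]) (use 2 in auto)
  next
    case 3
    have "((\<lambda>s::real. (max 0 s)\<^sup>2) has_real_derivative 0) (at s)"
    proof (rule has_real_derivative_zeroI[where C = 1])
      show "\<bar>(max 0 y)\<^sup>2\<bar> \<le> 1 * (y - s)\<^sup>2" for y using 3 by (simp add: max_def)
    qed
    then show ?thesis using 3 by simp
  qed
qed

text \<open>Multiplying by the indicator of the ball is harmless because the positive part already
  vanishes on the annulus between R1 and R2: on the overlap of the ball and the exterior of the
  smaller one, both descriptions of the function agree.\<close>

lemma C1c_pos_square:
  fixes W :: "real^'n::finite \<Rightarrow> real"
  assumes D: "\<And>x. (W has_derivative (\<lambda>h. GW x \<bullet> h)) (at x)" and cG: "continuous_on UNIV GW"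
    and bd: "\<And>x. R1 \<le> dist x x0 \<Longrightarrow> dist x x0 \<le> R2 \<Longrightarrow> W x \<le> k" and R: "R1 < R2"
  shows "C1c (\<lambda>x. indicator (ball x0 R2) x * (max 0 (W x - k))\<^sup>2)
             (\<lambda>x. indicator (ball x0 R2) x *\<^sub>R ((2 * max 0 (W x - k)) *\<^sub>R (GW x)))"
proof -
  define \<phi> where "\<phi> x = indicator (ball x0 R2) x * (max 0 (W x - k))\<^sup>2" for x
  define G where "G x = indicator (ball x0 R2) x *\<^sub>R ((2 * max 0 (W x - k)) *\<^sub>R (GW x))" for x
  have cW: "continuous_on UNIV W"
    using D by (meson continuous_at_imp_continuous_on has_derivative_continuous)
  let ?\<psi> = "\<lambda>x. (max 0 (W x - k))\<^sup>2"
  let ?G = "\<lambda>x. (2 * max 0 (W x - k)) *\<^sub>R (GW x)"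
  have D\<psi>: "(?\<psi> has_derivative (\<lambda>h. ?G x \<bullet> h)) (at x)" for x
  proof -
    have "((\<lambda>x. W x - k) has_derivative (\<lambda>h. GW x \<bullet> h)) (at x)"
      using has_derivative_diff[OF D has_derivative_const[of k]] by simp
    from has_derivative_compose[OF this has_real_derivative_pos_square[unfolded has_field_derivative_def]]
    show ?thesis by simp
  qed
  have c\<psi>G: "continuous_on UNIV ?G" by (intro continuous_intros cW cG)
  have out: "\<phi> x = 0 \<and> G x = 0" if "dist x x0 > R1" for x
  proof (cases "dist x x0 < R2")
    case True
    then have "W x \<le> k" using bd[of x] that by simp
    then show ?thesis by (simp add: \<phi>_def G_def)
  qed (simp add: \<phi>_def G_def dist_commute)
  have ins: "\<phi> x = ?\<psi> x \<and> G x = ?G x" if "dist x x0 < R2" for x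
    using that by (simp add: \<phi>_def G_def dist_commute)
  have oin: "open (ball x0 R2)" and oout: "open (- cball x0 R1)" by auto
  have "C1c \<phi> G"
  proof (rule C1cI[where R = "norm x0 + R1"])
    fix x
    show "(\<phi> has_derivative (\<lambda>h. G x \<bullet> h)) (at x)"
    proof (cases "dist x x0 < R2")
      case True
      have "(\<phi> has_derivative (\<lambda>h. ?G x \<bullet> h)) (at x)"
        by (rule has_derivative_transform_within_open[OF D\<psi> oin]) (use True ins in \<open>auto simp: dist_commute\<close>)
      then show ?thesis using ins[OF True] by simp
    next
      case False
      then have x: "dist x x0 > R1" using R by simp
      have "((\<lambda>_. 0) has_derivative (\<lambda>_. 0)) (at x)" by simp
      then have "(\<phi> has_derivative (\<lambda>_. 0)) (at x)"
        by (rule has_derivative_transform_within_open[OF _ oout]) (use x out in \<open>auto simp: dist_commute\<close>)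
      then show ?thesis using out[OF x] by simp
    qed
  next
    have "isCont G x" for x
    proof (cases "dist x x0 < R2")
      case True
      have "\<forall>\<^sub>F y in nhds x. y \<in> ball x0 R2" by (rule eventually_nhds_in_open[OF oin]) (use True in \<open>simp add: dist_commute\<close>)
      then have "\<forall>\<^sub>F y in nhds x. G y = ?G y" by eventually_elim (use ins in \<open>auto simp: dist_commute\<close>)
      moreover have "isCont ?G x" using c\<psi>G by (simp add: continuous_on_eq_continuous_at)
      ultimately show ?thesis using isCont_cong[of G ?G x] by simp
    next
      case False
      have "\<forall>\<^sub>F y in nhds x. y \<in> - cball x0 R1" by (rule eventually_nhds_in_open[OF oout]) (use False R in \<open>simp add: dist_commute\<close>)
      then have "\<forall>\<^sub>F y in nhds x. G y = 0" by eventually_elim (use out in \<open>auto simp: dist_commute\<close>)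
      then show ?thesis using isCont_cong[of G "\<lambda>_. 0" x] by simp
    qed
    then show "continuous_on UNIV G" by (simp add: continuous_at_imp_continuous_on)
  next
    fix x :: "real^'n" assume "norm x > norm x0 + R1"
    then have "dist x x0 > R1" using norm_triangle_ineq2[of x x0] by (simp add: dist_norm)
    then show "\<phi> x = 0" using out by simp
  qed
  then show ?thesis unfolding \<phi>_def[abs_def] G_def[abs_def] .
qed

text \<open>Jensen's inequality for the norm, obtained by pairing the averaged vector G with itself:
  |G|^2 is the average of the products of \<open>Du y\<close> with G, which are at most K |G|. A
  componentwise estimate would lose a factor depending on the dimension.\<close>

lemma norm_conv_vector_le:
  fixes Du :: "real^'n::finite \<Rightarrow> real^'n"
  assumes l: "\<And>i. loc_int (\<lambda>y. Du y $ i)" and \<rho>: "mollifier d \<rho>"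
    and b: "AE y in lborel. dist y x \<le> d \<longrightarrow> norm (Du y) \<le> K"
  shows "norm (\<chi> i. conv (\<lambda>y. Du y $ i) \<rho> x) \<le> K"
proof -
  note M = mollifierD[OF \<rho>]
  have i: "integrable lborel (\<lambda>y. Du y $ i * \<rho> (x - y))" for i by (rule conv_integrable[OF l M(7,3)])
  define G where "G = (\<chi> i. conv (\<lambda>y. Du y $ i) \<rho> x)"
  have eq: "(Du y \<bullet> G) * \<rho> (x - y) = (\<Sum>i\<in>UNIV. G $ i * (Du y $ i * \<rho> (x - y)))" for y
    by (simp add: inner_vec_def sum_distrib_left sum_distrib_right mult_ac)
  have ii: "integrable lborel (\<lambda>y. (Du y \<bullet> G) * \<rho> (x - y))"
    unfolding eq using i by simp
  have "G \<bullet> G = (\<Sum>i\<in>UNIV. G $ i * (LINT y|lborel. Du y $ i * \<rho> (x - y)))"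
    by (simp add: inner_vec_def G_def conv_def)
  also have "\<dots> = (LINT y|lborel. (Du y \<bullet> G) * \<rho> (x - y))"
    unfolding eq using i by simp
  also have "\<dots> \<le> (LINT y|lborel. (K * norm G) * \<rho> (x - y))"
  proof (rule integral_mono_AE[OF ii])
    show "integrable lborel (\<lambda>y. (K * norm G) * \<rho> (x - y))" using M(11)[of x] by simp
    show "AE y in lborel. (Du y \<bullet> G) * \<rho> (x - y) \<le> (K * norm G) * \<rho> (x - y)"
      using b
    proof eventually_elim
      case (elim y)
      show ?case
      proof (cases "dist y x \<le> d")
        case True
        have "Du y \<bullet> G \<le> norm (Du y) * norm G" by (rule norm_cauchy_schwarz)
        also have "\<dots> \<le> K * norm G" using elim True by (intro mult_right_mono) auto
        finally show ?thesis using M(2)[of "x - y"] by (intro mult_right_mono)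
      next
        case False
        then have "\<rho> (x - y) = 0" by (intro M(3)) (simp add: dist_norm norm_minus_commute)
        then show ?thesis by simp
      qed
    qed
  qed
  also have "\<dots> = K * norm G" using M(9)[of x] by simp
  finally have "norm G * norm G \<le> K * norm G" by (simp add: power2_norm_eq_inner[symmetric] power2_eq_square)
  show ?thesis
  proof (cases "G = 0")
    case True
    \<comment> \<open>For G = 0 the claim is K >= 0. A negative K could bound a norm at no y in the
      support of the kernel, against its unit mass.\<close>
    have "0 \<le> K"
    proof (rule ccontr)
      assume "\<not> 0 \<le> K"
      then have "AE y in lborel. \<not> dist y x \<le> d" using b by (auto elim!: eventually_mono) (meson norm_ge_zero order_trans)
      then have "AE y in lborel. \<rho> (x - y) = 0"
        by eventually_elim (auto intro!: M(3) simp: dist_norm norm_minus_commute)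
      then have "(LINT y|lborel. \<rho> (x - y)) = 0" by (rule integral_eq_zero_AE)
      then show False using M(9)[of x] by simp
    qed
    then show ?thesis using True by (simp add: G_def)
  next
    case False
    then show ?thesis using \<open>norm G * norm G \<le> K * norm G\<close> by (simp add: G_def)
  qed
qed

text \<open>Subtracting the two weak inequalities for the test function (U j - V - (Mj j -
  \<eta>))_+^2 gives an integral \<open>J j\<close> of nonpositive value. Its flux part pairs the
  flux of Du with the mollified gradient and has no sign; in the limit it becomes the monotone
  product, and the integrand is at least (c/2) s^2. Hence s vanishes almost everywhere on the
  ball.\<close>

lemma comparison_limit:
  fixes u V b bV :: "real^'n::finite \<Rightarrow> real" and Du DV :: "real^'n \<Rightarrow> real^'n"
    and U :: "nat \<Rightarrow> real^'n \<Rightarrow> real" and GU :: "nat \<Rightarrow> real^'n \<Rightarrow> real^'n" and Mj :: "nat \<Rightarrow> real"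
  assumes p: "1 < p" and c: "c > 0"
    and sub: "\<And>\<phi> G. C1c \<phi> G \<Longrightarrow> (\<And>x. \<phi> x \<ge> 0) \<Longrightarrow> integrable lborel (\<lambda>x. flux p (Du x) \<bullet> G x) \<and>
      integrable lborel (\<lambda>x. b x * \<phi> x) \<and> (LINT x|lborel. flux p (Du x) \<bullet> G x) \<le> - (LINT x|lborel. b x * \<phi> x)"
    and super: "\<And>\<phi> G. C1c \<phi> G \<Longrightarrow> (\<And>x. \<phi> x \<ge> 0) \<Longrightarrow> integrable lborel (\<lambda>x. flux p (DV x) \<bullet> G x) \<and>
      integrable lborel (\<lambda>x. bV x * \<phi> x) \<and> (LINT x|lborel. flux p (DV x) \<bullet> G x) \<ge> - (LINT x|lborel. bV x * \<phi> x)"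
    and C1: "\<And>j. C1c (\<lambda>x. indicator (ball x0 \<rho>) x * (max 0 (U j x - V x - (Mj j - \<eta>)))\<^sup>2)
      (\<lambda>x. indicator (ball x0 \<rho>) x *\<^sub>R ((2 * max 0 (U j x - V x - (Mj j - \<eta>))) *\<^sub>R (GU j x - DV x)))"
    and meas: "u \<in> borel_measurable lborel" "V \<in> borel_measurable lborel" "b \<in> borel_measurable lborel" "bV \<in> borel_measurable lborel"
      "Du \<in> borel_measurable lborel" "DV \<in> borel_measurable lborel"
    and bdd: "AE x in lborel. x \<in> ball x0 \<rho> \<longrightarrow> norm (Du x) \<le> T \<and> \<bar>b x\<bar> \<le> B"
    and bddV: "\<And>x. x \<in> ball x0 \<rho> \<Longrightarrow> norm (DV x) \<le> T \<and> \<bar>bV x\<bar> \<le> B"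
    and bddU: "\<And>j x. x \<in> ball x0 \<rho> \<Longrightarrow> norm (GU j x) \<le> T \<and> U j x - V x \<le> Mj j"
    and conv: "AE x in lborel. x \<in> ball x0 \<rho> \<longrightarrow> (\<lambda>j. U j x) \<longlonglongrightarrow> u x \<and> (\<lambda>j. GU j x) \<longlonglongrightarrow> Du x"
    and M: "Mj \<longlonglongrightarrow> M" and \<eta>: "\<eta> > 0"
    and absorb: "\<And>s \<xi> \<zeta> :: real^'n. 0 \<le> s \<Longrightarrow> s \<le> \<eta> \<Longrightarrow> norm \<xi> \<le> T \<Longrightarrow> norm \<zeta> \<le> T \<Longrightarrow>
      L * norm (\<xi> - \<zeta>) * s \<le> 2 * ((flux p \<xi> - flux p \<zeta>) \<bullet> (\<xi> - \<zeta>)) + c / 2 * s"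
    and gap: "AE x in lborel. x \<in> ball x0 \<rho> \<and> u x - V x > M - \<eta> \<longrightarrow> b x - bV x \<ge> c - L * norm (Du x - DV x)"
  shows "AE x in lborel. x \<in> ball x0 \<rho> \<longrightarrow> u x - V x \<le> M - \<eta>"
proof -
  let ?I = "\<lambda>x. indicator (ball x0 \<rho>) x :: real"
  define sj where "sj j x = max 0 (U j x - V x - (Mj j - \<eta>))" for j x
  define s where "s x = max 0 (u x - V x - (M - \<eta>))" for x
  define \<phi> where "\<phi> j x = ?I x * (sj j x)\<^sup>2" for j x
  define G where "G j x = ?I x *\<^sub>R ((2 * sj j x) *\<^sub>R (GU j x - DV x))" for j x
  have C1': "C1c (\<phi> j) (G j)" for j using C1[of j] unfolding \<phi>_def[abs_def] G_def[abs_def] sj_def[abs_def] .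
  have \<phi>nn: "\<phi> j x \<ge> 0" for j x by (simp add: \<phi>_def)
  define J where "J j x = (flux p (Du x) - flux p (DV x)) \<bullet> G j x + (b x - bV x) * \<phi> j x" for j x
  define Jl where "Jl x = ?I x * ((2 * s x) * ((flux p (Du x) - flux p (DV x)) \<bullet> (Du x - DV x)) + (b x - bV x) * (s x)\<^sup>2)" for x
  note S = sub[OF C1' \<phi>nn] and S' = super[OF C1' \<phi>nn]
  have iJ: "integrable lborel (J j)" for j
    unfolding J_def inner_diff_left left_diff_distrib using S[of j] S'[of j]
    by (intro Bochner_Integration.integrable_add Bochner_Integration.integrable_diff) auto
  have JI: "(LINT x|lborel. J j x) \<le> 0" for j
  proof -
    have "(LINT x|lborel. J j x) = ((LINT x|lborel. flux p (Du x) \<bullet> G j x) - (LINT x|lborel. flux p (DV x) \<bullet> G j x))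
      + ((LINT x|lborel. b x * \<phi> j x) - (LINT x|lborel. bV x * \<phi> j x))"
      unfolding J_def inner_diff_left left_diff_distrib using S[of j] S'[of j]
      by (simp add: Bochner_Integration.integral_add Bochner_Integration.integral_diff)
    then show ?thesis using S[of j] S'[of j] by linarith
  qed
  have mf: "flux p \<in> borel_measurable (borel :: (real^'n) measure)"
    by (intro borel_measurable_continuous_onI continuous_on_flux p)
  have mfD: "(\<lambda>x. flux p (Du x)) \<in> borel_measurable lborel" "(\<lambda>x. flux p (DV x)) \<in> borel_measurable lborel"
    using measurable_compose[OF meas(5) mf] measurable_compose[OF meas(6) mf] by auto
  have mI: "(\<lambda>x. ?I x) \<in> borel_measurable lborel" by (intro borel_measurable_indicator) auto
  have ms: "s \<in> borel_measurable lborel" unfolding s_def using meas by auto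
  have mJl: "Jl \<in> borel_measurable lborel"
    unfolding Jl_def using mfD meas ms mI by (intro borel_measurable_times borel_measurable_add borel_measurable_inner
      borel_measurable_diff borel_measurable_power borel_measurable_const) auto
  have sj\<eta>: "sj j x \<le> \<eta>" "0 \<le> sj j x" if "x \<in> ball x0 \<rho>" for j x
    using bddU[OF that, of j] \<eta> by (auto simp: sj_def)
  obtain Fl where Fl: "Fl \<ge> 0" "\<And>\<xi> :: real^'n. norm \<xi> \<le> T \<Longrightarrow> norm (flux p \<xi>) \<le> Fl"
  proof -
    have "bounded (flux p ` cball (0::real^'n) T)"
      by (intro compact_imp_bounded compact_continuous_image continuous_on_subset[OF continuous_on_flux[OF p]]) auto
    then obtain F where F: "\<forall>y\<in>flux p ` cball (0::real^'n) T. norm y \<le> F" unfolding bounded_iff by blast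
    show ?thesis
    proof (rule that[of "max 0 F"])
      fix \<xi> :: "real^'n" assume "norm \<xi> \<le> T"
      then have "norm (flux p \<xi>) \<le> F" using F by simp
      then show "norm (flux p \<xi>) \<le> max 0 F" by simp
    qed simp
  qed
  \<comment> \<open>Bound for \<open>J j\<close> on the ball: flux difference 2 Fl, test gradient 2
    \<eta> times 2 T, source difference 2 B, squared test value \<eta>^2.\<close>
  define Q where "Q = (2 * Fl) * (2 * \<eta> * (2 * T)) + 2 * B * \<eta>\<^sup>2"
  have lim: "(\<lambda>j. LINT x|lborel. J j x) \<longlonglongrightarrow> (LINT x|lborel. Jl x)" and iJl: "integrable lborel Jl"
  proof -
    have iw: "integrable lborel (\<lambda>x. ?I x * Q)"
    proof -
      have "emeasure lborel (ball x0 \<rho>) < \<infinity>" using emeasure_bounded_finite[OF bounded_ball] by (auto simp: less_top)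
      then show ?thesis by (intro integrable_mult_left) (auto simp: integrable_indicator_iff)
    qed
    have ae: "AE x in lborel. (\<lambda>j. J j x) \<longlonglongrightarrow> Jl x"
      using conv
    proof eventually_elim
      case (elim x)
      show ?case
      proof (cases "x \<in> ball x0 \<rho>")
        case True
        have "(\<lambda>j. sj j x) \<longlonglongrightarrow> s x"
          unfolding sj_def s_def using elim True M by (intro tendsto_intros) auto
        then have "(\<lambda>j. (flux p (Du x) - flux p (DV x)) \<bullet> (?I x *\<^sub>R ((2 * sj j x) *\<^sub>R (GU j x - DV x))) + (b x - bV x) * (?I x * (sj j x)\<^sup>2))
          \<longlonglongrightarrow> (flux p (Du x) - flux p (DV x)) \<bullet> (?I x *\<^sub>R ((2 * s x) *\<^sub>R (Du x - DV x))) + (b x - bV x) * (?I x * (s x)\<^sup>2)"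
          using elim True by (intro tendsto_intros) auto
        moreover have "(flux p (Du x) - flux p (DV x)) \<bullet> (?I x *\<^sub>R ((2 * s x) *\<^sub>R (Du x - DV x))) + (b x - bV x) * (?I x * (s x)\<^sup>2) = Jl x"
          using True by (simp add: Jl_def)
        ultimately show ?thesis unfolding J_def G_def \<phi>_def by simp
      next
        case False
        then have "J j x = 0" for j by (simp add: J_def G_def \<phi>_def)
        moreover have "Jl x = 0" using False by (simp add: Jl_def)
        ultimately show ?thesis by simp
      qed
    qed
    have dom: "AE x in lborel. norm (J j x) \<le> ?I x * Q" for j
      using bdd
    proof eventually_elim
      case (elim x)
      show ?case
      proof (cases "x \<in> ball x0 \<rho>")
        case True
        note bV' = bddV[OF True] and bU = bddU[OF True, of j] and sj = sj\<eta>[OF True, of j]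
        have D: "norm (Du x) \<le> T" "\<bar>b x\<bar> \<le> B" using elim True by auto
        have n1: "norm (flux p (Du x) - flux p (DV x)) \<le> 2 * Fl"
          using norm_triangle_ineq4[of "flux p (Du x)" "flux p (DV x)"] Fl(2)[OF D(1)] Fl(2)[of "DV x"] bV' by linarith
        have n2: "norm (GU j x - DV x) \<le> 2 * T"
          using norm_triangle_ineq4[of "GU j x" "DV x"] bU bV' by linarith
        have "norm (G j x) = 2 * sj j x * norm (GU j x - DV x)" using True sj by (simp add: G_def)
        also have "\<dots> \<le> 2 * \<eta> * (2 * T)" using sj n2 \<eta> by (intro mult_mono) auto
        finally have n3: "norm (G j x) \<le> 2 * \<eta> * (2 * T)" .
        have "\<bar>(flux p (Du x) - flux p (DV x)) \<bullet> G j x\<bar> \<le> norm (flux p (Du x) - flux p (DV x)) * norm (G j x)"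
          by (rule Cauchy_Schwarz_ineq2)
        also have "\<dots> \<le> (2 * Fl) * (2 * \<eta> * (2 * T))" using n1 n3 Fl(1) by (intro mult_mono) auto
        finally have t1: "\<bar>(flux p (Du x) - flux p (DV x)) \<bullet> G j x\<bar> \<le> (2 * Fl) * (2 * \<eta> * (2 * T))" .
        have "\<bar>(b x - bV x) * \<phi> j x\<bar> = \<bar>b x - bV x\<bar> * (sj j x)\<^sup>2" using True by (simp add: \<phi>_def abs_mult)
        also have "\<dots> \<le> (2 * B) * \<eta>\<^sup>2" using D(2) bV' sj by (intro mult_mono power_mono) auto
        finally have t2: "\<bar>(b x - bV x) * \<phi> j x\<bar> \<le> 2 * B * \<eta>\<^sup>2" .
        have "\<bar>J j x\<bar> \<le> Q" using t1 t2 unfolding J_def Q_def by linarith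
        then show ?thesis using True by simp
      next
        case False
        then show ?thesis by (simp add: J_def G_def \<phi>_def)
      qed
    qed
    show "(\<lambda>j. LINT x|lborel. J j x) \<longlonglongrightarrow> (LINT x|lborel. Jl x)"
      by (rule integral_dominated_convergence[OF mJl _ iw ae dom]) (use iJ in auto)
    show "integrable lborel Jl"
      by (rule integrable_dominated_convergence[OF mJl _ iw ae dom]) (use iJ in auto)
  qed
  have le0: "(LINT x|lborel. Jl x) \<le> 0"
    using LIMSEQ_le_const2[OF lim] JI by blast
  \<comment> \<open>Where s > 0, \<open>gap\<close> provides c s^2 at the price of L |Du - DV| s^2;
    \<open>absorb\<close>, multiplied once more by s, covers this price by the flux term and half of
    c s^2.\<close>
  have lower: "AE x in lborel. Jl x \<ge> ?I x * (c / 2 * (s x)\<^sup>2)"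
    using conv bdd gap
  proof eventually_elim
    case (elim x)
    show ?case
    proof (cases "x \<in> ball x0 \<rho>")
      case True
      \<comment> \<open>\<open>absorb\<close> is valid only for s <= \<eta>. The bound U j - V <= Mj
        j survives the limit and guarantees it.\<close>
      have s\<eta>: "s x \<le> \<eta>"
      proof -
        have "u x - V x \<le> M"
          by (rule LIMSEQ_le[of "\<lambda>j. U j x - V x" _ Mj]) (use elim True M bddU in \<open>auto intro!: tendsto_intros\<close>)
        then show ?thesis using \<eta> by (simp add: s_def)
      qed
      have s0: "s x \<ge> 0" by (simp add: s_def)
      show ?thesis
      proof (cases "s x = 0")
        case False
        then have "u x - V x > M - \<eta>" by (auto simp: s_def max_def split: if_splits)
        then have g: "b x - bV x \<ge> c - L * norm (Du x - DV x)" using elim True by blast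
        have "L * norm (Du x - DV x) * s x \<le> 2 * ((flux p (Du x) - flux p (DV x)) \<bullet> (Du x - DV x)) + c / 2 * s x"
          by (rule absorb[OF s0 s\<eta>]) (use elim True bddV in auto)
        then have "L * norm (Du x - DV x) * s x * s x \<le> (2 * ((flux p (Du x) - flux p (DV x)) \<bullet> (Du x - DV x)) + c / 2 * s x) * s x"
          using s0 by (intro mult_right_mono)
        moreover have "(c - L * norm (Du x - DV x)) * (s x)\<^sup>2 \<le> (b x - bV x) * (s x)\<^sup>2"
          using g by (intro mult_right_mono) auto
        ultimately have "c / 2 * (s x)\<^sup>2 \<le> (2 * s x) * ((flux p (Du x) - flux p (DV x)) \<bullet> (Du x - DV x)) + (b x - bV x) * (s x)\<^sup>2"
          by (simp add: algebra_simps power2_eq_square)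
        then show ?thesis using True by (simp add: Jl_def)
      qed (simp add: Jl_def)
    next
      case False
      then show ?thesis by (simp add: Jl_def)
    qed
  qed
  have nn: "AE x in lborel. 0 \<le> Jl x"
    using lower
  proof eventually_elim
    case (elim x)
    have "0 \<le> ?I x * (c / 2 * (s x)\<^sup>2)" using c by simp
    then show ?case using elim by linarith
  qed
  have "(LINT x|lborel. Jl x) \<ge> 0" using nn by (rule integral_nonneg_AE)
  then have "(LINT x|lborel. Jl x) = 0" using le0 by simp
  then have "AE x in lborel. Jl x = 0" using integral_nonneg_eq_0_iff_AE[OF iJl nn] by blast
  then show ?thesis
    using lower
  proof eventually_elim
    case (elim x)
    show ?case
    proof
      assume "x \<in> ball x0 \<rho>"
      then have "c / 2 * (s x)\<^sup>2 \<le> 0" using elim by simp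
      then have "s x = 0" using c by (simp add: mult_le_0_iff)
      then show "u x - V x \<le> M - \<eta>" by (simp add: s_def max_def split: if_splits)
    qed
  qed
qed

section \<open>Vanishing of nonnegative subsolutions\<close>

lemma W1inf_locD:
  assumes "W1inf_loc u Du"
  shows "u \<in> borel_measurable lborel" "Du \<in> borel_measurable lborel" "has_weak_gradient u Du"
    and "\<exists>C. AE x in lborel. norm x \<le> R \<longrightarrow> \<bar>u x\<bar> \<le> C" "\<exists>C. AE x in lborel. norm x \<le> R \<longrightarrow> norm (Du x) \<le> C"
proof -
  show "u \<in> borel_measurable lborel" "Du \<in> borel_measurable lborel" "has_weak_gradient u Du"
    using assms by (auto simp: W1inf_loc_def Linf_loc_def has_weak_gradient_def)
  have "\<exists>C. AE x in lborel. x \<in> cball 0 R \<longrightarrow> \<bar>u x\<bar> \<le> C" "\<exists>C. AE x in lborel. x \<in> cball 0 R \<longrightarrow> \<bar>norm (Du x)\<bar> \<le> C"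
    using assms unfolding W1inf_loc_def Linf_loc_def by (meson compact_cball)+
  then show "\<exists>C. AE x in lborel. norm x \<le> R \<longrightarrow> \<bar>u x\<bar> \<le> C" "\<exists>C. AE x in lborel. norm x \<le> R \<longrightarrow> norm (Du x) \<le> C"
    by simp_all
qed

text \<open>u is nonnegative only almost everywhere and f is controlled only on [0, \<infinity>), so
  \<open>max 0 (u x)\<close> is inserted: this changes the source on a null set and makes it
  measurable and locally bounded, as the passage to C^1 test functions requires.\<close>

lemma subsolution_C1c:
  fixes u :: "real^'n::finite \<Rightarrow> real"
  assumes p: "1 < p" and f: "continuous_on {0..} f" and g: "continuous_on {0..} g"
    and W: "W1inf_loc u Du" and u0: "AE x in lborel. u x \<ge> 0" and sub: "weak_subsolution p f g u Du"
  defines "b \<equiv> \<lambda>x. f (max 0 (u x)) + g (norm (Du x))"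
  shows "b \<in> borel_measurable lborel" and "\<exists>B. AE x in lborel. norm x \<le> R \<longrightarrow> \<bar>b x\<bar> \<le> B"
    and "C1c \<phi> G \<Longrightarrow> (\<And>x. \<phi> x \<ge> 0) \<Longrightarrow> integrable lborel (\<lambda>x. flux p (Du x) \<bullet> G x) \<and>
      integrable lborel (\<lambda>x. b x * \<phi> x) \<and> (LINT x|lborel. flux p (Du x) \<bullet> G x) \<le> - (LINT x|lborel. b x * \<phi> x)"
proof -
  note mu = W1inf_locD(1)[OF W] and mD = W1inf_locD(2)[OF W] and bu = W1inf_locD(4)[OF W] and bD = W1inf_locD(5)[OF W]
  have cf: "continuous_on UNIV (\<lambda>t. f (max 0 t))" and cg: "continuous_on UNIV (\<lambda>t. g (max 0 t))"
    by (intro continuous_on_compose2[OF f] continuous_on_compose2[OF g] continuous_intros; auto)+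
  have b_alt: "b = (\<lambda>x. f (max 0 (u x)) + g (max 0 (norm (Du x))))" by (simp add: b_def)
  have mD': "(\<lambda>x. norm (Du x)) \<in> borel_measurable lborel" using mD by simp
  show mb: "b \<in> borel_measurable lborel"
    unfolding b_alt
    by (intro borel_measurable_add measurable_compose[OF mu borel_measurable_continuous_onI[OF cf]]
        measurable_compose[OF mD' borel_measurable_continuous_onI[OF cg]])
  show bb: "\<exists>B. AE x in lborel. norm x \<le> R \<longrightarrow> \<bar>b x\<bar> \<le> B" for R
  proof -
    obtain C1 where C1: "AE x in lborel. norm x \<le> R \<longrightarrow> \<bar>u x\<bar> \<le> C1" using bu by blast
    obtain C2 where C2: "AE x in lborel. norm x \<le> R \<longrightarrow> norm (Du x) \<le> C2" using bD by blast
    have "bounded ((\<lambda>t. f (max 0 t)) ` {-C1..C1})" "bounded ((\<lambda>t. g (max 0 t)) ` {-C2..C2})"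
      by (intro compact_imp_bounded compact_continuous_image continuous_on_subset[OF cf] continuous_on_subset[OF cg]; simp)+
    then obtain B1 B2 where "\<forall>y\<in>(\<lambda>t. f (max 0 t)) ` {-C1..C1}. norm y \<le> B1"
      "\<forall>y\<in>(\<lambda>t. g (max 0 t)) ` {-C2..C2}. norm y \<le> B2"
      unfolding bounded_iff by blast
    then have B1: "\<And>t. t \<in> {-C1..C1} \<Longrightarrow> \<bar>f (max 0 t)\<bar> \<le> B1" and B2: "\<And>t. t \<in> {-C2..C2} \<Longrightarrow> \<bar>g (max 0 t)\<bar> \<le> B2"
      by (simp_all only: ball_simps real_norm_def)
    have "AE x in lborel. norm x \<le> R \<longrightarrow> \<bar>b x\<bar> \<le> B1 + B2"
      using C1 C2
    proof eventually_elim
      case (elim x)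
      show ?case
      proof
        assume x: "norm x \<le> R"
        then have "\<bar>u x\<bar> \<le> C1" "norm (Du x) \<le> C2" using elim by auto
        then have "u x \<in> {-C1..C1}" "norm (Du x) \<in> {-C2..C2}"
          using norm_ge_zero[of "Du x"] unfolding atLeastAtMost_iff by linarith+
        then have "\<bar>f (max 0 (u x))\<bar> \<le> B1" "\<bar>g (max 0 (norm (Du x)))\<bar> \<le> B2" using B1 B2 by blast+
        then show "\<bar>b x\<bar> \<le> B1 + B2" unfolding b_alt by linarith
      qed
    qed
    then show ?thesis by blast
  qed
  have lb: "loc_int b" by (rule bounded_imp_loc_int[OF mb bb])
  have la: "loc_int (\<lambda>x. flux p (Du x) $ i)" for i
  proof (rule bounded_imp_loc_int)
    have "(\<lambda>x. flux p (Du x)) \<in> borel_measurable lborel"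
      by (rule measurable_compose[OF mD borel_measurable_continuous_onI[OF continuous_on_flux[OF p]]])
    then have "(\<lambda>x. flux p (Du x) \<bullet> axis i 1) \<in> borel_measurable lborel" by (intro borel_measurable_inner) auto
    then show "(\<lambda>x. flux p (Du x) $ i) \<in> borel_measurable lborel" by (simp add: inner_axis)
    fix R
    obtain C where C: "AE x in lborel. norm x \<le> R \<longrightarrow> norm (Du x) \<le> C" using bD by blast
    have "AE x in lborel. norm x \<le> R \<longrightarrow> \<bar>flux p (Du x) $ i\<bar> \<le> C powr (p - 1)"
      using C
    proof eventually_elim
      case (elim x)
      show ?case
      proof
        assume "norm x \<le> R"
        then have "norm (Du x) powr (p - 1) \<le> C powr (p - 1)" using elim p by (intro powr_mono2) auto
        moreover have "norm (flux p (Du x)) = norm (Du x) powr (p - 1)"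
          by (simp add: flux_def norm_powr_mult)
        ultimately show "\<bar>flux p (Du x) $ i\<bar> \<le> C powr (p - 1)"
          using component_le_norm_cart[of "flux p (Du x)" i] by linarith
      qed
    qed
    then show "\<exists>C. AE x in lborel. norm x \<le> R \<longrightarrow> \<bar>flux p (Du x) $ i\<bar> \<le> C" by blast
  qed
  have test: "(LINT x|lborel. flux p (Du x) \<bullet> grad \<phi> x) \<le> - (LINT x|lborel. b x * \<phi> x)"
    if t: "test_fun \<phi>" and nn: "\<And>x. \<phi> x \<ge> 0" for \<phi>
  proof -
    have s: "integrable lborel (plap_rhs f g u Du \<phi>)"
      "(LINT x|lborel. plap_lhs p Du \<phi> x) \<le> - (LINT x|lborel. plap_rhs f g u Du \<phi> x)"
      using sub t nn unfolding weak_subsolution_def by blast+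
    have "smooth_fun \<phi>" using t by (simp add: test_fun_def)
    then have "continuous_on UNIV \<phi>"
      using smooth_fun_has_derivative_grad has_derivative_continuous
      by (intro continuous_at_imp_continuous_on) blast
    then have "\<phi> \<in> borel_measurable lborel" using borel_measurable_continuous_onI by simp
    then have "(LINT x|lborel. plap_rhs f g u Du \<phi> x) = (LINT x|lborel. b x * \<phi> x)"
      using s(1) mb u0 by (intro integral_cong_AE) (auto simp: plap_rhs_def b_def elim!: eventually_mono)
    moreover have "plap_lhs p Du \<phi> = (\<lambda>x. flux p (Du x) \<bullet> grad \<phi> x)" by (simp add: plap_lhs_def flux_def)
    ultimately show ?thesis using s(2) by simp
  qed
  show "integrable lborel (\<lambda>x. flux p (Du x) \<bullet> G x) \<and>
      integrable lborel (\<lambda>x. b x * \<phi> x) \<and> (LINT x|lborel. flux p (Du x) \<bullet> G x) \<le> - (LINT x|lborel. b x * \<phi> x)"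
    if "C1c \<phi> G" "\<And>x. \<phi> x \<ge> 0"
    using weak_inequality_C1c[OF la lb test that] by blast
qed

text \<open>The bound at the centre is stated for mollifications because u itself has no value at a
  point. If it failed along a subsequence, the maxima of U j - V would have a limit M >= m0; the
  comparison improves u - V to at most M - \<eta> almost everywhere, and mollifying back near the
  maximum points contradicts M being that limit.\<close>

lemma subsolution_mollified_bound:
  fixes u :: "real^'n::finite \<Rightarrow> real" and x0 :: "real^'n"
  assumes p: "1 < p"
    and f: "continuous_on {0..} f" "strict_mono_on {0..} f" "f 0 = 0"
    and g_lip: "loc_lipschitz_nonneg g" and g: "strict_mono_on {0..} g" "g 0 = 0"
    and int: "(\<lambda>s. 1 / primF f s powr (1/p)) integrable_on {1..} \<or>
      (\<lambda>s. s powr (p - 2) / g s) integrable_on {1..}"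
    and Winf: "W1inf_loc u Du" and u0: "AE x in lborel. u x \<ge> 0" and sub: "weak_subsolution p f g u Du"
    and \<rho>: "\<And>j. mollifier (1 / real (Suc j)) (\<rho> j)"
    and \<epsilon>: "\<epsilon> > 0" and m0: "m0 > 0"
  shows "\<exists>N. \<forall>j\<ge>N. conv u (\<rho> j) x0 \<le> \<epsilon> + m0"
proof (rule ccontr)
  assume "\<not> ?thesis"
  then have "\<forall>N. \<exists>j\<ge>N. conv u (\<rho> j) x0 > \<epsilon> + m0" by (auto simp: not_le)
  then have "infinite {j. conv u (\<rho> j) x0 > \<epsilon> + m0}"
    unfolding infinite_nat_iff_unbounded_le by auto
  then obtain r0 :: "nat \<Rightarrow> nat" where r0: "strict_mono r0" "\<And>j. conv u (\<rho> (r0 j)) x0 > \<epsilon> + m0"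
    using infinite_enumerate by blast
  have cg: "continuous_on {0..} g" by (rule loc_lipschitz_nonneg_imp_continuous_on[OF g_lip])
  note F = primF_facts[OF f]
  note mu = W1inf_locD(1)[OF Winf] and mD = W1inf_locD(2)[OF Winf] and wg = W1inf_locD(3)[OF Winf]
    and bu = W1inf_locD(4)[OF Winf] and bD = W1inf_locD(5)[OF Winf]
  have mDi: "(\<lambda>x. Du x $ i) \<in> borel_measurable lborel" for i
  proof -
    have "(\<lambda>x. Du x \<bullet> axis i 1) \<in> borel_measurable lborel" using mD by (intro borel_measurable_inner) auto
    then show ?thesis by (simp add: inner_axis)
  qed
  have bDi: "\<exists>C. AE x in lborel. norm x \<le> R \<longrightarrow> \<bar>Du x $ i\<bar> \<le> C" for i R
  proof -
    obtain C where "AE x in lborel. norm x \<le> R \<longrightarrow> norm (Du x) \<le> C" using bD by blast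
    then have "AE x in lborel. norm x \<le> R \<longrightarrow> \<bar>Du x $ i\<bar> \<le> C"
      by eventually_elim (use component_le_norm_cart order.trans in blast)
    then show ?thesis by blast
  qed
  have lu: "loc_int u" by (rule bounded_imp_loc_int[OF mu bu])
  have lD: "loc_int (\<lambda>x. Du x $ i)" for i by (rule bounded_imp_loc_int[OF mDi bDi])

  obtain R where R: "R > 0" and rad: "\<And>K. K \<ge> 0 \<Longrightarrow> \<exists>v w h.
    continuous_on {0..} v \<and> continuous_on {0..} w \<and> continuous_on {0..} h \<and>
    (\<forall>r\<ge>0. v r = \<epsilon> + integral {0..r} (\<lambda>s. pinv p (w s)) \<and>
      w r = integral {0..r} (\<lambda>s. s ^ (CARD('n) - 1) * h s) / r ^ (CARD('n) - 1) \<and> 0 \<le> w r \<and> \<epsilon> \<le> v r \<and>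
      h r \<le> f (v r) + g (pinv p (w r))) \<and> (\<forall>r\<ge>R. K \<le> pinv p (w r))"
    by (rule radial_supersolution[OF p f cg g \<epsilon> int, of "CARD('n) - 1"]) blast
  \<comment> \<open>Points up to R + 2 from the centre are used, and mollification looks at most 1
    further.\<close>
  define Q where "Q = norm x0 + R + 3"
  obtain K0 where K0: "AE x in lborel. norm x \<le> Q \<longrightarrow> norm (Du x) \<le> K0" using bD by blast
  define K where "K = max 0 K0"
  have K: "K \<ge> 0" and KD: "AE x in lborel. norm x \<le> Q \<longrightarrow> norm (Du x) \<le> K"
    using K0 by (auto simp: K_def elim!: eventually_mono)
  \<comment> \<open>The slope is required to exceed K by 1: the surplus makes U j - V fall below its
    maximum by at least the distance travelled beyond R, not merely fail to grow.\<close>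
  obtain v w h where vwh: "continuous_on {0..} v" "continuous_on {0..} w" "continuous_on {0..} h"
    "\<forall>r\<ge>0. v r = \<epsilon> + integral {0..r} (\<lambda>s. pinv p (w s)) \<and>
      w r = integral {0..r} (\<lambda>s. s ^ (CARD('n) - 1) * h s) / r ^ (CARD('n) - 1) \<and> 0 \<le> w r \<and> \<epsilon> \<le> v r \<and>
      h r \<le> f (v r) + g (pinv p (w r))" "\<forall>r\<ge>R. K + 1 \<le> pinv p (w r)"
    using rad[of "K + 1"] K by auto
  have v: "v r = \<epsilon> + integral {0..r} (\<lambda>s. pinv p (w s))" and w: "w r = integral {0..r} (\<lambda>s. s ^ (CARD('n) - 1) * h s) / r ^ (CARD('n) - 1)"
    and w0: "0 \<le> w r" and v\<epsilon>: "\<epsilon> \<le> v r" and hle: "h r \<le> f (v r) + g (pinv p (w r))" if "r \<ge> 0" for r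
    using vwh(4) that by blast+
  have yK: "K + 1 \<le> pinv p (w r)" if "r \<ge> R" for r using vwh(5) that by blast
  have wz: "w 0 = 0" using w[of 0] by simp
  have y0: "pinv p (w 0) = 0" by (simp add: wz pinv_0)
  have cy: "continuous_on {0..} (\<lambda>s. pinv p (w s))"
    by (rule continuous_on_compose2[OF continuous_on_pinv[OF p] vwh(2)]) auto
  define V where "V x = v (norm (x - x0))" for x
  define DV where "DV x = (pinv p (w (norm (x - x0))) / norm (x - x0)) *\<^sub>R (x - x0)" for x
  have dV: "(V has_derivative (\<lambda>h. DV x \<bullet> h)) (at x)" and cDV: "continuous_on UNIV DV" for x
    using radial_gradient[OF cy y0 v, where ?x0.0 = x0] unfolding V_def[abs_def] DV_def[abs_def] by simp_all
  have cV: "continuous_on UNIV V"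
    using dV has_derivative_continuous by (intro continuous_at_imp_continuous_on) blast
  have nDV: "norm (DV x) = pinv p (w (norm (x - x0)))"
    and flDV: "flux p (DV x) = (w (norm (x - x0)) / norm (x - x0)) *\<^sub>R (x - x0)" for x
    using radial_flux[where w = w and x = "x - x0", OF p w0[OF norm_ge_zero] wz, folded DV_def]
    by (simp_all add: flux_def)
  have V\<epsilon>: "\<epsilon> \<le> V x" for x unfolding V_def by (rule v\<epsilon>) simp
  have Vx0: "V x0 = \<epsilon>" using v[of 0] by (simp add: V_def)

  define U where "U j = conv u (\<rho> j)" for j
  define GU where "GU j x = (\<chi> i. conv (\<lambda>y. Du y $ i) (\<rho> j) x)" for j x
  note Mo = mollifierD[OF \<rho>]
  have dU: "(U j has_derivative (\<lambda>h. GU j x \<bullet> h)) (at x)" for j x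
    using conv_has_derivative[OF lu Mo(6), of j x] conv_weak_gradient[OF wg \<rho>, of j _ x]
    by (simp add: U_def GU_def)
  have cU: "continuous_on UNIV (U j)" for j
    using dU has_derivative_continuous by (intro continuous_at_imp_continuous_on) blast
  have cGU: "continuous_on UNIV (GU j)" for j
    unfolding GU_def by (intro continuous_on_vec_lambda conv_continuous[OF lD Mo(7,3)])
  have nearby: "norm y \<le> Q" if "dist x x0 \<le> R + 2" "dist y x \<le> 1 / real (Suc j)" for x y j
  proof -
    have "1 / real (Suc j) \<le> 1" by simp
    moreover have "norm y \<le> norm x0 + dist x x0 + dist y x"
      using norm_triangle_ineq2[of y x] norm_triangle_ineq2[of x x0] by (simp add: dist_norm)
    ultimately show ?thesis using that unfolding Q_def by linarith
  qed
  have GUK: "norm (GU j x) \<le> K" if "dist x x0 \<le> R + 2" for j x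
    unfolding GU_def
  proof (rule norm_conv_vector_le[OF lD \<rho>])
    show "AE y in lborel. dist y x \<le> 1 / real (Suc j) \<longrightarrow> norm (Du y) \<le> K"
      using KD by eventually_elim (use nearby[OF that] in blast)
  qed
  have Lip: "\<bar>U j x - U j x'\<bar> \<le> K * dist x x'" if "dist x x0 \<le> R + 2" "dist x' x0 \<le> R + 2" for j x x'
  proof -
    have "norm (U j x - U j x') \<le> K * norm (x - x')"
    proof (rule differentiable_bound[where S = "cball x0 (R + 2)" and f' = "\<lambda>x h. GU j x \<bullet> h"])
      show "(U j has_derivative (\<lambda>h. GU j x \<bullet> h)) (at x within cball x0 (R + 2))" for x
        by (rule has_derivative_at_withinI[OF dU])
      show "onorm (\<lambda>h. GU j x \<bullet> h) \<le> K" if "x \<in> cball x0 (R + 2)" for x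
      proof (rule onorm_bound[OF K])
        fix h :: "real^'n"
        have "norm (GU j x \<bullet> h) \<le> norm (GU j x) * norm h" using Cauchy_Schwarz_ineq2 by simp
        also have "\<dots> \<le> K * norm h" using GUK[of x j] that by (intro mult_right_mono) (auto simp: dist_commute)
        finally show "norm (GU j x \<bullet> h) \<le> K * norm h" .
      qed
    qed (use that in \<open>auto simp: dist_commute\<close>)
    then show ?thesis by (simp add: dist_norm)
  qed
  \<comment> \<open>A maximum point exists for the continuous U j - V, while for u, given almost
    everywhere, it would be meaningless.\<close>
  have "\<forall>j. \<exists>z\<in>cball x0 (R + 1). \<forall>x\<in>cball x0 (R + 1). U j x - V x \<le> U j z - V z"
    using R by (intro allI continuous_attains_sup continuous_on_diff continuous_on_subset[OF cU] continuous_on_subset[OF cV]) auto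
  then obtain z where z: "\<And>j. z j \<in> cball x0 (R + 1)" "\<And>j x. x \<in> cball x0 (R + 1) \<Longrightarrow> U j x - V x \<le> U j (z j) - V (z j)"
    by metis
  define Mj where "Mj j = U j (z j) - V (z j)" for j
  have Mj: "U j x - V x \<le> Mj j" if "dist x x0 \<le> R + 1" for j x
    using z(2)[of x j] that by (simp add: Mj_def dist_commute)
  have vinc: "v R + (K + 1) * (r - R) \<le> v r" if "r \<ge> R" for r
  proof -
    have "v R - (K + 1) * R \<le> v r - (K + 1) * r"
    proof (rule DERIV_nonneg_imp_increasing_open[OF that, where f = "\<lambda>r. v r - (K + 1) * r"])
      fix x assume x: "R < x" "x < r"
      have "((\<lambda>r. v r - (K + 1) * r) has_real_derivative pinv p (w x) - (K + 1) * 1) (at x)"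
        by (intro DERIV_diff DERIV_cmult DERIV_ident primitive_has_real_derivative_at[OF cy _ v]) (use x R in auto)
      then show "\<exists>y. ((\<lambda>r. v r - (K + 1) * r) has_real_derivative y) (at x) \<and> 0 \<le> y"
        using yK[of x] x by (intro exI[of _ "pinv p (w x) - (K + 1) * 1"]) simp
    next
      show "continuous_on {R..r} (\<lambda>r. v r - (K + 1) * r)"
        by (intro continuous_intros continuous_on_subset[OF vwh(1)]) (use R in auto)
    qed
    then show ?thesis by (simp add: algebra_simps)
  qed
  \<comment> \<open>On the outer annulus \<open>V\<close> is steeper than the Lipschitz constant of \<open>U j\<close>.\<close>
  have edge: "U j x - V x \<le> Mj j - (dist x x0 - R)" if x: "R \<le> dist x x0" "dist x x0 \<le> R + 1" for j x
  proof -
    define t where "t = dist x x0"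
    have t: "t > 0" "R \<le> t" "t \<le> R + 1" using x R by (auto simp: t_def)
    \<comment> \<open>Radial projection of x onto the sphere of radius R; along this segment V grows
      at rate at least K + 1 and U j at rate at most K.\<close>
    define x' where "x' = x0 + (R / t) *\<^sub>R (x - x0)"
    have d1: "dist x' x0 = R" using t R by (simp add: x'_def dist_norm t_def)
    have "x - x' = (1 - R / t) *\<^sub>R (x - x0)" by (simp add: x'_def algebra_simps)
    then have "dist x x' = \<bar>1 - R / t\<bar> * t" by (simp add: dist_norm t_def)
    also have "\<dots> = t - R" using t by (simp add: field_simps)
    finally have d2: "dist x x' = t - R" .
    have "\<bar>U j x - U j x'\<bar> \<le> K * (t - R)" using Lip[of x x' j] d1 d2 t R by (simp add: t_def)
    moreover have "V x \<ge> V x' + (K + 1) * (t - R)"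
      using vinc[OF t(2)] d1 by (simp add: V_def t_def dist_norm)
    moreover have "U j x' - V x' \<le> Mj j" using Mj[of x' j] d1 by simp
    ultimately show ?thesis by (simp add: t_def algebra_simps)
  qed
  have zR: "dist (z j) x0 \<le> R" for j
  proof (rule ccontr)
    assume "\<not> dist (z j) x0 \<le> R"
    then show False using edge[of "z j" j] z(1)[of j] by (simp add: Mj_def dist_commute)
  qed

  obtain Cu where Cu: "AE x in lborel. norm x \<le> Q \<longrightarrow> \<bar>u x\<bar> \<le> Cu" using bu by blast
  obtain BV where BV: "\<And>x. dist x x0 \<le> R + 1 \<Longrightarrow> V x \<le> BV"
  proof -
    have "bounded (V ` cball x0 (R + 1))"
      by (intro compact_imp_bounded compact_continuous_image continuous_on_subset[OF cV]) auto
    then obtain B where B: "\<forall>y\<in>V ` cball x0 (R + 1). norm y \<le> B" unfolding bounded_iff by blast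
    show ?thesis
    proof (rule that[of B])
      fix x assume "dist x x0 \<le> R + 1"
      then have "norm (V x) \<le> B" using B by (simp add: dist_commute)
      then show "V x \<le> B" by simp
    qed
  qed
  have UC: "\<bar>U j x\<bar> \<le> Cu" if "dist x x0 \<le> R + 2" for j x
  proof -
    have "AE y in lborel. dist y x \<le> 1 / real (Suc j) \<longrightarrow> \<bar>u y - 0\<bar> \<le> Cu"
      using Cu by eventually_elim (use nearby[OF that] in auto)
    from conv_approx[OF lu \<rho> this] show ?thesis by (simp add: U_def)
  qed
  have "bounded (range (\<lambda>j. Mj (r0 j)))"
  proof (rule boundedI)
    fix y assume "y \<in> range (\<lambda>j. Mj (r0 j))"
    then obtain j where y: "y = Mj (r0 j)" by auto
    have "\<bar>U (r0 j) (z (r0 j))\<bar> \<le> Cu" using UC zR[of "r0 j"] by simp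
    moreover have "V (z (r0 j)) \<le> BV" using BV zR[of "r0 j"] by simp
    ultimately show "norm y \<le> Cu + BV" using V\<epsilon>[of "z (r0 j)"] \<epsilon> by (simp add: y Mj_def)
  qed
  then obtain M r1 where r1: "strict_mono r1" and M1: "(\<lambda>j. Mj (r0 (r1 j))) \<longlonglongrightarrow> M"
    using bounded_imp_convergent_subsequence[of "\<lambda>j. Mj (r0 j)"] by (auto simp: comp_def)
  \<comment> \<open>The extra index \<open>None\<close> stands for u itself, so that u and the
    components of Du share one subsequence.\<close>
  define k where "k i = (case i of None \<Rightarrow> u | Some i \<Rightarrow> (\<lambda>x. Du x $ i))" for i :: "'n option"
  obtain r2 where r2: "strict_mono r2" and
    AEc: "AE x in lborel. norm x \<le> Q \<longrightarrow> (\<forall>i. (\<lambda>j. conv (k i) (\<rho> ((r0 \<circ> r1) (r2 j))) x) \<longlonglongrightarrow> k i x)"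
  proof (rule mollification_AE_subseq[of k \<rho> "r0 \<circ> r1" Q])
    show "k i \<in> borel_measurable lborel" for i using mu mDi by (auto simp: k_def split: option.split)
    show "\<exists>C. AE x in lborel. norm x \<le> R \<longrightarrow> \<bar>k i x\<bar> \<le> C" for i R using bu bDi by (auto simp: k_def split: option.split)
    show "strict_mono (r0 \<circ> r1)" using r0(1) r1 by (rule strict_mono_o)
  qed (use \<rho> in auto)
  define \<sigma> where "\<sigma> j = r0 (r1 (r2 j))" for j
  have M: "(\<lambda>j. Mj (\<sigma> j)) \<longlonglongrightarrow> M"
    using LIMSEQ_subseq_LIMSEQ[OF M1 r2] by (simp add: comp_def \<sigma>_def)
  \<comment> \<open>At the centre V equals \<epsilon>, so the assumed excess of U j over \<epsilon>
    + m0 is an excess of U j - V over m0.\<close>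
  have Mm0: "M \<ge> m0"
  proof (rule LIMSEQ_le_const[OF M])
    have "m0 \<le> Mj (\<sigma> j)" for j
      using r0(2)[of "r1 (r2 j)"] Mj[of x0 "\<sigma> j"] Vx0 R by (simp add: U_def \<sigma>_def)
    then show "\<exists>N. \<forall>j\<ge>N. m0 \<le> Mj (\<sigma> j)" by blast
  qed

  have "continuous_on {0..R + 1} (\<lambda>s. pinv p (w s))" by (rule continuous_on_subset[OF cy]) auto
  from continuous_on_Icc_bounded_above[OF this]
  obtain Y where Y: "\<And>s. s \<in> {0..R + 1} \<Longrightarrow> pinv p (w s) \<le> Y" by blast
  \<comment> \<open>One bound for the gradients of u, U j and V on the ball, so that the Lipschitz
    constant of g and the flux estimate refer to the same range.\<close>
  define T where "T = max K Y"
  have T: "T \<ge> 0" "K \<le> T" "Y \<le> T" using K by (auto simp: T_def)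
  have DVT: "norm (DV x) \<le> T" if "dist x x0 \<le> R + 1" for x
    using Y[of "norm (x - x0)"] that T by (simp add: nDV dist_norm)
  obtain L where L: "L-lipschitz_on {0..T} g" using g_lip T(1) unfolding loc_lipschitz_nonneg_def by blast
  have L0: "L \<ge> 0" using L by (rule lipschitz_on_nonneg)
  \<comment> \<open>Strict monotonicity of f made quantitative by compactness: V takes values in
    [0, BV] on the ball, and a jump by m0/2 raises f by at least c throughout.\<close>
  obtain c where c: "c > 0" "\<And>t. 0 \<le> t \<Longrightarrow> t \<le> BV \<Longrightarrow> c \<le> f (t + m0 / 2) - f t"
  proof -
    have BV0: "BV \<ge> 0" using BV[of x0] Vx0 \<epsilon> R by simp
    have "continuous_on {0..BV} (\<lambda>t. f (t + m0 / 2) - f t)"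
      by (intro continuous_on_diff continuous_on_compose2[OF f(1)] continuous_on_subset[OF f(1)] continuous_intros) (use m0 in auto)
    then obtain t where t: "t \<in> {0..BV}" "\<And>t'. t' \<in> {0..BV} \<Longrightarrow> f (t + m0 / 2) - f t \<le> f (t' + m0 / 2) - f t'"
      using continuous_attains_inf[of "{0..BV}" "\<lambda>t. f (t + m0 / 2) - f t"] BV0 by auto
    have "f t < f (t + m0 / 2)" using strict_mono_onD[OF f(2), of t "t + m0 / 2"] t(1) m0 by auto
    then show ?thesis using that[of "f (t + m0 / 2) - f t"] t(2) by auto
  qed
  obtain \<eta>1 where \<eta>1: "\<eta>1 > 0" "\<And>s \<xi> \<zeta> :: real^'n. 0 \<le> s \<Longrightarrow> s \<le> \<eta>1 \<Longrightarrow> norm \<xi> \<le> T \<Longrightarrow> norm \<zeta> \<le> T \<Longrightarrow>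
    L * norm (\<xi> - \<zeta>) * s \<le> 2 * ((flux p \<xi> - flux p \<zeta>) \<bullet> (\<xi> - \<zeta>)) + c / 2 * s"
    by (rule flux_absorbs_linear[OF p L0 T(1) c(1), where 'a = "real^'n"]) (rule that; assumption)
  \<comment> \<open>\<eta>1 serves the absorption; 1/2 makes the positive part vanish from radius R
    + 1/2 on, where U j - V has dropped by at least 1/2; m0/2 ensures u - V > m0/2 wherever the
    limiting test function is positive.\<close>
  define \<eta> where "\<eta> = min \<eta>1 (min (1/2) (m0 / 2))"
  have \<eta>: "\<eta> > 0" "\<eta> \<le> \<eta>1" "\<eta> \<le> 1/2" "\<eta> \<le> m0 / 2" using \<eta>1 m0 by (auto simp: \<eta>_def)
  define b where "b x = f (max 0 (u x)) + g (norm (Du x))" for x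
  define bV where "bV x = f (V x) + g (norm (DV x))" for x
  note S = subsolution_C1c[OF p f(1) cg Winf u0 sub]
  have mb: "b \<in> borel_measurable lborel" unfolding b_def[abs_def] by (rule S(1))
  have bb: "\<exists>B. AE x in lborel. norm x \<le> Q \<longrightarrow> \<bar>b x\<bar> \<le> B" unfolding b_def by (rule S(2))
  have subC: "integrable lborel (\<lambda>x. flux p (Du x) \<bullet> G x) \<and>
      integrable lborel (\<lambda>x. b x * \<phi> x) \<and> (LINT x|lborel. flux p (Du x) \<bullet> G x) \<le> - (LINT x|lborel. b x * \<phi> x)"
    if "C1c \<phi> G" "\<And>x. \<phi> x \<ge> 0" for \<phi> G
    unfolding b_def by (rule S(3)[OF that])
  have cbV: "continuous_on UNIV bV"
    unfolding bV_def
  proof (intro continuous_on_add continuous_on_compose2[OF f(1) cV] continuous_on_compose2[OF cg])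
    have "V x \<ge> 0" for x using V\<epsilon>[of x] \<epsilon> by simp
    then show "V ` UNIV \<subseteq> {0..}" by auto
    show "continuous_on UNIV (\<lambda>x. norm (DV x))" by (intro continuous_on_norm cDV)
  qed auto
  have super: "integrable lborel (\<lambda>x. flux p (DV x) \<bullet> G x) \<and>
      integrable lborel (\<lambda>x. bV x * \<phi> x) \<and> (LINT x|lborel. flux p (DV x) \<bullet> G x) \<ge> - (LINT x|lborel. bV x * \<phi> x)"
    if C: "C1c \<phi> G" and nn: "\<And>x. \<phi> x \<ge> 0" for \<phi> G
  proof -
    obtain R' where R': "\<And>x. (\<phi> has_derivative (\<lambda>h. G x \<bullet> h)) (at x)" "continuous_on UNIV G" "continuous_on UNIV \<phi>"
      "R' \<ge> 0" "\<And>x. norm x > R' \<Longrightarrow> \<phi> x = 0" "\<And>x. norm x > R' \<Longrightarrow> G x = 0"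
      by (rule C1cE[OF C]) (rule that; assumption)
    note rd = radial_divergence[OF vwh(3,2) w C, where ?x0.0 = x0, folded flDV]
    have i: "integrable lborel (\<lambda>x. bV x * \<phi> x)"
      by (rule continuous_integrable_lborel[OF continuous_on_mult[OF cbV R'(3)], of R']) (simp add: R'(5))
    have "(LINT x|lborel. h (norm (x - x0)) * \<phi> x) \<le> (LINT x|lborel. bV x * \<phi> x)"
    proof (rule integral_mono[OF rd(3) i])
      fix x
      have "h (norm (x - x0)) \<le> bV x" unfolding bV_def nDV V_def by (rule hle) simp
      then show "h (norm (x - x0)) * \<phi> x \<le> bV x * \<phi> x" using nn by (rule mult_right_mono)
    qed
    then show ?thesis using rd i by simp
  qed
  have key: "AE x in lborel. x \<in> ball x0 (R + 1) \<longrightarrow> u x - V x \<le> M - \<eta>"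
  proof -
    obtain B1 where B1: "AE x in lborel. norm x \<le> Q \<longrightarrow> \<bar>b x\<bar> \<le> B1" using bb by blast
    obtain B2 where B2: "\<And>x. dist x x0 \<le> R + 1 \<Longrightarrow> \<bar>bV x\<bar> \<le> B2"
    proof -
      have "bounded (bV ` cball x0 (R + 1))"
        by (intro compact_imp_bounded compact_continuous_image continuous_on_subset[OF cbV]) auto
      then obtain B where B: "\<forall>y\<in>bV ` cball x0 (R + 1). norm y \<le> B" unfolding bounded_iff by blast
      show ?thesis
      proof (rule that[of B])
        fix x assume "dist x x0 \<le> R + 1"
        then show "\<bar>bV x\<bar> \<le> B" using B by (simp add: dist_commute)
      qed
    qed
    have inQ: "norm x \<le> Q" and inB: "dist x x0 \<le> R + 1" if "x \<in> ball x0 (R + 1)" for x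
    proof -
      show "dist x x0 \<le> R + 1" using that by (simp add: dist_commute)
      then show "norm x \<le> Q" using norm_triangle_ineq2[of x x0] by (simp add: Q_def dist_norm)
    qed
    show ?thesis
    proof (rule comparison_limit[where U = "\<lambda>j. U (\<sigma> j)" and GU = "\<lambda>j. GU (\<sigma> j)" and Mj = "\<lambda>j. Mj (\<sigma> j)" and
          b = b and bV = bV and Du = Du and DV = DV and T = T and B = "max B1 B2" and L = L, OF p c(1) subC super])
      fix j
      show "C1c (\<lambda>x. indicator (ball x0 (R + 1)) x * (max 0 (U (\<sigma> j) x - V x - (Mj (\<sigma> j) - \<eta>)))\<^sup>2)
        (\<lambda>x. indicator (ball x0 (R + 1)) x *\<^sub>R ((2 * max 0 (U (\<sigma> j) x - V x - (Mj (\<sigma> j) - \<eta>))) *\<^sub>R (GU (\<sigma> j) x - DV x)))"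
      proof (rule C1c_pos_square[where ?R1.0 = "R + 1/2"])
        show "((\<lambda>x. U (\<sigma> j) x - V x) has_derivative (\<lambda>h. (GU (\<sigma> j) x - DV x) \<bullet> h)) (at x)" for x
          using has_derivative_diff[OF dU dV] by (simp add: inner_diff_left)
        show "continuous_on UNIV (\<lambda>x. GU (\<sigma> j) x - DV x)" by (intro continuous_on_diff cGU cDV)
        show "U (\<sigma> j) x - V x \<le> Mj (\<sigma> j) - \<eta>" if "R + 1/2 \<le> dist x x0" "dist x x0 \<le> R + 1" for x
          using edge[of x "\<sigma> j"] that \<eta> by simp
      qed simp
    next
      show "AE x in lborel. x \<in> ball x0 (R + 1) \<longrightarrow> norm (Du x) \<le> T \<and> \<bar>b x\<bar> \<le> max B1 B2"
        using KD B1
      proof eventually_elim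
        case (elim x)
        then show ?case using inQ[of x] T by fastforce
      qed
      show "norm (DV x) \<le> T \<and> \<bar>bV x\<bar> \<le> max B1 B2" if "x \<in> ball x0 (R + 1)" for x
        using DVT[OF inB[OF that]] B2[OF inB[OF that]] by simp
      show "norm (GU (\<sigma> j) x) \<le> T \<and> U (\<sigma> j) x - V x \<le> Mj (\<sigma> j)" if "x \<in> ball x0 (R + 1)" for j x
        using GUK[of x "\<sigma> j"] Mj[of x "\<sigma> j"] inB[OF that] T by simp
      show "AE x in lborel. x \<in> ball x0 (R + 1) \<longrightarrow> (\<lambda>j. U (\<sigma> j) x) \<longlonglongrightarrow> u x \<and> (\<lambda>j. GU (\<sigma> j) x) \<longlonglongrightarrow> Du x"
        using AEc
      proof (eventually_elim, intro impI)
        fix x assume a: "norm x \<le> Q \<longrightarrow> (\<forall>i. (\<lambda>j. conv (k i) (\<rho> ((r0 \<circ> r1) (r2 j))) x) \<longlonglongrightarrow> k i x)" and x: "x \<in> ball x0 (R + 1)"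
        have a': "(\<lambda>j. conv (k i) (\<rho> (\<sigma> j)) x) \<longlonglongrightarrow> k i x" for i using a inQ[OF x] by (simp add: \<sigma>_def)
        have "(\<lambda>j. GU (\<sigma> j) x) \<longlonglongrightarrow> Du x"
          by (rule vec_tendstoI) (use a'[of "Some _"] in \<open>simp add: GU_def k_def\<close>)
        then show "(\<lambda>j. U (\<sigma> j) x) \<longlonglongrightarrow> u x \<and> (\<lambda>j. GU (\<sigma> j) x) \<longlonglongrightarrow> Du x"
          using a'[of None] by (simp add: U_def k_def)
      qed
      show "L * norm (\<xi> - \<zeta>) * s \<le> 2 * ((flux p \<xi> - flux p \<zeta>) \<bullet> (\<xi> - \<zeta>)) + c / 2 * s"
        if "0 \<le> s" "s \<le> \<eta>" "norm \<xi> \<le> T" "norm \<zeta> \<le> T" for s and \<xi> \<zeta> :: "real^'n"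
        using that \<eta> by (intro \<eta>1(2)) auto
      show "AE x in lborel. x \<in> ball x0 (R + 1) \<and> u x - V x > M - \<eta> \<longrightarrow> b x - bV x \<ge> c - L * norm (Du x - DV x)"
        using KD
      proof (eventually_elim, intro impI)
        fix x assume a: "norm x \<le> Q \<longrightarrow> norm (Du x) \<le> K" and x: "x \<in> ball x0 (R + 1) \<and> u x - V x > M - \<eta>"
        have nD: "norm (Du x) \<in> {0..T}" "norm (DV x) \<in> {0..T}" using a inQ[of x] DVT[OF inB[of x]] x T by auto
        have "u x \<ge> V x + m0 / 2" using x Mm0 \<eta>(4) by auto
        then have "f (V x + m0 / 2) \<le> f (max 0 (u x))" using V\<epsilon>[of x] \<epsilon> m0 by (intro F(6)) auto
        moreover have "c \<le> f (V x + m0 / 2) - f (V x)" using V\<epsilon>[of x] \<epsilon> BV[of x] inB[of x] x by (intro c(2)) auto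
        moreover have "dist (g (norm (Du x))) (g (norm (DV x))) \<le> L * dist (norm (Du x)) (norm (DV x))"
          by (rule lipschitz_onD[OF L nD])
        moreover have "L * dist (norm (Du x)) (norm (DV x)) \<le> L * norm (Du x - DV x)"
          using L0 norm_triangle_ineq3[of "Du x" "DV x"] by (intro mult_left_mono) (auto simp: dist_real_def)
        ultimately show "b x - bV x \<ge> c - L * norm (Du x - DV x)"
          unfolding b_def bV_def dist_real_def by linarith
      qed
    qed (use mu mD mb cV cDV cbV M \<eta>(1) borel_measurable_continuous_onI in auto)
  qed
  \<comment> \<open>At a maximum point z, U j averages u over a ball of radius 1/(j+1), where u <= V
    + M - \<eta> almost everywhere and V varies by less than \<eta>/4. Hence Mj <= M - 3\<eta>/4,
    which is impossible in the limit. The radius is also kept below 1/2, so that this ball, centred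
    within R of x0, stays in the ball of radius R + 1.\<close>
  have "uniformly_continuous_on (cball x0 (R + 1)) V"
    by (intro compact_uniformly_continuous continuous_on_subset[OF cV]) auto
  moreover have "\<eta> / 4 > 0" using \<eta> by simp
  ultimately obtain d1 where d1: "d1 > 0" "\<And>x y. x \<in> cball x0 (R + 1) \<Longrightarrow> y \<in> cball x0 (R + 1) \<Longrightarrow> dist y x < d1 \<Longrightarrow> dist (V y) (V x) < \<eta> / 4"
    unfolding uniformly_continuous_on_def by meson
  define dd where "dd = min d1 (1/2)"
  have dd: "dd > 0" using d1 by (simp add: dd_def)
  obtain N where N: "1 / real (Suc N) < dd" using nat_approx_posE[OF dd] by auto
  have \<sigma>mono: "strict_mono \<sigma>" unfolding \<sigma>_def[abs_def] using r0(1) r1 r2 by (auto simp: strict_mono_def)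
  have "Mj (\<sigma> j) \<le> M - 3 / 4 * \<eta>" if "j \<ge> N" for j
  proof -
    have "\<sigma> j \<ge> N" using seq_suble[OF \<sigma>mono, of j] that by simp
    then have "1 / real (Suc (\<sigma> j)) \<le> 1 / real (Suc N)" by (simp add: frac_le)
    then have small: "1 / real (Suc (\<sigma> j)) < dd" using N by linarith
    have "AE y in lborel. dist y (z (\<sigma> j)) \<le> 1 / real (Suc (\<sigma> j)) \<longrightarrow> u y \<le> V (z (\<sigma> j)) + (M - 3 / 4 * \<eta>)"
      using key
    proof (eventually_elim, intro impI)
      fix y assume a: "y \<in> ball x0 (R + 1) \<longrightarrow> u y - V y \<le> M - \<eta>" and y: "dist y (z (\<sigma> j)) \<le> 1 / real (Suc (\<sigma> j))"
      have "1 / real (Suc (\<sigma> j)) < d1" "1 / real (Suc (\<sigma> j)) < 1/2"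
        using small unfolding dd_def by (simp_all only: min_less_iff_conj)
      then have yz: "dist y (z (\<sigma> j)) < d1" "dist y (z (\<sigma> j)) < 1/2" using y by linarith+
      have "dist y x0 < R + 1" using dist_triangle[of y x0 "z (\<sigma> j)"] yz zR[of "\<sigma> j"] by linarith
      then have yB: "y \<in> ball x0 (R + 1)" by (simp add: dist_commute)
      have "dist (V y) (V (z (\<sigma> j))) < \<eta> / 4"
        using yB z(1)[of "\<sigma> j"] yz by (intro d1(2)) auto
      then have "V y - V (z (\<sigma> j)) < \<eta> / 4" unfolding dist_real_def by linarith
      moreover have "u y - V y \<le> M - \<eta>" using a yB by blast
      ultimately show "u y \<le> V (z (\<sigma> j)) + (M - 3 / 4 * \<eta>)" by linarith
    qed
    from conv_le[OF lu \<rho> this] show ?thesis by (simp add: Mj_def U_def)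
  qed
  then have "M \<le> M - 3 / 4 * \<eta>" by (intro LIMSEQ_le_const2[OF M]) auto
  then show False using \<eta> by simp
qed

text \<open>Every point serves as a centre, so the mollifications are eventually below any e > 0
  everywhere; almost everywhere convergence along a subsequence transfers this to u on each ball of
  integer radius, and countably many such balls cover the space.\<close>

lemma subsolution_zero:
  fixes u :: "real^'n::finite \<Rightarrow> real"
  assumes p: "1 < p"
    and f: "continuous_on {0..} f" "strict_mono_on {0..} f" "f 0 = 0"
    and g_lip: "loc_lipschitz_nonneg g" and g: "strict_mono_on {0..} g" "g 0 = 0"
    and int: "(\<lambda>s. 1 / primF f s powr (1/p)) integrable_on {1..} \<or>
      (\<lambda>s. s powr (p - 2) / g s) integrable_on {1..}"
    and Winf: "W1inf_loc u Du" and u0: "AE x in lborel. u x \<ge> 0" and sub: "weak_subsolution p f g u Du"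
  shows "AE x in lborel. u x = 0"
proof -
  obtain \<rho> :: "nat \<Rightarrow> real^'n \<Rightarrow> real" where \<rho>: "\<And>j. mollifier (1 / real (Suc j)) (\<rho> j)"
    by (rule mollifier_sequence_exists) (rule that; assumption)
  note mu = W1inf_locD(1)[OF Winf] and bu = W1inf_locD(4)[OF Winf]
  have "AE x in lborel. norm x \<le> real n \<longrightarrow> u x \<le> 0" for n
  proof -
    obtain r where r: "strict_mono r"
      and AEc: "AE x in lborel. norm x \<le> real n \<longrightarrow> (\<forall>i::unit. (\<lambda>j. conv u (\<rho> (id (r j))) x) \<longlonglongrightarrow> u x)"
      by (rule mollification_AE_subseq[of "\<lambda>_::unit. u" \<rho> id "real n"]) (use mu bu \<rho> in \<open>auto simp: strict_mono_def\<close>)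
    show ?thesis
      using AEc
    proof (eventually_elim, intro impI)
      fix x assume a: "norm x \<le> real n \<longrightarrow> (\<forall>i::unit. (\<lambda>j. conv u (\<rho> (id (r j))) x) \<longlonglongrightarrow> u x)" and x: "norm x \<le> real n"
      have lim: "(\<lambda>j. conv u (\<rho> (r j)) x) \<longlonglongrightarrow> u x" using a x by simp
      show "u x \<le> 0"
      proof (rule field_le_epsilon)
        fix e :: real assume "e > 0"
        then have e2: "e / 2 > 0" by simp
        obtain N where N: "\<And>j. j \<ge> N \<Longrightarrow> conv u (\<rho> j) x \<le> e / 2 + e / 2"
          using subsolution_mollified_bound[OF p f g_lip g int Winf u0 sub \<rho> e2 e2] by blast
        have "\<forall>j\<ge>N. conv u (\<rho> (r j)) x \<le> e"
        proof (intro allI impI)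
          fix j assume "j \<ge> N"
          then have "r j \<ge> N" using seq_suble[OF r, of j] by simp
          from N[OF this] show "conv u (\<rho> (r j)) x \<le> e" by simp
        qed
        then show "u x \<le> 0 + e" using LIMSEQ_le_const2[OF lim] by auto
      qed
    qed
  qed
  then have "AE x in lborel. \<forall>n. norm x \<le> real n \<longrightarrow> u x \<le> 0"
    by (intro AE_all_countable[THEN iffD2] allI)
  then show ?thesis
    using u0
  proof eventually_elim
    case (elim x)
    obtain n where "norm x \<le> real n" using real_arch_simple by blast
    then show ?case using elim by fastforce
  qed
qed

theorem theorem1p1:
  fixes p :: real and f g :: "real \<Rightarrow> real"
  assumes p: "1 < p"
    and f_cont: "continuous_on {0..} f" and f_mono: "strict_mono_on {0..} f" and f0: "f 0 = 0"
    and g_lip: "loc_lipschitz_nonneg g" and g_mono: "strict_mono_on {0..} g" and g0: "g 0 = 0"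
  shows
   "((\<lambda>s. 1 / primF f s powr (1/p)) integrable_on {1..} \<or>
     (\<lambda>s. s powr (p - 2) / g s) integrable_on {1..}
     \<longrightarrow> (\<forall>(u :: real^'n::finite \<Rightarrow> real) Du.
            W1inf_loc u Du \<and> (AE x in lborel. u x \<ge> 0) \<and> weak_subsolution p f g u Du
            \<longrightarrow> (AE x in lborel. u x = 0)))
    \<and>
    (\<not> (\<lambda>s. 1 / primF f s powr (1/p)) integrable_on {1..} \<and>
     \<not> (\<lambda>s. s powr (p - 2) / g s) integrable_on {1..} \<and>
     (\<exists>A0 \<epsilon>0. A0 > 0 \<and> \<epsilon>0 > 0 \<and> (\<forall>A\<ge>A0.
        (p \<le> 2 \<and> Liminf at_top (\<lambda>s. ereal (g (A * primF f s powr (1/p)) / (A powr p * f s)))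
                     > ereal (1/p + \<epsilon>0)) \<or>
        (p \<ge> 2 \<and> Limsup at_top (\<lambda>s. ereal (g (A * primF f s powr (1/p)) / (A powr p * f s)))
                     < ereal (1/p - \<epsilon>0))))
     \<longrightarrow> (\<exists>(u :: real^'n \<Rightarrow> real) Du. weak_solution p f g u Du \<and> (\<forall>x. u x > 0)))"
proof (intro conjI impI)
  assume int: "(\<lambda>s. 1 / primF f s powr (1/p)) integrable_on {1..} \<or> (\<lambda>s. s powr (p - 2) / g s) integrable_on {1..}"
  show "\<forall>(u :: real^'n \<Rightarrow> real) Du. W1inf_loc u Du \<and> (AE x in lborel. u x \<ge> 0) \<and> weak_subsolution p f g u Du
      \<longrightarrow> (AE x in lborel. u x = 0)"
    using subsolution_zero[OF p f_cont f_mono f0 g_lip g_mono g0 int] by blast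
next
  assume a: "\<not> (\<lambda>s. 1 / primF f s powr (1/p)) integrable_on {1..} \<and>
     \<not> (\<lambda>s. s powr (p - 2) / g s) integrable_on {1..} \<and>
     (\<exists>A0 \<epsilon>0. A0 > 0 \<and> \<epsilon>0 > 0 \<and> (\<forall>A\<ge>A0.
        (p \<le> 2 \<and> Liminf at_top (\<lambda>s. ereal (g (A * primF f s powr (1/p)) / (A powr p * f s)))
                     > ereal (1/p + \<epsilon>0)) \<or>
        (p \<ge> 2 \<and> Limsup at_top (\<lambda>s. ereal (g (A * primF f s powr (1/p)) / (A powr p * f s)))
                     < ereal (1/p - \<epsilon>0))))"
  then obtain A0 \<epsilon>0 where A0: "\<epsilon>0 > 0" "\<And>A. A \<ge> A0 \<Longrightarrow>
        (p \<le> 2 \<and> Liminf at_top (\<lambda>s. ereal (g (A * primF f s powr (1/p)) / (A powr p * f s)))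
                     > ereal (1/p + \<epsilon>0)) \<or>
        (p \<ge> 2 \<and> Limsup at_top (\<lambda>s. ereal (g (A * primF f s powr (1/p)) / (A powr p * f s)))
                     < ereal (1/p - \<epsilon>0))" by blast
  have cg: "continuous_on {0..} g" by (rule loc_lipschitz_nonneg_imp_continuous_on[OF g_lip])
  obtain s0 v w where vw: "s0 > 0" "continuous_on {0..} v" "continuous_on {0..} w"
    "\<And>r. r \<ge> 0 \<Longrightarrow> v r = s0 + integral {0..r} (\<lambda>s. pinv p (w s))"
    "\<And>r. r \<ge> 0 \<Longrightarrow> w r = integral {0..r} (\<lambda>s. s ^ (CARD('n) - 1) * (f (v s) + g (pinv p (w s)))) / r ^ (CARD('n) - 1)"
    "\<And>r. r \<ge> 0 \<Longrightarrow> 0 \<le> w r" "\<And>r. r \<ge> 0 \<Longrightarrow> s0 \<le> v r"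
    by (rule radial_global_solution[OF p f_cont f_mono f0 cg g_mono g0 conjunct1[OF a] conjunct1[OF conjunct2[OF a]] A0,
        where m = "CARD('n) - 1"]; (assumption | (rule that; assumption)))
  show "\<exists>(u :: real^'n \<Rightarrow> real) Du. weak_solution p f g u Du \<and> (\<forall>x. u x > 0)"
    by (rule radial_weak_solution[OF p f_cont cg vw])
qed

end
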